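(* Let $K$ be a field of characteristic $p>0$, $P_n=K[x_1,\ldots,x_n]$, $P_m=K[y_1,\ldots,y_m]$, and $A=\mathcal{D}(P_n)\otimes_KP_m$, where $\mathcal{D}(P_n)$ is the ring of differential operators on $P_n$. For each $\sigma\in\operatorname{Aut}_K(A)$ and each $a\in A$, $$\sigma^{-1}(a)=\sum_{\alpha,\beta\in\mathbb{N}^n,\,\gamma\in\mathbb{N}^m}(-1)^{|\alpha|}\phi_{P_m,\sigma}\Big({\partial_y'}^{[\gamma]}\big(\phi_{\mathcal{D},\sigma}({\delta'}^\beta(a)\,{\partial'}^{[\alpha]})\big)\Big)\,\partial^{[\beta]}x^\alpha y^\gamma$$ $$=\sum_{\alpha,\beta\in\mathbb{N}^n,\,\gamma\in\mathbb{N}^m}\phi_{P_m,\sigma}\Big({\partial_y'}^{[\gamma]}\big(\psi_{\mathcal{D},\sigma}({\partial'}^{[\alpha]}\,{\delta'}^\beta(a))\big)\Big)\,x^\alpha\partial^{[\beta]}y^\gamma ,$$ with all maps as defined in the context.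
   Context: $\mathbb{N}=\{0,1,\ldots\}$, $|\alpha|=\alpha_1+\cdots+\alpha_n$, $(\operatorname{ad}r)(s)=rs-sr$. The $K$-algebra $\mathcal{D}(P_n)$ is generated by $x_1,\ldots,x_n$ and higher derivations $\partial_i^{[k]}$, $1\le i\le n$, $k\ge1$, with defining relations $[x_i,x_j]=[\partial_i^{[k]},\partial_j^{[l]}]=0$, $\partial_i^{[k]}\partial_i^{[l]}=\binom{k+l}{k}\partial_i^{[k+l]}$, $[\partial_i^{[k]},x_j]=\delta_{ij}\partial_i^{[k-1]}$ ($\delta_{ij}$ Kronecker, $\partial_i^{[0]}:=1$). Put $x^\alpha=\prod x_i^{\alpha_i}$, $\partial^{[\beta]}=\prod\partial_i^{[\beta_i]}$, $y^\gamma=\prod y_j^{\gamma_j}$. The centre of $A$ is $P_m$, so $\sigma(P_m)=P_m$. Given $\sigma$, put $x_i':=\sigma(x_i)$, ${\partial_i'}^{[k]}:=\sigma(\partial_i^{[k]})$, $y_j':=\sigma(y_j)$ (so $P_m=K[y_1',\ldots,y_m']$), ${\partial'}^{[\alpha]}:=\prod_i{\partial_i'}^{[\alpha_i]}\in A$, ${\delta'}^\beta:=\prod_{i=1}^n(-\operatorname{ad}x_i')^{\beta_i}:A\to A$. Maps $\phi_{\mathcal{D},\sigma},\psi_{\mathcal{D},\sigma}:A\to P_m$. For $1\le i\le n$ let $\phi_i':=\sum_{k\ge0}{\partial_i'}^{[k]}(\operatorname{ad}x_i')^k$ and $\psi_i':=\sum_{k\ge0}(\operatorname{ad}x_i')^k(\cdot)\,{\partial_i'}^{[k]}$,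 as maps $A\to A$; the products $\phi_n'\cdots\phi_1'$ and $\psi_1'\cdots\psi_n'$ have image $S':=P_m[x_1',\ldots,x_n']$. For $1\le i\le n$ let $\phi_{n+i}':=\cdots\phi_{n+i,1}'\phi_{n+i,0}':S'\to S'$ with $\phi_{n+i,k}':=\sum_{j=0}^{p-1}(-1)^j\frac{{x_i'}^{p^kj}}{j!}(\operatorname{ad}{\partial_i'}^{[p^k]})^j$, acting on elements of $S'$ that involve $x_i'$ only through ${x_i'}^{p^k}$ (it maps these to elements involving $x_i'$ only through ${x_i'}^{p^{k+1}}$); on each element of $S'$ all but finitely many factors act as the identity. Then $\phi_{\mathcal{D},\sigma}:=\phi_{2n}'\cdots\phi_{n+1}'\phi_n'\cdots\phi_1'$ and $\psi_{\mathcal{D},\sigma}:=\phi_{2n}'\cdots\phi_{n+1}'\psi_1'\cdots\psi_n'$. Maps on $P_m$. ${\partial_y'}^{[\gamma]}=\prod_{j=1}^m{\partial_{y,j}'}^{[\gamma_j]}:P_m\to P_m$ are the higher derivations with respect to $y_1',\ldots,y_m'$: the $K$-linear maps ${y'}^\epsilon\mapsto\prod_j\binom{\epsilon_j}{\gamma_j}{y'}^{\epsilon-\gamma}$ ($0$ if some $\epsilon_j<\gamma_j$). For $1\le j\le m$, $k\ge0$ put $\theta_{j,k}:=\sum_{l=0}^{p-1}(-1)^l\frac{{y_j'}^{p^kl}}{l!}({\partial_{y,j}'}^{[p^k]})^l$ and $\theta_j:=\cdots\theta_{j,1}\theta_{j,0}:P_m\to P_m$ (if $u$ has degree $<p^{k+1}$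 in $y_j'$ then $\theta_j(u)=\theta_{j,k}\cdots\theta_{j,0}(u)$, further factors acting as the identity). The $\theta_j$ commute and $\phi_{P_m,\sigma}:=\prod_{j=1}^m\theta_j$. *)

theory Defs
  imports "HOL-Algebra.QuotRing" "HOL-Algebra.Module" "HOL-Library.Poly_Mapping"
begin

section \<open>Algebras over a field\<close>

text \<open>
  A unital associative algebra over the field \<open>'k\<close> is a record of type \<open>('k, 'a) module\<close>: a ring
  together with a scalar multiplication.  Indices \<open>1, \<dots>, n\<close> are shifted to \<open>0, \<dots>, n - 1\<close>,
  and \<open>n = 0\<close> is allowed.
\<close>

definition monoid_algebra :: "('a, 'b) monoid_scheme \<Rightarrow> ('k::field, 'a \<Rightarrow>\<^sub>0 'k) module" where
  "monoid_algebra M =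
    \<lparr>carrier = {f. Poly_Mapping.keys f \<subseteq> carrier M},
     monoid.mult = (\<lambda>f g. \<Sum>u\<in>Poly_Mapping.keys f. \<Sum>v\<in>Poly_Mapping.keys g.
        Poly_Mapping.single (u \<otimes>\<^bsub>M\<^esub> v) (Poly_Mapping.lookup f u * Poly_Mapping.lookup g v)),
     one = Poly_Mapping.single \<one>\<^bsub>M\<^esub> 1,
     zero = 0,
     add = (+),
     smult = (\<lambda>c. Poly_Mapping.map ((*) c))\<rparr>"

definition bas :: "'a \<Rightarrow> 'a \<Rightarrow>\<^sub>0 'k::field" where
  "bas u = Poly_Mapping.single u 1"

definition rel_ideal :: "('k, 'a) module \<Rightarrow> 'a set \<Rightarrow> 'a set" where
  "rel_ideal R S = Idl\<^bsub>R\<^esub> S"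

definition alg_quot :: "('k, 'a) module \<Rightarrow> 'a set \<Rightarrow> ('k, 'a set) module" where
  "alg_quot R S = (let Q = R Quot (rel_ideal R S) in
    \<lparr>carrier = carrier Q, monoid.mult = mult Q, one = one Q, zero = zero Q, add = add Q,
     smult = (\<lambda>c X. \<Union>x\<in>X. rel_ideal R S +>\<^bsub>R\<^esub> (c \<odot>\<^bsub>R\<^esub> x))\<rparr>)"

definition alg_cls :: "('k, 'a) module \<Rightarrow> 'a set \<Rightarrow> 'a \<Rightarrow> 'a set" where
  "alg_cls R S x = rel_ideal R S +>\<^bsub>R\<^esub> x"

text \<open>
  The tensor product of two \<open>'k\<close>-algebras.  The bilinearity relators are permuted, up to sign and
  scalars, by multiplication with a basis element \<open>(d, f)\<close>, so their linear span is already a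
  two-sided ideal.  Hence the underlying vector space is the free vector space on the set
  of pairs modulo bilinearity, with the product \<open>(d \<otimes> f) (d' \<otimes> f') = dd' \<otimes> ff'\<close>.
\<close>

definition tensor_rels :: "('k::field, 'a) module \<Rightarrow> ('k, 'b) module \<Rightarrow> ('a \<times> 'b \<Rightarrow>\<^sub>0 'k) set" where
  "tensor_rels D P =
     {bas (d \<oplus>\<^bsub>D\<^esub> d', f) - bas (d, f) - bas (d', f) | d d' f.
        d \<in> carrier D \<and> d' \<in> carrier D \<and> f \<in> carrier P}
   \<union> {bas (d, f \<oplus>\<^bsub>P\<^esub> f') - bas (d, f) - bas (d, f') | d f f'.
        d \<in> carrier D \<and> f \<in> carrier P \<and> f' \<in> carrier P}
   \<union> {bas (c \<odot>\<^bsub>D\<^esub> d, f) - Poly_Mapping.single (d, f) c | c d f. d \<in> carrier D \<and> f \<in> carrier P}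
   \<union> {bas (d, c \<odot>\<^bsub>P\<^esub> f) - Poly_Mapping.single (d, f) c | c d f. d \<in> carrier D \<and> f \<in> carrier P}"

definition alg_tensor ::
    "('k::field, 'a) module \<Rightarrow> ('k, 'b) module \<Rightarrow> ('k, ('a \<times> 'b \<Rightarrow>\<^sub>0 'k) set) module" where
  "alg_tensor D P = alg_quot (monoid_algebra (D \<times>\<times> P)) (tensor_rels D P)"

definition tens ::
    "('k::field, 'a) module \<Rightarrow> ('k, 'b) module \<Rightarrow> 'a \<Rightarrow> 'b \<Rightarrow> ('a \<times> 'b \<Rightarrow>\<^sub>0 'k) set" where
  "tens D P d f = alg_cls (monoid_algebra (D \<times>\<times> P)) (tensor_rels D P) (bas (d, f))"

definition alg_Aut :: "('k, 'a) module \<Rightarrow> ('a \<Rightarrow> 'a) set" where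
  "alg_Aut R = {\<sigma> \<in> ring_iso R R. \<forall>c. \<forall>a\<in>carrier R. \<sigma> (c \<odot>\<^bsub>R\<^esub> a) = c \<odot>\<^bsub>R\<^esub> \<sigma> a}"


section \<open>The algebra \<open>D(P\<^sub>n) \<otimes> P\<^sub>m\<close>\<close>

definition mindex :: "nat \<Rightarrow> (nat \<Rightarrow>\<^sub>0 nat) set" where
  "mindex n = {\<alpha>. Poly_Mapping.keys \<alpha> \<subseteq> {..<n}}"

definition poly_alg :: "nat \<Rightarrow> ('k::field, (nat \<Rightarrow>\<^sub>0 nat) \<Rightarrow>\<^sub>0 'k) module" where
  "poly_alg m = monoid_algebra \<lparr>carrier = mindex m, monoid.mult = (+), one = 0\<rparr>"

definition poly_var :: "nat \<Rightarrow> (nat \<Rightarrow>\<^sub>0 nat) \<Rightarrow>\<^sub>0 'k::field" where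
  "poly_var j = bas (Poly_Mapping.single j 1)"

definition commutator :: "('a, 'b) ring_scheme \<Rightarrow> 'a \<Rightarrow> 'a \<Rightarrow> 'a" where
  "commutator R r s = r \<otimes>\<^bsub>R\<^esub> s \<ominus>\<^bsub>R\<^esub> s \<otimes>\<^bsub>R\<^esub> r"

text \<open>\<open>GX i\<close> stands for \<open>x\<^sub>i\<close> and \<open>GD i k\<close>, \<open>k \<ge> 1\<close>, for the higher derivation \<open>\<partial>\<^sub>i\<^bsup>[k]\<^esup>\<close>.\<close>

datatype gen = GX nat | GD nat nat

definition gens :: "nat \<Rightarrow> gen set" where
  "gens n = {GX i | i. i < n} \<union> {GD i k | i k. i < n \<and> 1 \<le> k}"

definition free_alg :: "nat \<Rightarrow> ('k::field, gen list \<Rightarrow>\<^sub>0 'k) module" where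
  "free_alg n = monoid_algebra \<lparr>carrier = lists (gens n), monoid.mult = (@), one = []\<rparr>"

definition fX :: "nat \<Rightarrow> gen list \<Rightarrow>\<^sub>0 'k::field" where
  "fX i = bas [GX i]"

definition fD :: "nat \<Rightarrow> nat \<Rightarrow> gen list \<Rightarrow>\<^sub>0 'k::field" where
  "fD i k = (if k = 0 then bas [] else bas [GD i k])"

definition diff_rels :: "nat \<Rightarrow> (gen list \<Rightarrow>\<^sub>0 'k::field) set" where
  "diff_rels n = (let F = free_alg n in
     {commutator F (fX i) (fX j) | i j. i < n \<and> j < n}
   \<union> {commutator F (fD i k) (fD j l) | i j k l. i < n \<and> j < n \<and> 1 \<le> k \<and> 1 \<le> l}
   \<union> {fD i k \<otimes>\<^bsub>F\<^esub> fD i l \<ominus>\<^bsub>F\<^esub> of_nat ((k + l) choose k) \<odot>\<^bsub>F\<^esub> fD i (k + l) | i k l.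
        i < n \<and> 1 \<le> k \<and> 1 \<le> l}
   \<union> {commutator F (fD i k) (fX j) \<ominus>\<^bsub>F\<^esub> (if i = j then 1 else 0) \<odot>\<^bsub>F\<^esub> fD i (k - 1) | i j k.
        i < n \<and> j < n \<and> 1 \<le> k})"

text \<open>The ring of differential operators on \<open>P\<^sub>n\<close>, given by generators and defining relations.\<close>

type_synonym 'k dop = "(gen list \<Rightarrow>\<^sub>0 'k) set"

definition diff_ops :: "nat \<Rightarrow> ('k::field, 'k dop) module" where
  "diff_ops n = alg_quot (free_alg n) (diff_rels n)"

type_synonym 'k dpol = "('k dop \<times> ((nat \<Rightarrow>\<^sub>0 nat) \<Rightarrow>\<^sub>0 'k) \<Rightarrow>\<^sub>0 'k) set"

definition DP :: "nat \<Rightarrow> nat \<Rightarrow> ('k::field, 'k dpol) module" where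
  "DP n m = alg_tensor (diff_ops n) (poly_alg m)"

definition gen_x :: "nat \<Rightarrow> nat \<Rightarrow> nat \<Rightarrow> 'k::field dpol" where
  "gen_x n m i =
     tens (diff_ops n) (poly_alg m) (alg_cls (free_alg n) (diff_rels n) (fX i)) \<one>\<^bsub>poly_alg m\<^esub>"

definition gen_d :: "nat \<Rightarrow> nat \<Rightarrow> nat \<Rightarrow> nat \<Rightarrow> 'k::field dpol" where
  "gen_d n m i k =
     tens (diff_ops n) (poly_alg m) (alg_cls (free_alg n) (diff_rels n) (fD i k)) \<one>\<^bsub>poly_alg m\<^esub>"

definition gen_y :: "nat \<Rightarrow> nat \<Rightarrow> nat \<Rightarrow> 'k::field dpol" where
  "gen_y n m j = tens (diff_ops n) (poly_alg m) \<one>\<^bsub>diff_ops n\<^esub> (poly_var j)"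

definition sub_P :: "nat \<Rightarrow> nat \<Rightarrow> 'k::field dpol set" where
  "sub_P n m = tens (diff_ops n) (poly_alg m) \<one>\<^bsub>diff_ops n\<^esub> ` carrier (poly_alg m)"


section \<open>Infinite sums and products\<close>

text \<open>
  Sums of families with finite support.  When the support is infinite, \<open>fsum\<close> has the
  junk value zero; \<open>has_fsum\<close> also asserts that the support is finite.
\<close>

definition fsupp :: "('a, 'b) ring_scheme \<Rightarrow> ('i \<Rightarrow> 'a) \<Rightarrow> 'i set \<Rightarrow> 'i set" where
  "fsupp R f I = {i \<in> I. f i \<noteq> \<zero>\<^bsub>R\<^esub>}"

definition fsum :: "('a, 'b) ring_scheme \<Rightarrow> ('i \<Rightarrow> 'a) \<Rightarrow> 'i set \<Rightarrow> 'a" where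
  "fsum R f I = finsum R f (fsupp R f I)"

definition has_fsum :: "('a, 'b) ring_scheme \<Rightarrow> ('i \<Rightarrow> 'a) \<Rightarrow> 'i set \<Rightarrow> 'a \<Rightarrow> bool" where
  "has_fsum R f I s \<longleftrightarrow> finite (fsupp R f I) \<and> s = fsum R f I"

text \<open>The infinite product \<open>\<cdots> T\<^sub>1 T\<^sub>0\<close> of maps, applied to \<open>u\<close>: the eventually constant
  value of \<open>T\<^bsub>N-1\<^esub> \<cdots> T\<^sub>0 u\<close>.\<close>

definition inf_comp :: "(nat \<Rightarrow> 'a \<Rightarrow> 'a) \<Rightarrow> 'a \<Rightarrow> 'a" where
  "inf_comp T u = (THE v. \<forall>\<^sub>F N in sequentially. fold T [0..<N] u = v)"

text \<open>The ordered product \<open>f 0 \<otimes> \<cdots> \<otimes> f (n - 1)\<close>.\<close>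

definition oprod :: "('a, 'b) monoid_scheme \<Rightarrow> (nat \<Rightarrow> 'a) \<Rightarrow> nat \<Rightarrow> 'a" where
  "oprod R f n = foldr (\<lambda>i u. f i \<otimes>\<^bsub>R\<^esub> u) [0..<n] \<one>\<^bsub>R\<^esub>"


section \<open>The maps entering the inversion formula\<close>

text \<open>
  In this section \<open>R\<close> is the algebra, and \<open>x\<close>, \<open>d\<close> and \<open>y\<close> stand for the families \<open>x'\<^sub>i\<close>,
  \<open>\<partial>'\<^sub>i\<^bsup>[k]\<^esup>\<close> and \<open>y'\<^sub>j\<close>.
\<close>

definition mpow :: "('a, 'b) monoid_scheme \<Rightarrow> nat \<Rightarrow> (nat \<Rightarrow> 'a) \<Rightarrow> (nat \<Rightarrow>\<^sub>0 nat) \<Rightarrow> 'a" where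
  "mpow R n x \<alpha> = oprod R (\<lambda>i. x i [^]\<^bsub>R\<^esub> Poly_Mapping.lookup \<alpha> i) n"

definition dpow :: "('a, 'b) monoid_scheme \<Rightarrow> nat \<Rightarrow> (nat \<Rightarrow> nat \<Rightarrow> 'a) \<Rightarrow> (nat \<Rightarrow>\<^sub>0 nat) \<Rightarrow> 'a" where
  "dpow R n d \<alpha> = oprod R (\<lambda>i. d i (Poly_Mapping.lookup \<alpha> i)) n"

definition mdelta :: "('a, 'b) ring_scheme \<Rightarrow> nat \<Rightarrow> (nat \<Rightarrow> 'a) \<Rightarrow> (nat \<Rightarrow>\<^sub>0 nat) \<Rightarrow> 'a \<Rightarrow> 'a" where
  "mdelta R n x \<beta> =
     foldr (\<lambda>i. (\<lambda>s. \<ominus>\<^bsub>R\<^esub> commutator R (x i) s) ^^ Poly_Mapping.lookup \<beta> i) [0..<n]"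

definition phi_d :: "('a, 'b) ring_scheme \<Rightarrow> (nat \<Rightarrow> 'a) \<Rightarrow> (nat \<Rightarrow> nat \<Rightarrow> 'a) \<Rightarrow> nat \<Rightarrow> 'a \<Rightarrow> 'a" where
  "phi_d R x d i s = fsum R (\<lambda>k. d i k \<otimes>\<^bsub>R\<^esub> (commutator R (x i) ^^ k) s) UNIV"

definition psi_d :: "('a, 'b) ring_scheme \<Rightarrow> (nat \<Rightarrow> 'a) \<Rightarrow> (nat \<Rightarrow> nat \<Rightarrow> 'a) \<Rightarrow> nat \<Rightarrow> 'a \<Rightarrow> 'a" where
  "psi_d R x d i s = fsum R (\<lambda>k. (commutator R (x i) ^^ k) s \<otimes>\<^bsub>R\<^esub> d i k) UNIV"

text \<open>The number \<open>p\<close> is the characteristic of \<open>'k\<close>, so \<open>j!\<close> is invertible for \<open>j < p\<close>.\<close>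

definition phi_x_factor ::
    "nat \<Rightarrow> ('k::field, 'a) module \<Rightarrow> (nat \<Rightarrow> 'a) \<Rightarrow> (nat \<Rightarrow> nat \<Rightarrow> 'a) \<Rightarrow> nat \<Rightarrow> nat \<Rightarrow> 'a \<Rightarrow> 'a" where
  "phi_x_factor p R x d i k s =
     finsum R (\<lambda>j. ((-1) ^ j / of_nat (fact j)) \<odot>\<^bsub>R\<^esub>
       (x i [^]\<^bsub>R\<^esub> (p ^ k * j) \<otimes>\<^bsub>R\<^esub> (commutator R (d i (p ^ k)) ^^ j) s)) {..<p}"

definition phi_x ::
    "nat \<Rightarrow> ('k::field, 'a) module \<Rightarrow> (nat \<Rightarrow> 'a) \<Rightarrow> (nat \<Rightarrow> nat \<Rightarrow> 'a) \<Rightarrow> nat \<Rightarrow> 'a \<Rightarrow> 'a" where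
  "phi_x p R x d i = inf_comp (phi_x_factor p R x d i)"

text \<open>
  \<open>fold f [0..<n]\<close> applies \<open>f 0\<close> first, whereas \<open>foldr f [0..<n]\<close> applies \<open>f (n - 1)\<close> first.
\<close>

definition phi_D ::
    "nat \<Rightarrow> ('k::field, 'a) module \<Rightarrow> nat \<Rightarrow> (nat \<Rightarrow> 'a) \<Rightarrow> (nat \<Rightarrow> nat \<Rightarrow> 'a) \<Rightarrow> 'a \<Rightarrow> 'a" where
  "phi_D p R n x d a = fold (phi_x p R x d) [0..<n] (fold (phi_d R x d) [0..<n] a)"

definition psi_D ::
    "nat \<Rightarrow> ('k::field, 'a) module \<Rightarrow> nat \<Rightarrow> (nat \<Rightarrow> 'a) \<Rightarrow> (nat \<Rightarrow> nat \<Rightarrow> 'a) \<Rightarrow> 'a \<Rightarrow> 'a" where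
  "psi_D p R n x d a = fold (phi_x p R x d) [0..<n] (foldr (psi_d R x d) [0..<n] a)"

text \<open>
  The higher derivation \<open>\<partial>'\<^sub>y\<^bsup>[\<gamma>]\<^esup>\<close> of the polynomial algebra \<open>P\<close> in the variables \<open>y\<close>: the unique linear
  map with the given values on monomials.  If \<open>\<epsilon>\<^sub>j < \<gamma>\<^sub>j\<close> for some \<open>j\<close>, the binomial coefficient
  vanishes, and the truncated difference of the exponents is irrelevant.
  In the application \<open>P = P\<^sub>m\<close>, which is also \<open>K[y'\<^sub>1, \<dots>, y'\<^sub>m]\<close>, being the centre of the algebra.
\<close>

definition hderiv ::
    "('k::field, 'a) module \<Rightarrow> 'a set \<Rightarrow> nat \<Rightarrow> (nat \<Rightarrow> 'a) \<Rightarrow> (nat \<Rightarrow>\<^sub>0 nat) \<Rightarrow> 'a \<Rightarrow> 'a" where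
  "hderiv R P m y \<gamma> = (THE D. D \<in> P \<rightarrow>\<^sub>E P \<and>
     (\<forall>u\<in>P. \<forall>v\<in>P. D (u \<oplus>\<^bsub>R\<^esub> v) = D u \<oplus>\<^bsub>R\<^esub> D v) \<and>
     (\<forall>c. \<forall>u\<in>P. D (c \<odot>\<^bsub>R\<^esub> u) = c \<odot>\<^bsub>R\<^esub> D u) \<and>
     (\<forall>\<epsilon>\<in>mindex m. D (mpow R m y \<epsilon>) =
        of_nat (\<Prod>j<m. Poly_Mapping.lookup \<epsilon> j choose Poly_Mapping.lookup \<gamma> j)
          \<odot>\<^bsub>R\<^esub> mpow R m y (\<epsilon> - \<gamma>)))"

definition theta_factor ::
    "nat \<Rightarrow> ('k::field, 'a) module \<Rightarrow> 'a set \<Rightarrow> nat \<Rightarrow> (nat \<Rightarrow> 'a) \<Rightarrow> nat \<Rightarrow> nat \<Rightarrow> 'a \<Rightarrow> 'a" where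
  "theta_factor p R P m y j k u =
     finsum R (\<lambda>l. ((-1) ^ l / of_nat (fact l)) \<odot>\<^bsub>R\<^esub>
       (y j [^]\<^bsub>R\<^esub> (p ^ k * l) \<otimes>\<^bsub>R\<^esub> (hderiv R P m y (Poly_Mapping.single j (p ^ k)) ^^ l) u)) {..<p}"

definition theta ::
    "nat \<Rightarrow> ('k::field, 'a) module \<Rightarrow> 'a set \<Rightarrow> nat \<Rightarrow> (nat \<Rightarrow> 'a) \<Rightarrow> nat \<Rightarrow> 'a \<Rightarrow> 'a" where
  "theta p R P m y j = inf_comp (theta_factor p R P m y j)"

definition phi_P ::
    "nat \<Rightarrow> ('k::field, 'a) module \<Rightarrow> 'a set \<Rightarrow> nat \<Rightarrow> (nat \<Rightarrow> 'a) \<Rightarrow> 'a \<Rightarrow> 'a" where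
  "phi_P p R P m y = fold (theta p R P m y) [0..<m]"

definition mdeg :: "nat \<Rightarrow> (nat \<Rightarrow>\<^sub>0 nat) \<Rightarrow> nat" where
  "mdeg n \<alpha> = (\<Sum>i<n. Poly_Mapping.lookup \<alpha> i)"

end

theory Submission
  imports Defs "HOL-Computational_Algebra.Primes"
begin

text \<open>
  Let \<open>x'\<close>, \<open>d'\<close>, \<open>y'\<close> be the images of the standard generators under \<open>\<sigma>\<close>.  If \<open>a\<close> is written in the
  form \<open>a = \<Sum> \<lambda> \<partial>'\<^bsup>[\<beta>]\<^esup> x'\<^sup>\<alpha> y'\<^sup>\<gamma>\<close> with scalars \<open>\<lambda> = \<lambda>(\<alpha>, \<beta>, \<gamma>)\<close>, then \<open>\<sigma>\<inverse>(a) = \<Sum> \<lambda> \<partial>\<^bsup>[\<beta>]\<^esup> x\<^sup>\<alpha> y\<^sup>\<gamma>\<close>.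
  So the first formula says that the maps \<open>\<phi>\<close> compute the coefficients of \<open>a\<close> in the coordinates
  \<open>x'\<close>, \<open>d'\<close>, \<open>y'\<close>, and the second one says the same for \<open>\<psi>\<close> and the opposite normal ordering.

  The coefficient extraction works as follows.  The map \<open>\<delta>'\<^sup>\<beta>\<close> lowers \<open>\<partial>'\<^bsup>[\<beta>']\<^esup>\<close> to \<open>\<partial>'\<^bsup>[\<beta>' - \<beta>]\<^esup>\<close>.
  After multiplication from the right by \<open>\<partial>'\<^bsup>[\<alpha>]\<^esup>\<close> and normal ordering, the part without derivations is
  \<open>(-1)\<^bsup>|\<alpha>|\<^esup> (\<alpha>' choose \<alpha>) x'\<^bsup>\<alpha>' - \<alpha>\<^esup>\<close> if \<open>\<beta>' = \<beta>\<close>, and zero otherwise.  The maps \<open>phi_d\<close>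
  isolate this part: they kill \<open>\<partial>'\<^sub>i\<^bsup>[l]\<^esup> u\<close> for \<open>l > 0\<close>, since the alternating sum of the binomial
  coefficients \<open>l choose k\<close> vanishes (\<open>phi_d_d\<close>, \<open>phi_d_normal\<close>; \<open>psi_d_normal\<close> for \<open>\<psi>\<close>).
  The maps \<open>phi_x\<close> then kill every positive power of \<open>x'\<^sub>i\<close> (\<open>phi_x_pow\<close>), which leaves
  \<open>\<alpha>' = \<alpha>\<close>.  The reason is that on a polynomial in \<open>x'\<^sub>i\<^bsup>q\<^esup>\<close> with \<open>q = p\<^sup>k\<close> the commutator with
  \<open>\<partial>'\<^sub>i\<^bsup>[q]\<^esup>\<close> acts as the derivative with respect to \<open>x'\<^sub>i\<^bsup>q\<^esup>\<close>, so that the \<open>k\<close>-th factor multiplies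
  \<open>x'\<^sub>i\<^bsup>q b\<^esup>\<close> by the sum of \<open>(-1)\<^sup>j (b choose j)\<close> over \<open>j < p\<close>, which is \<open>1\<close> in characteristic \<open>p\<close> if
  \<open>p\<close> divides \<open>b\<close> and \<open>0\<close> otherwise (\<open>truncated_exponential\<close>).  The same sieve in the variables
  \<open>y'\<close>, applied after a higher derivation, reads off the coefficient of \<open>y'\<^sup>\<gamma>\<close> (\<open>y_coeff_Y\<close>).

  All these maps are linear, and the normally ordered monomials span the algebra.  Hence the
  expansion of \<open>a\<close> only has to be checked when \<open>a\<close> is itself such a monomial (\<open>expansion\<close>).

  The argument is carried out in a locale \<open>weyl\<close>, whose axioms are the defining relations,
  generation, and the existence of the higher derivations on the subalgebra \<open>P\<close> of polynomials
  in \<open>y\<close>.  For the standard coordinates the higher derivations exist because a linear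
  endomorphism of one tensor factor extends to the tensor product (\<open>tens_one_map_well_defined\<close>).
  For the primed coordinates they are transported by \<open>\<sigma>\<close>, which maps \<open>P\<close> to itself since \<open>P\<close> is
  the centre.  The latter is a first application of the expansion: if \<open>b\<close> is central, then all
  terms with \<open>(\<alpha>, \<beta>) \<noteq> (0, 0)\<close> vanish (\<open>centre_eq_P\<close>).
\<close>

section \<open>Algebras over a field\<close>

abbreviation lookup :: "('a \<Rightarrow>\<^sub>0 'b::zero) \<Rightarrow> 'a \<Rightarrow> 'b" where
  "lookup \<equiv> Poly_Mapping.lookup"

abbreviation single :: "'a \<Rightarrow> 'b \<Rightarrow> 'a \<Rightarrow>\<^sub>0 'b::zero" where
  "single \<equiv> Poly_Mapping.single"

abbreviation keys :: "('a \<Rightarrow>\<^sub>0 'b::zero) \<Rightarrow> 'a set" where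
  "keys \<equiv> Poly_Mapping.keys"

text \<open>
  Unital associative algebras over the field \<open>'k\<close>; the multiplication need not be commutative.
\<close>

locale kalg = ring A for A :: "('k::field, 'a) module" (structure) +
  assumes smult_closed [simp, intro]: "x \<in> carrier A \<Longrightarrow> c \<odot> x \<in> carrier A"
    and smult_l_distr: "x \<in> carrier A \<Longrightarrow> (c + d) \<odot> x = c \<odot> x \<oplus> d \<odot> x"
    and smult_r_distr: "x \<in> carrier A \<Longrightarrow> y \<in> carrier A \<Longrightarrow> c \<odot> (x \<oplus> y) = c \<odot> x \<oplus> c \<odot> y"
    and smult_assoc1: "x \<in> carrier A \<Longrightarrow> (c * d) \<odot> x = c \<odot> (d \<odot> x)"
    and smult_one [simp]: "x \<in> carrier A \<Longrightarrow> 1 \<odot> x = x"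
    and smult_mult_left: "x \<in> carrier A \<Longrightarrow> y \<in> carrier A \<Longrightarrow> (c \<odot> x) \<otimes> y = c \<odot> (x \<otimes> y)"
    and smult_mult_right: "x \<in> carrier A \<Longrightarrow> y \<in> carrier A \<Longrightarrow> x \<otimes> (c \<odot> y) = c \<odot> (x \<otimes> y)"
begin

lemma smult_0_left [simp]: "x \<in> carrier A \<Longrightarrow> 0 \<odot> x = \<zero>"
  using smult_l_distr[of x 0 0] by (simp add: add.r_cancel_one')

lemma smult_0_right [simp]: "c \<odot> \<zero> = \<zero>"
  using smult_r_distr[of \<zero> \<zero> c] by (simp add: add.r_cancel_one')

lemma smult_minus1: assumes "x \<in> carrier A" shows "(-1) \<odot> x = \<ominus> x"
proof -
  have "(-1) \<odot> x \<oplus> x = \<zero>"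
    using smult_l_distr[of x "-1" 1] assms by simp
  then show ?thesis using assms
    by (metis minus_equality smult_closed)
qed

end

abbreviation scal :: "'k::field \<Rightarrow> ('a \<Rightarrow>\<^sub>0 'k) \<Rightarrow> 'a \<Rightarrow>\<^sub>0 'k" where
  "scal c \<equiv> Poly_Mapping.map ((*) c)"

text \<open>
  The product of a monoid algebra, the maps on the factors of a tensor product and the higher
  derivations of a polynomial algebra are all obtained by linear extension from a basis.
\<close>

definition lin_ext :: "('a \<Rightarrow> 'b \<Rightarrow>\<^sub>0 'k::field) \<Rightarrow> ('a \<Rightarrow>\<^sub>0 'k) \<Rightarrow> 'b \<Rightarrow>\<^sub>0 'k" where
  "lin_ext h f = (\<Sum>u\<in>keys f. scal (lookup f u) (h u))"

lemma lookup_scal: "lookup (scal c f) u = c * lookup f u"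
  by (simp add: map.rep_eq when_def)

lemma scal_simps:
  "scal c (f + g) = scal c f + scal c g" "scal (c + d) f = scal c f + scal d f"
  "scal (c * d) f = scal c (scal d f)" "scal 1 f = f" "scal c 0 = 0" "scal 0 f = 0"
  "scal c (single u d) = single u (c * d)"
  by (auto intro!: poly_mapping_eqI simp: lookup_scal lookup_add algebra_simps lookup_single when_def)

lemma scal_sum: "scal c (sum F X) = (\<Sum>x\<in>X. scal c (F x))"
  by (intro poly_mapping_eqI) (simp add: lookup_scal lookup_sum sum_distrib_left)

lemma lin_ext_superset:
  assumes "finite X" "keys f \<subseteq> X"
  shows "lin_ext h f = (\<Sum>u\<in>X. scal (lookup f u) (h u))"
  unfolding lin_ext_def
  by (rule sum.mono_neutral_left) (use assms in \<open>auto simp: scal_simps in_keys_iff\<close>)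

lemma lin_ext_add: "lin_ext h (f + g) = lin_ext h f + lin_ext h g"
proof -
  let ?X = "keys f \<union> keys g"
  have "lin_ext h (f + g) = (\<Sum>u\<in>?X. scal (lookup (f + g) u) (h u))"
    by (rule lin_ext_superset) (use keys_add[of f g] in auto)
  also have "\<dots> = (\<Sum>u\<in>?X. scal (lookup f u) (h u)) + (\<Sum>u\<in>?X. scal (lookup g u) (h u))"
    by (simp add: lookup_add scal_simps sum.distrib)
  also have "\<dots> = lin_ext h f + lin_ext h g"
    by (simp add: lin_ext_superset[of ?X])
  finally show ?thesis .
qed

lemma keys_scal: "keys (scal c f) \<subseteq> keys f"
  by (auto simp: in_keys_iff lookup_scal)

lemma lin_ext_scal: "lin_ext h (scal c f) = scal c (lin_ext h f)"
proof -
  have "lin_ext h (scal c f) = (\<Sum>u\<in>keys f. scal (lookup (scal c f) u) (h u))"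
    by (rule lin_ext_superset) (use keys_scal[of c f] in auto)
  then show ?thesis
    by (simp add: lin_ext_def lookup_scal scal_sum scal_simps)
qed

lemma lin_ext_single: "lin_ext h (single u c) = scal c (h u)"
  by (simp add: lin_ext_superset[of "{u}"])

lemma lin_ext_zero: "lin_ext h 0 = 0"
  by (simp add: lin_ext_def)

lemma lin_ext_bas: "lin_ext h (bas u) = h u"
  by (simp add: bas_def lin_ext_single scal_simps)

lemma lin_ext_fun_add: "lin_ext (\<lambda>u. h u + k u) f = lin_ext h f + lin_ext k f"
  by (simp add: lin_ext_def scal_simps sum.distrib)

lemma lin_ext_minus: "lin_ext h (f - g) = lin_ext h f - lin_ext h g"
  using lin_ext_add[of h "f - g" g] by (simp add: algebra_simps)

lemma keys_lin_ext: "(\<And>u. u \<in> keys f \<Longrightarrow> keys (h u) \<subseteq> C) \<Longrightarrow> keys (lin_ext h f) \<subseteq> C"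
  unfolding lin_ext_def
  by (rule order.trans[OF keys_sum]) (use keys_scal in fastforce)

lemma poly_mapping_expand: "f = (\<Sum>u\<in>keys f. single u (lookup f u))"
proof (rule poly_mapping_eqI)
  fix v
  show "lookup f v = lookup (\<Sum>u\<in>keys f. single u (lookup f u)) v"
    by (auto simp: lookup_sum lookup_single when_def in_keys_iff sum.delta)
qed

text \<open>
  Every element of a monoid algebra is a sum of multiples of basis elements, so additive
  statements can be reduced to the basis.
\<close>

lemma poly_mapping_span_induct [consumes 1, case_names zero single add]:
  assumes "keys f \<subseteq> C"
    and "P 0"
    and "\<And>u c. u \<in> C \<Longrightarrow> P (single u c)"
    and "\<And>f g. keys f \<subseteq> C \<Longrightarrow> keys g \<subseteq> C \<Longrightarrow> P f \<Longrightarrow> P g \<Longrightarrow> P (f + g)"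
  shows "P (f :: 'a \<Rightarrow>\<^sub>0 'k::field)"
proof -
  have "keys (\<Sum>u\<in>X. single u (lookup f u)) \<subseteq> C \<and>
      P (\<Sum>u\<in>X. single u (lookup f u))"
    if "finite X" "X \<subseteq> C" for X
    using that
  proof (induction X)
    case (insert u X)
    have u: "keys (single u (lookup f u)) \<subseteq> C"
      using insert by auto
    let ?s = "\<Sum>u\<in>X. single u (lookup f u)"
    have IH: "keys ?s \<subseteq> C" "P ?s" using insert by auto
    have "P (single u (lookup f u) + ?s)"
      using insert u IH assms(3) by (intro assms(4)) auto
    moreover have "keys (single u (lookup f u) + ?s) \<subseteq> C"
      using u IH(1) by (intro order.trans[OF keys_add] Un_least)
    ultimately show ?case
      using insert.hyps by simp
  qed (use assms in auto)
  from this[of "keys f"] show ?thesis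
    using assms(1) by (simp flip: poly_mapping_expand)
qed

section \<open>Monoid algebras\<close>

lemma monoid_algebra_mult:
  "f \<otimes>\<^bsub>monoid_algebra M\<^esub> g = lin_ext (\<lambda>u. lin_ext (\<lambda>v. bas (u \<otimes>\<^bsub>M\<^esub> v)) g) f"
  by (simp add: monoid_algebra_def lin_ext_def scal_sum bas_def scal_simps)

lemma monoid_algebra_sel:
  "carrier (monoid_algebra M) = {f. keys f \<subseteq> carrier M}"
  "\<one>\<^bsub>monoid_algebra M\<^esub> = bas \<one>\<^bsub>M\<^esub>" "\<zero>\<^bsub>monoid_algebra M\<^esub> = 0"
  "f \<oplus>\<^bsub>monoid_algebra M\<^esub> g = f + g" "c \<odot>\<^bsub>monoid_algebra M\<^esub> f = scal c f"
  by (simp_all add: monoid_algebra_def bas_def)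

lemma monoid_algebra_mult_add:
  "(f + f') \<otimes>\<^bsub>monoid_algebra M\<^esub> g = f \<otimes>\<^bsub>monoid_algebra M\<^esub> g + f' \<otimes>\<^bsub>monoid_algebra M\<^esub> g"
  "g \<otimes>\<^bsub>monoid_algebra M\<^esub> (f + f') = g \<otimes>\<^bsub>monoid_algebra M\<^esub> f + g \<otimes>\<^bsub>monoid_algebra M\<^esub> f'"
  by (simp_all add: monoid_algebra_mult lin_ext_add lin_ext_fun_add)

lemma monoid_algebra_mult_scal:
  "scal c f \<otimes>\<^bsub>monoid_algebra M\<^esub> g = scal c (f \<otimes>\<^bsub>monoid_algebra M\<^esub> g)"
  "g \<otimes>\<^bsub>monoid_algebra M\<^esub> scal c f = scal c (g \<otimes>\<^bsub>monoid_algebra M\<^esub> f)"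
  by (simp_all add: monoid_algebra_mult lin_ext_scal)
    (simp add: lin_ext_def scal_sum mult.left_commute flip: scal_simps(3))

lemma monoid_algebra_mult_zero [simp]:
  "0 \<otimes>\<^bsub>monoid_algebra M\<^esub> g = 0" "g \<otimes>\<^bsub>monoid_algebra M\<^esub> 0 = 0"
  by (simp_all add: monoid_algebra_mult lin_ext_zero) (simp add: lin_ext_def scal_simps)

lemma monoid_algebra_mult_single:
  "single u c \<otimes>\<^bsub>monoid_algebra M\<^esub> single v d
    = single (u \<otimes>\<^bsub>M\<^esub> v) (c * d)"
  by (simp add: monoid_algebra_mult lin_ext_single bas_def scal_simps)

lemma monoid_algebra_mult_bas:
  "bas u \<otimes>\<^bsub>monoid_algebra M\<^esub> bas v = bas (u \<otimes>\<^bsub>M\<^esub> v)"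
  by (simp add: bas_def monoid_algebra_mult_single)

text \<open>
  The product is bilinear, hence the associative law and the unit laws are inherited from the monoid.
\<close>

lemma kalg_monoid_algebra:
  assumes "monoid M"
  shows "kalg (monoid_algebra M :: ('k::field, _) module)"
proof -
  interpret M: monoid M by fact
  let ?A = "monoid_algebra M :: ('k::field, _) module"
  have closed: "f \<otimes>\<^bsub>?A\<^esub> g \<in> carrier ?A" if "f \<in> carrier ?A" "g \<in> carrier ?A" for f g
  proof -
    have "u \<otimes>\<^bsub>M\<^esub> v \<in> carrier M" if "u \<in> keys f" "v \<in> keys g" for u v
      using that \<open>f \<in> _\<close> \<open>g \<in> _\<close> by (auto simp: monoid_algebra_sel)
    then have "keys (f \<otimes>\<^bsub>?A\<^esub> g) \<subseteq> carrier M"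
      unfolding monoid_algebra_mult by (intro keys_lin_ext) (simp add: bas_def)
    then show ?thesis by (simp add: monoid_algebra_sel)
  qed
  have assoc: "f \<otimes>\<^bsub>?A\<^esub> g \<otimes>\<^bsub>?A\<^esub> h = f \<otimes>\<^bsub>?A\<^esub> (g \<otimes>\<^bsub>?A\<^esub> h)"
    if "f \<in> carrier ?A" "g \<in> carrier ?A" "h \<in> carrier ?A" for f g h
  proof -
    have f: "keys f \<subseteq> carrier M" and g: "keys g \<subseteq> carrier M"
      and h: "keys h \<subseteq> carrier M" using that by (auto simp: monoid_algebra_sel)
    from f show ?thesis
    proof (induction f rule: poly_mapping_span_induct)
      case (single u c)
      note u = this
      from g show ?case
      proof (induction g rule: poly_mapping_span_induct)
        case (single v d)
        note v = this
        from h show ?case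
        proof (induction h rule: poly_mapping_span_induct)
          case (single w e)
          then show ?case using u v by (simp add: monoid_algebra_mult_single M.m_assoc mult.assoc)
        qed (simp_all add: monoid_algebra_mult_add)
      qed (simp_all add: monoid_algebra_mult_add)
    qed (simp_all add: monoid_algebra_mult_add)
  qed
  have one: "\<one>\<^bsub>?A\<^esub> \<otimes>\<^bsub>?A\<^esub> f = f" "f \<otimes>\<^bsub>?A\<^esub> \<one>\<^bsub>?A\<^esub> = f" if "f \<in> carrier ?A" for f
  proof -
    have f: "keys f \<subseteq> carrier M" using that by (auto simp: monoid_algebra_sel)
    from f show "\<one>\<^bsub>?A\<^esub> \<otimes>\<^bsub>?A\<^esub> f = f"
      by (induction f rule: poly_mapping_span_induct)
        (simp_all add: monoid_algebra_sel monoid_algebra_mult_add bas_def monoid_algebra_mult_single)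
    from f show "f \<otimes>\<^bsub>?A\<^esub> \<one>\<^bsub>?A\<^esub> = f"
      by (induction f rule: poly_mapping_span_induct)
        (simp_all add: monoid_algebra_sel monoid_algebra_mult_add bas_def monoid_algebra_mult_single)
  qed
  have "ring ?A"
  proof (rule ringI)
    show "abelian_group ?A"
    proof (rule abelian_groupI, goal_cases)
      case (1 x y) then show ?case using keys_add[of x y] by (auto simp: monoid_algebra_sel)
    next
      case (6 x)
      then show ?case
        by (intro bexI[of _ "- x"]) (auto simp: monoid_algebra_sel in_keys_iff)
    qed (auto simp: monoid_algebra_sel add_ac)
    show "monoid ?A"
      by (rule monoidI) (use closed assoc one in \<open>auto simp: monoid_algebra_sel bas_def\<close>)
  qed (auto simp: monoid_algebra_mult_add monoid_algebra_sel(4))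
  then interpret A: ring ?A .
  show ?thesis
  proof (unfold_locales, goal_cases)
    case (1 x c) then show ?case using keys_scal[of c x] by (auto simp: monoid_algebra_sel)
  qed (simp_all add: monoid_algebra_sel scal_simps monoid_algebra_mult_scal)
qed

section \<open>Quotient algebras\<close>

text \<open>
  Algebras presented as a quotient of \<open>A\<close> by the ideal that a set \<open>S\<close> of relators generates.
\<close>

locale kalg_pres = kalg A for A :: "('k::field, 'a) module" (structure) +
  fixes S assumes S: "S \<subseteq> carrier A"
begin

abbreviation "I \<equiv> rel_ideal A S"
abbreviation "Q \<equiv> alg_quot A S"
abbreviation "cls \<equiv> alg_cls A S"

sublocale I: ideal I A
  unfolding rel_ideal_def by (rule genideal_ideal[OF S])

lemma rel_in_I: "s \<in> S \<Longrightarrow> s \<in> I"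
  using genideal_self[OF S] by (auto simp: rel_ideal_def)

lemma I_least: "ideal J A \<Longrightarrow> S \<subseteq> J \<Longrightarrow> I \<subseteq> J"
  unfolding rel_ideal_def by (rule genideal_minimal)

text \<open>
  A scalar multiple of \<open>z\<close> is the product of \<open>z\<close> with a multiple of the unit, so every ideal is a
  subspace.  This makes the scalar multiplication on the quotient well defined.
\<close>

lemma smult_I: "z \<in> I \<Longrightarrow> c \<odot> z \<in> I"
  using I.I_l_closed[of z "c \<odot> \<one>"] I.a_subset
  by (metis I.Icarr l_one one_closed smult_closed smult_mult_left)

lemma quot_sel:
  "carrier Q = cls ` carrier A" "\<one>\<^bsub>Q\<^esub> = cls \<one>" "\<zero>\<^bsub>Q\<^esub> = cls \<zero>"
  "a \<in> carrier A \<Longrightarrow> b \<in> carrier A \<Longrightarrow> cls a \<oplus>\<^bsub>Q\<^esub> cls b = cls (a \<oplus> b)"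
  "a \<in> carrier A \<Longrightarrow> b \<in> carrier A \<Longrightarrow> cls a \<otimes>\<^bsub>Q\<^esub> cls b = cls (a \<otimes> b)"
proof -
  show "carrier Q = cls ` carrier A" "\<one>\<^bsub>Q\<^esub> = cls \<one>"
    by (auto simp: alg_quot_def alg_cls_def Let_def FactRing_simps)
  show "\<zero>\<^bsub>Q\<^esub> = cls \<zero>"
    using a_rcos_zero[OF I.ideal_axioms I.zero_closed]
    by (simp add: alg_quot_def alg_cls_def Let_def FactRing_simps)
  show "a \<in> carrier A \<Longrightarrow> b \<in> carrier A \<Longrightarrow> cls a \<oplus>\<^bsub>Q\<^esub> cls b = cls (a \<oplus> b)"
    "a \<in> carrier A \<Longrightarrow> b \<in> carrier A \<Longrightarrow> cls a \<otimes>\<^bsub>Q\<^esub> cls b = cls (a \<otimes> b)"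
    by (simp_all add: alg_quot_def alg_cls_def Let_def FactRing_def I.a_rcos_sum I.rcoset_mult_add)
qed

lemma cls_eq_iff: "a \<in> carrier A \<Longrightarrow> b \<in> carrier A \<Longrightarrow> cls a = cls b \<longleftrightarrow> a \<ominus> b \<in> I"
  unfolding alg_cls_def using quotient_eq_iff_same_a_r_cos[OF I.ideal_axioms] by auto

lemma quot_smult: assumes a: "a \<in> carrier A" shows "c \<odot>\<^bsub>Q\<^esub> cls a = cls (c \<odot> a)"
proof -
  have "alg_cls A S (c \<odot> x) = cls (c \<odot> a)" if "x \<in> cls a" for x
  proof -
    obtain i where i: "i \<in> I" "x = i \<oplus> a"
      using \<open>x \<in> cls a\<close> by (auto simp: alg_cls_def a_r_coset_def')
    then have ic: "i \<in> carrier A" by auto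
    have "c \<odot> x \<ominus> c \<odot> a = c \<odot> i"
      using a ic i by (simp add: smult_r_distr minus_eq a_assoc r_neg)
    moreover have "x \<in> carrier A" using i ic a by simp
    ultimately show ?thesis
      using cls_eq_iff[of "c \<odot> x" "c \<odot> a"] smult_I[OF i(1), of c] a by simp
  qed
  moreover have "a \<in> cls a"
    unfolding alg_cls_def by (rule I.a_rcos_self[OF a])
  ultimately have "(\<Union>x\<in>cls a. cls (c \<odot> x)) = cls (c \<odot> a)"
    by blast
  then show ?thesis
    by (simp only: alg_quot_def Let_def module.simps alg_cls_def)
qed

lemma quot_cls_in: "a \<in> carrier A \<Longrightarrow> cls a \<in> carrier Q" by (simp add: quot_sel)

lemma kalg_quot: "kalg Q"
proof -
  interpret F: ring "A Quot I" by (rule I.quotient_is_ring)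
  have sel: "carrier Q = carrier (A Quot I)" "monoid.mult Q = monoid.mult (A Quot I)"
    "one Q = one (A Quot I)" "zero Q = zero (A Quot I)" "add Q = add (A Quot I)"
    by (simp_all only: alg_quot_def Let_def partial_object.simps monoid.simps ring.simps)
  have "ring Q"
  proof (rule ringI)
    show "abelian_group Q"
      by (rule abelian_groupI; unfold sel)
        (simp_all add: F.a_ac F.add.l_inv_ex)
    show "monoid Q"
      by (rule monoidI; unfold sel) (simp_all add: F.m_assoc)
  qed (unfold sel, simp_all add: F.l_distr F.r_distr)
  then interpret Q: ring Q .
  show ?thesis
    by (intro kalg.intro Q.ring_axioms kalg_axioms.intro; unfold quot_sel(1); elim imageE; hypsubst)
      (simp_all add: quot_sel(2-) quot_smult smult_l_distr smult_r_distr smult_assoc1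
        smult_mult_left smult_mult_right)
qed

end

section \<open>Binomial coefficients modulo a prime\<close>

text \<open>
  From \<open>j (q choose j) = q (q - 1 choose j - 1)\<close> with \<open>q = p\<^sup>k\<close>: if \<open>p\<close> did not divide \<open>q choose j\<close>, then \<open>q\<close>
  would divide \<open>j\<close>.
\<close>

lemma of_nat_choose_prime_power:
  assumes p: "CHAR('k::field) = p" "prime p" and j: "0 < j" "j < p ^ k"
  shows "of_nat (p ^ k choose j) = (0::'k)"
proof -
  have "j * (p ^ k choose j) = p ^ k * ((p ^ k - 1) choose (j - 1))"
    using binomial_absorption[of "j - 1" "p ^ k"] j by simp
  then have dvd: "p ^ k dvd j * (p ^ k choose j)" by simp
  have "p dvd (p ^ k choose j)"
  proof (rule ccontr)
    assume "\<not> p dvd (p ^ k choose j)"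
    then have "coprime (p ^ k) (p ^ k choose j)"
      using p(2) by (simp add: prime_imp_coprime)
    then have "p ^ k dvd j" using dvd by (simp add: coprime_dvd_mult_left_iff)
    then show False using j by (auto dest: dvd_imp_le)
  qed
  then show ?thesis using p(1) by (simp add: of_nat_eq_0_iff_char_dvd)
qed

text \<open>
  In Vandermonde's convolution only the first and the last term survive modulo \<open>p\<close>.
\<close>

lemma of_nat_choose_add_prime_power:
  assumes p: "CHAR('k::field) = p" "prime p" and l: "l \<le> p ^ k"
  shows "of_nat ((p ^ k + b) choose l) = (of_nat (b choose l) + (if l = p ^ k then 1 else 0) :: 'k)"
proof -
  let ?q = "p ^ k"
  have q: "?q > 0" using p(2) by (simp add: prime_gt_0_nat)
  have "of_nat ((?q + b) choose l) = (\<Sum>i\<le>l. of_nat (?q choose i) * (of_nat (b choose (l - i)) :: 'k))"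
    by (subst vandermonde[symmetric]) simp
  also have "\<dots> = (\<Sum>i\<le>l. (if i = 0 then of_nat (b choose l) else 0) + (if i = ?q then 1 else 0))"
  proof (intro sum.cong refl)
    fix i assume "i \<in> {..l}"
    then have i: "i \<le> l" by simp
    consider "i = 0" | "0 < i" "i < ?q" | "i = ?q" using i l by linarith
    then show "of_nat (?q choose i) * (of_nat (b choose (l - i)) :: 'k)
        = (if i = 0 then of_nat (b choose l) else 0) + (if i = ?q then 1 else 0)"
    proof cases
      case 3
      then have "i \<noteq> 0" "l = i" using q i l by (metis less_irrefl, linarith)
      then show ?thesis using 3 p(2) by (simp add: prime_gt_0_nat)
    qed (use q of_nat_choose_prime_power[OF p] in auto)
  qed
  also have "\<dots> = of_nat (b choose l) + (if ?q \<le> l then 1 else 0)"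
    by (simp add: sum.distrib)
  finally show ?thesis using l by auto
qed

lemma of_nat_choose_mult_prime_power:
  assumes p: "CHAR('k::field) = p" "prime p"
  shows "of_nat ((p ^ k * b) choose (p ^ k)) = (of_nat b :: 'k)"
proof (induction b)
  case 0
  have "p ^ k \<noteq> 0" using p(2) by (simp add: prime_gt_0_nat)
  then show ?case by (simp add: binomial_eq_0)
next
  case (Suc b)
  then show ?case using of_nat_choose_add_prime_power[OF p, of "p ^ k" k "p ^ k * b"] by simp
qed

text \<open>
  For \<open>l < p\<close> the residue of \<open>b choose l\<close> depends only on \<open>b mod p\<close>, and for \<open>b < p\<close> the sum is the full
  alternating sum of a row of Pascal's triangle.  These sums are the factors by which the
  maps \<open>phi_x_factor\<close> and \<open>theta_factor\<close> multiply monomials.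
\<close>

lemma alternating_sum_choose_below_prime:
  assumes p: "CHAR('k::field) = p" "prime p"
  shows "(\<Sum>l<p. (-1) ^ l * of_nat (b choose l)) = (if p dvd b then 1 else 0 :: 'k)"
proof (induction b rule: less_induct)
  case (less b)
  have p0: "p > 0" using p(2) by (simp add: prime_gt_0_nat)
  show ?case
  proof (cases "b < p")
    case True
    have "(\<Sum>l<p. (-1) ^ l * of_nat (b choose l)) = (\<Sum>l\<le>b. (-1) ^ l * of_nat (b choose l) :: 'k)"
      by (rule sum.mono_neutral_right) (use True in \<open>auto simp: binomial_eq_0\<close>)
    also have "\<dots> = (if b = 0 then 1 else 0)"
      by (simp add: choose_alternating_sum)
    finally show ?thesis using True p0 by (auto dest: dvd_imp_le)
  next
    case False
    have "(\<Sum>l<p. (-1) ^ l * of_nat (b choose l)) = (\<Sum>l<p. (-1) ^ l * of_nat ((b - p) choose l) :: 'k)"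
      using of_nat_choose_add_prime_power[OF p, of _ 1 "b - p"] False
      by (intro sum.cong) auto
    also have "\<dots> = (if p dvd b - p then 1 else 0)"
      using False p0 by (intro less) auto
    finally show ?thesis using False by (simp add: dvd_minus_self)
  qed
qed

text \<open>
  The falling factorial arises when a derivation is applied \<open>j\<close> times to a \<open>b\<close>-th power.
\<close>

lemma prod_falling_factorial: "(\<Prod>t<j. b - t) = fact j * (b choose j)" for b j :: nat
proof (induction j)
  case (Suc j)
  have "(b - j) * (b choose j) = Suc j * (b choose Suc j)"
    by (cases b) (simp_all add: Suc_times_binomial binomial_absorb_comp del: binomial_Suc_Suc mult_Suc)
  then show ?case using Suc by (simp add: algebra_simps)
qed simp

text \<open>
  Since \<open>a < p\<^sup>a\<close>, the first \<open>a\<close> steps of the sieve already detect whether \<open>a\<close> is zero.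
\<close>

lemma not_dvd_large_power:
  assumes "p \<ge> 2" "a \<le> N" shows "p ^ N dvd a \<longleftrightarrow> a = (0::nat)"
proof -
  have "a < 2 ^ a" by (rule less_exp)
  also have "(2::nat) ^ a \<le> p ^ a" using assms by (intro power_mono) auto
  also have "p ^ a \<le> p ^ N" using assms by (intro power_increasing) auto
  finally show ?thesis by (auto dest: dvd_imp_le)
qed

section \<open>Multi-indices\<close>

lemma mindex_add: "\<gamma> \<in> mindex k \<Longrightarrow> \<gamma>' \<in> mindex k \<Longrightarrow> \<gamma> + \<gamma>' \<in> mindex k"
  using keys_add[of \<gamma> \<gamma>'] by (auto simp: mindex_def)

lemma mindex_single: "j < k \<Longrightarrow> single j a \<in> mindex k"
  by (simp add: mindex_def)

lemma mindex_zero: "0 \<in> mindex k"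
  by (simp add: mindex_def)

lemma mindex_update: "\<gamma> \<in> mindex k \<Longrightarrow> j < k \<Longrightarrow> Poly_Mapping.update j a \<gamma> \<in> mindex k"
  by (auto simp: mindex_def keys_update)

lemma mindex_diff: "\<gamma> \<in> mindex k \<Longrightarrow> \<gamma> - \<gamma>' \<in> mindex k"
  by (auto simp: mindex_def in_keys_iff lookup_minus subset_eq)

lemma mindex_eqI:
  assumes "\<alpha> \<in> mindex k" "\<beta> \<in> mindex k" "\<And>i. i < k \<Longrightarrow> lookup \<alpha> i = lookup \<beta> i"
  shows "\<alpha> = \<beta>"
proof (rule poly_mapping_eqI)
  fix i
  have "lookup \<gamma> i = 0" if "\<gamma> \<in> mindex k" "\<not> i < k" for \<gamma>
    using that by (metis (mono_tags) in_keys_iff lessThan_iff mem_Collect_eq mindex_def subsetD)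
  then show "lookup \<alpha> i = lookup \<beta> i"
    using assms by (cases "i < k") auto
qed

section \<open>Ordered products\<close>

lemma oprod_0 [simp]: "oprod R f 0 = \<one>\<^bsub>R\<^esub>"
  by (simp add: oprod_def)

context monoid
begin

lemma foldr_mult_closed: "(\<And>i. i \<in> set L \<Longrightarrow> f i \<in> carrier G) \<Longrightarrow> z \<in> carrier G \<Longrightarrow>
    foldr (\<lambda>i u. f i \<otimes> u) L z \<in> carrier G"
  by (induction L) auto

lemma foldr_mult_acc: "(\<And>i. i \<in> set L \<Longrightarrow> f i \<in> carrier G) \<Longrightarrow> z \<in> carrier G \<Longrightarrow>
    foldr (\<lambda>i u. f i \<otimes> u) L z = foldr (\<lambda>i u. f i \<otimes> u) L \<one> \<otimes> z"
  by (induction L) (auto simp: foldr_mult_closed m_assoc)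

lemma oprod_closed [intro, simp]: "(\<And>i. i < k \<Longrightarrow> f i \<in> carrier G) \<Longrightarrow> oprod G f k \<in> carrier G"
  unfolding oprod_def by (rule foldr_mult_closed) auto

lemma oprod_Suc: "(\<And>i. i < Suc k \<Longrightarrow> f i \<in> carrier G) \<Longrightarrow> oprod G f (Suc k) = oprod G f k \<otimes> f k"
  unfolding oprod_def by (simp, subst foldr_mult_acc) auto

lemma oprod_cong: "(\<And>i. i < k \<Longrightarrow> f i = g i) \<Longrightarrow> oprod G f k = oprod G g k"
  unfolding oprod_def by (rule foldr_cong) auto

lemma oprod_one: "(\<And>i. i < k \<Longrightarrow> f i = \<one>) \<Longrightarrow> oprod G f k = \<one>"
  by (induction k) (simp_all add: oprod_Suc)

lemma oprod_commute:
  assumes "\<And>i. i < k \<Longrightarrow> f i \<in> carrier G" "v \<in> carrier G" "\<And>i. i < k \<Longrightarrow> v \<otimes> f i = f i \<otimes> v"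
  shows "v \<otimes> oprod G f k = oprod G f k \<otimes> v"
  using assms
proof (induction k)
  case (Suc k)
  have "v \<otimes> oprod G f (Suc k) = (v \<otimes> oprod G f k) \<otimes> f k"
    using Suc.prems by (simp add: oprod_Suc m_assoc)
  also have "\<dots> = oprod G f k \<otimes> (v \<otimes> f k)"
    using Suc by (simp add: m_assoc)
  also have "\<dots> = oprod G f (Suc k) \<otimes> v"
    using Suc.prems by (simp add: oprod_Suc m_assoc)
  finally show ?case .
qed simp

lemma oprod_mult:
  assumes "\<And>i. i < k \<Longrightarrow> f i \<in> carrier G" "\<And>i. i < k \<Longrightarrow> g i \<in> carrier G"
    "\<And>i j. i < k \<Longrightarrow> j < k \<Longrightarrow> i \<noteq> j \<Longrightarrow> f i \<otimes> g j = g j \<otimes> f i"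
  shows "oprod G f k \<otimes> oprod G g k = oprod G (\<lambda>i. f i \<otimes> g i) k"
  using assms
proof (induction k)
  case (Suc k)
  have c: "f k \<otimes> oprod G g k = oprod G g k \<otimes> f k"
    by (rule oprod_commute) (use Suc.prems in auto)
  have "oprod G f (Suc k) \<otimes> oprod G g (Suc k) = oprod G f k \<otimes> (f k \<otimes> oprod G g k) \<otimes> g k"
    using Suc.prems by (simp add: oprod_Suc m_assoc)
  also have "\<dots> = (oprod G f k \<otimes> oprod G g k) \<otimes> (f k \<otimes> g k)"
    unfolding c using Suc.prems by (simp add: m_assoc)
  also have "\<dots> = oprod G (\<lambda>i. f i \<otimes> g i) (Suc k)"
    using Suc by (simp add: oprod_Suc)
  finally show ?case .
qed simp

lemma oprod_delta:
  assumes "a \<in> carrier G"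
  shows "oprod G (\<lambda>i. if i = j then a else \<one>) k = (if j < k then a else \<one>)"
  by (induction k) (use assms in \<open>auto simp: oprod_Suc\<close>)

text \<open>
  Moving one factor to the front makes the product accessible to an operator that acts on this
  factor only.
\<close>

lemma oprod_pull:
  assumes f: "\<And>i. i < k \<Longrightarrow> f i \<in> carrier G" and j: "j < k"
    and c: "\<And>i. i < k \<Longrightarrow> i \<noteq> j \<Longrightarrow> f j \<otimes> f i = f i \<otimes> f j"
  shows "oprod G f k = f j \<otimes> oprod G (f(j := \<one>)) k"
proof -
  let ?g = "\<lambda>i. if i = j then f j else \<one>"
  have "oprod G ?g k \<otimes> oprod G (f(j := \<one>)) k = oprod G (\<lambda>i. ?g i \<otimes> (f(j := \<one>)) i) k"
    by (rule oprod_mult) (use f c j in auto)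
  also have "\<dots> = oprod G f k"
    by (rule oprod_cong) (use f in auto)
  finally show ?thesis using oprod_delta[OF f[OF j], of j k] j by simp
qed

end

section \<open>Linear maps\<close>

context kalg
begin

definition subspace :: "'a set \<Rightarrow> bool" where
  "subspace V \<longleftrightarrow> V \<subseteq> carrier A \<and> \<zero> \<in> V \<and> (\<forall>u\<in>V. \<forall>v\<in>V. u \<oplus> v \<in> V) \<and> (\<forall>c. \<forall>u\<in>V. c \<odot> u \<in> V)"

text \<open>
  Linearity on a subspace: some of the maps are only meaningful on a part of the algebra.
\<close>

definition linear :: "'a set \<Rightarrow> 'a set \<Rightarrow> ('a \<Rightarrow> 'a) \<Rightarrow> bool" where
  "linear V W T \<longleftrightarrow> (\<forall>u\<in>V. T u \<in> W) \<and> (\<forall>u\<in>V. \<forall>v\<in>V. T (u \<oplus> v) = T u \<oplus> T v) \<and>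
     (\<forall>c. \<forall>u\<in>V. T (c \<odot> u) = c \<odot> T u)"

inductive_set span :: "'a set \<Rightarrow> 'a set" for B where
  zero: "\<zero> \<in> span B"
| base: "b \<in> B \<Longrightarrow> b \<in> span B"
| add: "u \<in> span B \<Longrightarrow> v \<in> span B \<Longrightarrow> u \<oplus> v \<in> span B"
| smult: "u \<in> span B \<Longrightarrow> c \<odot> u \<in> span B"

inductive_set gen_alg :: "'a set \<Rightarrow> 'a set" for B where
  one: "\<one> \<in> gen_alg B"
| base: "b \<in> B \<Longrightarrow> b \<in> gen_alg B"
| add: "u \<in> gen_alg B \<Longrightarrow> v \<in> gen_alg B \<Longrightarrow> u \<oplus> v \<in> gen_alg B"
| mult: "u \<in> gen_alg B \<Longrightarrow> v \<in> gen_alg B \<Longrightarrow> u \<otimes> v \<in> gen_alg B"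
| smult: "u \<in> gen_alg B \<Longrightarrow> c \<odot> u \<in> gen_alg B"

lemma subspaceI:
  "V \<subseteq> carrier A \<Longrightarrow> \<zero> \<in> V \<Longrightarrow> (\<And>u v. u \<in> V \<Longrightarrow> v \<in> V \<Longrightarrow> u \<oplus> v \<in> V) \<Longrightarrow>
    (\<And>c u. u \<in> V \<Longrightarrow> c \<odot> u \<in> V) \<Longrightarrow> subspace V"
  by (auto simp: subspace_def)

lemma subspaceD:
  assumes "subspace V"
  shows "u \<in> V \<Longrightarrow> u \<in> carrier A" "\<zero> \<in> V" "u \<in> V \<Longrightarrow> v \<in> V \<Longrightarrow> u \<oplus> v \<in> V" "u \<in> V \<Longrightarrow> c \<odot> u \<in> V"
  using assms by (auto simp: subspace_def)

lemma subspace_carrier [simp]: "subspace (carrier A)"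
  by (auto simp: subspace_def)

lemma span_subset_subspace: "B \<subseteq> V \<Longrightarrow> subspace V \<Longrightarrow> span B \<subseteq> V"
proof
  fix u assume "B \<subseteq> V" "subspace V" "u \<in> span B"
  from this(3,1,2) show "u \<in> V"
    by induction (auto dest: subspaceD)
qed

lemma subspace_span: "B \<subseteq> carrier A \<Longrightarrow> subspace (span B)"
  using span_subset_subspace[of B "carrier A"]
  by (intro subspaceI) (auto intro: span.intros)

lemma linearI:
  "(\<And>u. u \<in> V \<Longrightarrow> T u \<in> W) \<Longrightarrow> (\<And>u v. u \<in> V \<Longrightarrow> v \<in> V \<Longrightarrow> T (u \<oplus> v) = T u \<oplus> T v) \<Longrightarrow>
    (\<And>c u. u \<in> V \<Longrightarrow> T (c \<odot> u) = c \<odot> T u) \<Longrightarrow> linear V W T"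
  by (auto simp: linear_def)

lemma linearD:
  assumes "linear V W T"
  shows "u \<in> V \<Longrightarrow> T u \<in> W" "u \<in> V \<Longrightarrow> v \<in> V \<Longrightarrow> T (u \<oplus> v) = T u \<oplus> T v" "u \<in> V \<Longrightarrow> T (c \<odot> u) = c \<odot> T u"
  using assms by (auto simp: linear_def)

lemma linear_zero:
  assumes "linear V W T" "subspace V" "subspace W"
  shows "T \<zero> = \<zero>"
proof -
  have "T \<zero> \<in> carrier A" using linearD(1)[OF assms(1)] subspaceD[OF assms(3)] subspaceD(2)[OF assms(2)] by blast
  then show ?thesis using linearD(3)[OF assms(1) subspaceD(2)[OF assms(2)], of 0] by simp
qed

lemma linear_comp: "linear V W T \<Longrightarrow> linear U V S \<Longrightarrow> linear U W (\<lambda>s. T (S s))"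
  by (auto simp: linear_def)

lemma linear_subset: "linear V W T \<Longrightarrow> V' \<subseteq> V \<Longrightarrow> W \<subseteq> W' \<Longrightarrow> linear V' W' T"
  by (auto simp: linear_def subset_eq)

lemma linear_fold: "(\<And>i. i \<in> set L \<Longrightarrow> linear V V (T i)) \<Longrightarrow> linear V V (fold T L)"
  by (induction L) (auto simp: linear_def)

lemma linear_foldr: "(\<And>i. i \<in> set L \<Longrightarrow> linear V V (T i)) \<Longrightarrow> linear V V (foldr T L)"
  by (induction L) (auto simp: linear_def)

lemma linear_funpow: "linear V V T \<Longrightarrow> linear V V (T ^^ k)"
  by (induction k) (auto simp: linear_def)

text \<open>
  The image of a span is determined by the images of the spanning elements; \<open>V\<close> is an a priori
  codomain.
\<close>

lemma linear_image_span:
  assumes T: "linear (span B) V T" and B: "\<And>b. b \<in> B \<Longrightarrow> T b \<in> W" "B \<subseteq> carrier A"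
    and W: "subspace W" "subspace V"
  shows "linear (span B) W T"
proof -
  have "T u \<in> W" if "u \<in> span B" for u
    using that
  proof induction
    case zero
    then show ?case using linear_zero[OF T subspace_span[OF B(2)] W(2)] W by (simp add: subspaceD)
  next
    case (base b) then show ?case by (rule B(1))
  next
    case (add u v) then show ?case by (simp add: linearD(2)[OF T] subspaceD(3)[OF W(1)])
  next
    case (smult u c) then show ?case by (simp add: linearD(3)[OF T] subspaceD(4)[OF W(1)])
  qed
  then show ?thesis using T by (auto simp: linear_def)
qed

lemma linear_mult_right: "v \<in> carrier A \<Longrightarrow> linear (carrier A) (carrier A) (\<lambda>s. s \<otimes> v)"
  by (intro linearI) (simp_all add: l_distr smult_mult_left)

lemma linear_mult_left: "v \<in> carrier A \<Longrightarrow> linear (carrier A) (carrier A) (\<lambda>s. v \<otimes> s)"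
  by (intro linearI) (simp_all add: r_distr smult_mult_right)

lemma linear_smult: "subspace V \<Longrightarrow> linear V V (\<lambda>s. c \<odot> s)"
  by (intro linearI) (simp_all add: subspaceD smult_r_distr mult.commute flip: smult_assoc1)

lemma finsum_smult: "finite X \<Longrightarrow> (\<And>k. k \<in> X \<Longrightarrow> f k \<in> carrier A) \<Longrightarrow>
   finsum A (\<lambda>k. c \<odot> f k) X = c \<odot> finsum A f X"
  by (induction X rule: finite_induct) (simp_all add: Pi_def smult_r_distr)

lemma finsum_smult_left: "finite X \<Longrightarrow> v \<in> carrier A \<Longrightarrow> finsum A (\<lambda>k. f k \<odot> v) X = sum f X \<odot> v"
  by (induction X rule: finite_induct) (simp_all add: Pi_def smult_l_distr)

lemma finsum_subspace: "subspace W \<Longrightarrow> finite X \<Longrightarrow> (\<And>k. k \<in> X \<Longrightarrow> f k \<in> W) \<Longrightarrow> finsum A f X \<in> W"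
proof -
  assume W: "subspace W" and "finite X" "\<And>k. k \<in> X \<Longrightarrow> f k \<in> W"
  from this(2,3) show ?thesis
    by (induction X rule: finite_induct) (auto simp: Pi_def subspaceD[OF W])
qed

lemma linear_finsum:
  assumes "finite X" "subspace V" "subspace W" "\<And>k. k \<in> X \<Longrightarrow> linear V W (T k)"
  shows "linear V W (\<lambda>s. finsum A (\<lambda>k. T k s) X)"
proof -
  have cl: "k \<in> X \<Longrightarrow> u \<in> V \<Longrightarrow> T k u \<in> W" for k u using assms(4) by (auto simp: linear_def)
  have clA: "k \<in> X \<Longrightarrow> u \<in> V \<Longrightarrow> T k u \<in> carrier A" for k u using cl subspaceD(1)[OF assms(3)] by blast
  show ?thesis
  proof (rule linearI)
    fix u assume u: "u \<in> V"
    then show "finsum A (\<lambda>k. T k u) X \<in> W" using cl assms by (auto intro: finsum_subspace)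
    fix v assume v: "v \<in> V"
    have "finsum A (\<lambda>k. T k (u \<oplus> v)) X = finsum A (\<lambda>k. T k u \<oplus> T k v) X"
      by (rule finsum_cong') (use assms(4) u v clA in \<open>auto simp: linear_def\<close>)
    also have "\<dots> = finsum A (\<lambda>k. T k u) X \<oplus> finsum A (\<lambda>k. T k v) X"
      using clA u v by (intro finsum_addf) auto
    finally show "finsum A (\<lambda>k. T k (u \<oplus> v)) X = finsum A (\<lambda>k. T k u) X \<oplus> finsum A (\<lambda>k. T k v) X" .
  next
    fix u c assume u: "u \<in> V"
    have "finsum A (\<lambda>k. T k (c \<odot> u)) X = finsum A (\<lambda>k. c \<odot> T k u) X"
      by (rule finsum_cong') (use assms(4) u clA in \<open>auto simp: linear_def\<close>)
    also have "\<dots> = c \<odot> finsum A (\<lambda>k. T k u) X"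
      using clA u assms by (intro finsum_smult) auto
    finally show "finsum A (\<lambda>k. T k (c \<odot> u)) X = c \<odot> finsum A (\<lambda>k. T k u) X" .
  qed
qed

section \<open>Sums of families with finite support\<close>

lemma fsum_superset:
  assumes "finite X" "fsupp A f I \<subseteq> X" "X \<subseteq> I" "\<And>i. i \<in> I \<Longrightarrow> f i \<in> carrier A"
  shows "fsum A f I = finsum A f X"
  unfolding fsum_def
  by (rule add.finprod_mono_neutral_cong_left) (use assms in \<open>auto simp: fsupp_def\<close>)

text \<open>
  A sum with finite support may be taken over every finite set that contains the support.
\<close>

lemma has_fsum_superset:
  assumes "finite X" "fsupp A f I \<subseteq> X" "X \<subseteq> I" "\<And>i. i \<in> I \<Longrightarrow> f i \<in> carrier A"
  shows "has_fsum A f I s \<longleftrightarrow> s = finsum A f X"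
  using fsum_superset[OF assms] finite_subset[OF assms(2,1)] by (auto simp: has_fsum_def)

lemma has_fsum_add:
  assumes f: "has_fsum A f I s" "\<And>i. i \<in> I \<Longrightarrow> f i \<in> carrier A"
    and g: "has_fsum A g I t" "\<And>i. i \<in> I \<Longrightarrow> g i \<in> carrier A"
  shows "has_fsum A (\<lambda>i. f i \<oplus> g i) I (s \<oplus> t)"
proof -
  let ?X = "fsupp A f I \<union> fsupp A g I"
  have X: "finite ?X" "?X \<subseteq> I" using f g by (auto simp: has_fsum_def fsupp_def)
  have s: "s = finsum A f ?X" "t = finsum A g ?X"
    using has_fsum_superset[of ?X f I s] has_fsum_superset[of ?X g I t] X f g by auto
  have "finsum A (\<lambda>i. f i \<oplus> g i) ?X = s \<oplus> t"
    unfolding s using X f g by (intro finsum_addf) auto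
  moreover have "fsupp A (\<lambda>i. f i \<oplus> g i) I \<subseteq> ?X"
    by (auto simp: fsupp_def)
  ultimately show ?thesis
    by (subst has_fsum_superset[OF X(1) _ X(2)]) (use f g in auto)
qed

lemma has_fsum_smult:
  assumes f: "has_fsum A f I s" "\<And>i. i \<in> I \<Longrightarrow> f i \<in> carrier A"
  shows "has_fsum A (\<lambda>i. c \<odot> f i) I (c \<odot> s)"
proof -
  let ?X = "fsupp A f I"
  have X: "finite ?X" "?X \<subseteq> I" "s = finsum A f ?X" using f by (auto simp: has_fsum_def fsupp_def fsum_def)
  have "finsum A (\<lambda>i. c \<odot> f i) ?X = c \<odot> s"
    unfolding X(3) using X f by (intro finsum_smult) auto
  moreover have "fsupp A (\<lambda>i. c \<odot> f i) I \<subseteq> ?X"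
    by (auto simp: fsupp_def)
  ultimately show ?thesis
    by (subst has_fsum_superset[OF X(1) _ X(2)]) (use f in auto)
qed

lemma has_fsum_cong:
  assumes "\<And>i. i \<in> I \<Longrightarrow> f i = g i" "\<And>i. i \<in> I \<Longrightarrow> g i \<in> carrier A"
  shows "has_fsum A f I s \<longleftrightarrow> has_fsum A g I s"
proof -
  have "fsupp A f I = fsupp A g I" using assms(1) by (auto simp: fsupp_def)
  moreover have "finsum A f (fsupp A g I) = finsum A g (fsupp A g I)"
    by (rule finsum_cong') (use assms in \<open>auto simp: fsupp_def\<close>)
  ultimately show ?thesis by (simp add: has_fsum_def fsum_def)
qed

lemma has_fsum_single:
  assumes "j \<in> I" "f j \<in> carrier A" "\<And>i. i \<in> I \<Longrightarrow> i \<noteq> j \<Longrightarrow> f i = \<zero>"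
  shows "has_fsum A f I (f j)"
proof -
  have "i \<in> I \<Longrightarrow> f i \<in> carrier A" for i using assms by (cases "i = j") auto
  then show ?thesis
    by (subst has_fsum_superset[of "{j}"]) (use assms in \<open>auto simp: fsupp_def\<close>)
qed

lemma has_fsum_zero: "(\<And>i. i \<in> I \<Longrightarrow> f i = \<zero>) \<Longrightarrow> has_fsum A f I \<zero>"
  by (subst has_fsum_superset[of "{}"]) (auto simp: fsupp_def)

lemma linear_fsum:
  assumes V: "subspace V" and T: "\<And>k. linear V (carrier A) (T k)"
    and fin: "\<And>s. s \<in> V \<Longrightarrow> finite {k. T k s \<noteq> \<zero>}"
  shows "linear V (carrier A) (\<lambda>s. fsum A (\<lambda>k. T k s) UNIV)"
proof -
  have h: "has_fsum A (\<lambda>k. T k s) UNIV (fsum A (\<lambda>k. T k s) UNIV)" if "s \<in> V" for s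
    using fin[OF that] by (simp add: has_fsum_def fsupp_def)
  have u: "fsum A f UNIV = t" if "has_fsum A f UNIV t" for f t
    using that by (simp add: has_fsum_def)
  have cl: "s \<in> V \<Longrightarrow> T k s \<in> carrier A" for k s using T by (auto simp: linear_def)
  show ?thesis
  proof (rule linearI, goal_cases)
    case (1 s) then show ?case unfolding fsum_def using cl by (auto intro!: finsum_closed)
  next
    case (2 s t)
    then show ?case
      using has_fsum_add[OF h[of s] _ h[of t]] cl T by (intro u) (simp add: linear_def)
  next
    case (3 c s)
    then show ?case
      using has_fsum_smult[OF h[of s], of c] cl T by (intro u) (simp add: linear_def)
  qed
qed

lemma fsum_mult_right:
  assumes "\<And>k. f k \<in> carrier A" "finite {k. f k \<noteq> \<zero>}" "v \<in> carrier A"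
  shows "fsum A (\<lambda>k. f k \<otimes> v) UNIV = fsum A f UNIV \<otimes> v"
proof -
  have "fsum A (\<lambda>k. f k \<otimes> v) UNIV = finsum A (\<lambda>k. f k \<otimes> v) {k. f k \<noteq> \<zero>}"
    by (rule fsum_superset) (use assms in \<open>auto simp: fsupp_def\<close>)
  also have "\<dots> = finsum A f {k. f k \<noteq> \<zero>} \<otimes> v"
    using finsum_ldistr[of "{k. f k \<noteq> \<zero>}" v f] assms by auto
  finally show ?thesis by (simp add: fsum_def fsupp_def)
qed

section \<open>Stationary limits\<close>

text \<open>
  The infinite product has the value at which its partial products become stationary.
\<close>

lemma inf_comp_eqI:
  assumes "\<And>N. N \<ge> M \<Longrightarrow> fold T [0..<N] u = v"
  shows "inf_comp T u = v"
proof -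
  have ev: "\<forall>\<^sub>F N in sequentially. fold T [0..<N] u = v"
    using assms by (auto simp: eventually_sequentially)
  show ?thesis unfolding inf_comp_def
  proof (rule the_equality, rule ev)
    fix w assume "\<forall>\<^sub>F N in sequentially. fold T [0..<N] u = w"
    then have "\<forall>\<^sub>F N in sequentially. w = v" using ev by eventually_elim auto
    then show "w = v" by (simp add: eventually_sequentially) (meson le_refl)
  qed
qed

text \<open>
  On every element of the span the partial products are eventually constant, because this holds on
  the generators, and the limit of eventually constant linear maps is linear.
\<close>

lemma linear_inf_comp:
  assumes B: "B \<subseteq> carrier A" and U: "subspace U" "span B \<subseteq> U" and T: "\<And>k. linear U U (T k)" and W: "subspace W"
    and ev: "\<And>b. b \<in> B \<Longrightarrow> \<exists>v\<in>W. \<exists>M. \<forall>N\<ge>M. fold T [0..<N] b = v"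
  shows "linear (span B) W (inf_comp T)"
proof -
  have fo: "linear U U (fold T [0..<N])" for N by (rule linear_fold) (rule T)
  have ev': "\<exists>v\<in>W. \<exists>M. \<forall>N\<ge>M. fold T [0..<N] u = v" if "u \<in> span B" for u
    using that
  proof induction
    case zero
    have "fold T [0..<N] \<zero> = \<zero>" for N by (rule linear_zero[OF fo U(1) U(1)])
    then show ?case using subspaceD[OF W] by auto
  next
    case (base b) then show ?case by (rule ev)
  next
    case (add u v)
    from add.IH obtain u' v' M M' where "u' \<in> W" "v' \<in> W" "\<forall>N\<ge>M. fold T [0..<N] u = u'" "\<forall>N\<ge>M'. fold T [0..<N] v = v'"
      by metis
    then show ?case using add.hyps U(2)
      by (intro bexI[of _ "u' \<oplus> v'"] exI[of _ "max M M'"]) (auto simp: linearD(2)[OF fo] subset_eq subspaceD[OF W])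
  next
    case (smult u c)
    from smult.IH obtain u' M where "u' \<in> W" "\<forall>N\<ge>M. fold T [0..<N] u = u'" by metis
    then show ?case using smult.hyps U(2)
      by (intro bexI[of _ "c \<odot> u'"] exI[of _ M]) (auto simp: linearD(3)[OF fo] subset_eq subspaceD[OF W])
  qed
  have lim: "inf_comp T u \<in> W \<and> (\<exists>M. \<forall>N\<ge>M. fold T [0..<N] u = inf_comp T u)" if "u \<in> span B" for u
    using ev'[OF that] inf_comp_eqI by metis
  show ?thesis
  proof (rule linearI, goal_cases)
    case (1 u) then show ?case using lim by blast
  next
    case (2 u v)
    then obtain M M' where "\<forall>N\<ge>M. fold T [0..<N] u = inf_comp T u" "\<forall>N\<ge>M'. fold T [0..<N] v = inf_comp T v"
      using lim by metis
    then show ?case using 2 U(2)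
      by (intro inf_comp_eqI[of "max M M'"]) (simp add: linearD(2)[OF fo] subset_eq)
  next
    case (3 c u)
    then obtain M where "\<forall>N\<ge>M. fold T [0..<N] u = inf_comp T u" using lim by metis
    then show ?case using 3 U(2)
      by (intro inf_comp_eqI[of M]) (simp add: linearD(3)[OF fo] subset_eq)
  qed
qed

section \<open>Commutators\<close>

lemma commutator_closed [simp, intro]: "r \<in> carrier A \<Longrightarrow> s \<in> carrier A \<Longrightarrow> commutator A r s \<in> carrier A"
  by (simp add: commutator_def)

lemma linear_commutator: "r \<in> carrier A \<Longrightarrow> linear (carrier A) (carrier A) (commutator A r)"
  by (intro linearI)
    (simp_all add: commutator_def ring_simprules smult_mult_left smult_mult_right smult_r_distr
      flip: smult_minus1 smult_assoc1)

lemma linear_neg_commutator: "r \<in> carrier A \<Longrightarrow> linear (carrier A) (carrier A) (\<lambda>s. \<ominus> commutator A r s)"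
  by (intro linearI)
    (simp_all add: linearD[OF linear_commutator] minus_add smult_r_distr flip: smult_minus1 smult_assoc1)

lemma commutator_mult_commuting:
  "r \<in> carrier A \<Longrightarrow> e \<in> carrier A \<Longrightarrow> v \<in> carrier A \<Longrightarrow> r \<otimes> v = v \<otimes> r \<Longrightarrow>
    commutator A r (e \<otimes> v) = commutator A r e \<otimes> v"
  by (simp add: commutator_def minus_eq l_distr l_minus m_assoc)

lemma funpow_commutator_closed [simp, intro]:
  "r \<in> carrier A \<Longrightarrow> s \<in> carrier A \<Longrightarrow> (commutator A r ^^ k) s \<in> carrier A"
  by (induction k) auto

lemma funpow_commutator_mult_commuting:
  "r \<in> carrier A \<Longrightarrow> e \<in> carrier A \<Longrightarrow> v \<in> carrier A \<Longrightarrow> r \<otimes> v = v \<otimes> r \<Longrightarrow>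
    (commutator A r ^^ k) (e \<otimes> v) = (commutator A r ^^ k) e \<otimes> v"
  by (induction k) (simp_all add: commutator_mult_commuting)

lemma commutator_derivation:
  assumes "r \<in> carrier A" "s \<in> carrier A" "t \<in> carrier A"
  shows "commutator A r (s \<otimes> t) = commutator A r s \<otimes> t \<oplus> s \<otimes> commutator A r t"
proof -
  have "commutator A r s \<otimes> t \<oplus> s \<otimes> commutator A r t
      = r \<otimes> s \<otimes> t \<oplus> (\<ominus> (s \<otimes> r \<otimes> t) \<oplus> (s \<otimes> r \<otimes> t \<oplus> \<ominus> (s \<otimes> t \<otimes> r)))"
    using assms by (simp add: commutator_def minus_eq l_distr r_distr l_minus r_minus m_assoc a_assoc)
  also have "\<dots> = r \<otimes> s \<otimes> t \<oplus> \<ominus> (s \<otimes> t \<otimes> r)"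
    using assms by (simp add: r_neg1)
  finally show ?thesis using assms by (simp add: commutator_def minus_eq m_assoc)
qed

text \<open>
  A derivation that maps \<open>z\<close> to \<open>1\<close> acts on the powers of \<open>z\<close> as the derivative.
\<close>

lemma commutator_pow:
  assumes r: "r \<in> carrier A" and z: "z \<in> carrier A" and c: "commutator A r z = \<one>"
  shows "commutator A r (z [^] (b::nat)) = of_nat b \<odot> z [^] (b - 1)"
proof (induction b)
  case 0
  show ?case using r by (simp add: commutator_def minus_eq r_neg)
next
  case (Suc b)
  have "commutator A r (z [^] Suc b) = of_nat b \<odot> (z [^] (b - 1) \<otimes> z) \<oplus> z [^] b"
    using r z by (simp add: commutator_derivation Suc c smult_mult_left)
  also have "of_nat b \<odot> (z [^] (b - 1) \<otimes> z) = of_nat b \<odot> z [^] b"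
    using z by (cases b) simp_all
  finally show ?case using z by (simp add: smult_l_distr a_comm)
qed

lemma funpow_commutator_pow:
  assumes r: "r \<in> carrier A" and z: "z \<in> carrier A" and c: "commutator A r z = \<one>"
    and v: "v \<in> carrier A" "r \<otimes> v = v \<otimes> r"
  shows "(commutator A r ^^ j) (z [^] (b::nat) \<otimes> v) = of_nat (fact j * (b choose j)) \<odot> (z [^] (b - j) \<otimes> v)"
  unfolding prod_falling_factorial[symmetric]
proof (induction j)
  case 0 then show ?case using z v by simp
next
  case (Suc j)
  have "(commutator A r ^^ Suc j) (z [^] b \<otimes> v)
      = of_nat (\<Prod>t<j. b - t) \<odot> commutator A r (z [^] (b - j) \<otimes> v)"
    using r z v by (simp add: Suc linearD(3)[OF linear_commutator])
  also have "commutator A r (z [^] (b - j) \<otimes> v) = of_nat (b - j) \<odot> (z [^] (b - Suc j) \<otimes> v)"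
    using r z v by (simp add: commutator_mult_commuting commutator_pow[OF r z c] smult_mult_left)
  finally show ?case using z v by (simp flip: smult_assoc1)
qed

text \<open>
  In the applications \<open>T j\<close> is the \<open>j\<close>-fold derivative of \<open>w = z\<^sup>b\<close>, possibly times a constant, and \<open>M j = z\<^sup>j\<close>,
  so every term is a multiple of \<open>w\<close>.  The factorials cancel, and the alternating sum of the binomial
  coefficients \<open>b choose j\<close> with \<open>j < p\<close> remains.
\<close>

lemma truncated_exponential:
  assumes p: "CHAR('k) = p" "prime p" and w: "w \<in> carrier A"
    and T: "\<And>j. j < p \<Longrightarrow> M j \<otimes> T j = of_nat (fact j * (b choose j)) \<odot> w"
  shows "finsum A (\<lambda>j. ((-1) ^ j / of_nat (fact j)) \<odot> (M j \<otimes> T j)) {..<p} = (if p dvd b then w else \<zero>)"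
proof -
  have "finsum A (\<lambda>j. ((-1) ^ j / of_nat (fact j)) \<odot> (M j \<otimes> T j)) {..<p}
      = finsum A (\<lambda>j. ((-1) ^ j * of_nat (b choose j)) \<odot> w) {..<p}"
  proof (rule finsum_cong', goal_cases)
    case (3 j)
    then have "\<not> p dvd fact j" using p(2) by (simp add: prime_dvd_fact_iff)
    then have "(of_nat (fact j) :: 'k) \<noteq> 0" using p(1) of_nat_eq_0_iff_char_dvd by metis
    then show ?case using 3 w T[of j] by (simp flip: smult_assoc1)
  qed (use w in auto)
  also have "\<dots> = (\<Sum>j<p. (-1) ^ j * of_nat (b choose j)) \<odot> w"
    using w by (intro finsum_smult_left) auto
  finally show ?thesis using w alternating_sum_choose_below_prime[OF p, of b] by simp
qed

text \<open>
  Step \<open>N\<close> keeps \<open>w\<close> if the next base-\<open>p\<close> digit of \<open>a\<close> vanishes, so \<open>N\<close> steps test divisibility by \<open>p\<^sup>N\<close>.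
\<close>

lemma fold_sieve:
  fixes p :: nat
  assumes p: "p > 0" and T: "\<And>N b. a = p ^ N * b \<Longrightarrow> T N w = (if p dvd b then w else \<zero>)"
    and z: "\<And>N. T N \<zero> = \<zero>"
  shows "fold T [0..<N] w = (if p ^ N dvd a then w else \<zero>)"
proof (induction N)
  case (Suc N)
  show ?case
  proof (cases "p ^ N dvd a")
    case True
    then obtain b where b: "a = p ^ N * b" ..
    then have "p dvd b \<longleftrightarrow> p ^ Suc N dvd a" using p by simp
    then show ?thesis using Suc True T[OF b] by simp
  next
    case False
    then have "\<not> p ^ Suc N dvd a" by (auto elim: dvd_mult_right)
    then show ?thesis using Suc False z by simp
  qed
qed simp

end

section \<open>Algebras with the relations of differential operators\<close>

text \<open>
  An algebra together with coordinates \<open>x\<close>, \<open>d\<close>, \<open>y\<close> that satisfy the relations of \<open>D(P\<^sub>n) \<otimes> P\<^sub>m\<close>.  The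
  axioms are chosen such that they hold for the standard coordinates and are inherited by
  their images under an automorphism.
\<close>

locale weyl = kalg A for A :: "('k::field, 'a) module" (structure) +
  fixes n m p :: nat and x :: "nat \<Rightarrow> 'a" and d :: "nat \<Rightarrow> nat \<Rightarrow> 'a" and y :: "nat \<Rightarrow> 'a" and P :: "'a set"
  assumes char: "CHAR('k) = p" "p > 0"
    and x_closed [simp, intro]: "i < n \<Longrightarrow> x i \<in> carrier A"
    and d_closed [simp, intro]: "i < n \<Longrightarrow> d i k \<in> carrier A"
    and y_closed [simp, intro]: "j < m \<Longrightarrow> y j \<in> carrier A"
    and d_0 [simp]: "i < n \<Longrightarrow> d i 0 = \<one>"
    and xx: "i < n \<Longrightarrow> j < n \<Longrightarrow> x i \<otimes> x j = x j \<otimes> x i"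
    and dd: "i < n \<Longrightarrow> j < n \<Longrightarrow> d i k \<otimes> d j l = d j l \<otimes> d i k"
    and d_mult: "i < n \<Longrightarrow> d i k \<otimes> d i l = of_nat ((k + l) choose k) \<odot> d i (k + l)"
    and dx_ne: "i < n \<Longrightarrow> j < n \<Longrightarrow> i \<noteq> j \<Longrightarrow> d i k \<otimes> x j = x j \<otimes> d i k"
    and dx: "i < n \<Longrightarrow> d i (Suc k) \<otimes> x i = x i \<otimes> d i (Suc k) \<oplus> d i k"
    and y_central: "j < m \<Longrightarrow> a \<in> carrier A \<Longrightarrow> y j \<otimes> a = a \<otimes> y j"
    and generated: "carrier A \<subseteq> gen_alg (x ` {..<n} \<union> case_prod d ` ({..<n} \<times> UNIV) \<union> y ` {..<m})"
    and P: "P = span (mpow A m y ` mindex m)"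
    and hasse_derivation: "\<gamma> \<in> mindex m \<Longrightarrow> \<exists>D. linear P P D \<and> (\<forall>\<epsilon>\<in>mindex m. D (mpow A m y \<epsilon>) =
        of_nat (\<Prod>j<m. lookup \<epsilon> j choose lookup \<gamma> j) \<odot> mpow A m y (\<epsilon> - \<gamma>))"
begin

lemma prime: "prime p"
  using prime_CHAR_semidom[where 'a = 'k] char by simp

lemma xd: "i < n \<Longrightarrow> x i \<otimes> d i (Suc k) = d i (Suc k) \<otimes> x i \<ominus> d i k"
  by (simp add: dx minus_eq a_assoc r_neg)

section \<open>Elements of a single block\<close>

text \<open>
  Scalar multiples of products of \<open>x i\<close> and \<open>d i k\<close> for a single index \<open>i\<close>.  Elements of different blocks commute, so an
  operator attached to the index \<open>i\<close> sees the other factors of a monomial as constants.  This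
  reduces all computations to one variable.
\<close>

inductive_set block :: "nat \<Rightarrow> 'a set" for i where
  one: "\<one> \<in> block i"
| x: "x i \<in> block i"
| d: "d i k \<in> block i"
| mult: "u \<in> block i \<Longrightarrow> v \<in> block i \<Longrightarrow> u \<otimes> v \<in> block i"
| smult: "u \<in> block i \<Longrightarrow> c \<odot> u \<in> block i"

text \<open>
  The centralizer of \<open>block i\<close>.
\<close>

definition centralizer :: "nat \<Rightarrow> 'a set" where
  "centralizer i = {v \<in> carrier A. v \<otimes> x i = x i \<otimes> v \<and> (\<forall>k. v \<otimes> d i k = d i k \<otimes> v)}"

lemma block_closed: "i < n \<Longrightarrow> e \<in> block i \<Longrightarrow> e \<in> carrier A"
  by (rotate_tac, induction rule: block.induct) simp_all

lemma block_pow: "i < n \<Longrightarrow> e \<in> block i \<Longrightarrow> e [^] (k::nat) \<in> block i"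
  by (induction k) (simp_all add: block.one block.mult)

lemma centD: "v \<in> centralizer i \<Longrightarrow> v \<in> carrier A" "v \<in> centralizer i \<Longrightarrow> v \<otimes> x i = x i \<otimes> v"
    "v \<in> centralizer i \<Longrightarrow> v \<otimes> d i k = d i k \<otimes> v"
  by (auto simp: centralizer_def)

lemma cent_one: "i < n \<Longrightarrow> \<one> \<in> centralizer i"
  by (simp add: centralizer_def)

lemma commute_mult: "a \<in> carrier A \<Longrightarrow> u \<in> carrier A \<Longrightarrow> v \<in> carrier A \<Longrightarrow>
    u \<otimes> a = a \<otimes> u \<Longrightarrow> v \<otimes> a = a \<otimes> v \<Longrightarrow> (u \<otimes> v) \<otimes> a = a \<otimes> (u \<otimes> v)"
  by (metis m_assoc)

lemma cent_mult: "i < n \<Longrightarrow> u \<in> centralizer i \<Longrightarrow> v \<in> centralizer i \<Longrightarrow> u \<otimes> v \<in> centralizer i"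
  by (simp add: centralizer_def commute_mult)

lemma cent_smult: "i < n \<Longrightarrow> u \<in> centralizer i \<Longrightarrow> c \<odot> u \<in> centralizer i"
  by (simp add: centralizer_def smult_mult_left smult_mult_right)

lemma block_commute: "i < n \<Longrightarrow> e \<in> block i \<Longrightarrow> v \<in> centralizer i \<Longrightarrow> e \<otimes> v = v \<otimes> e"
proof (rotate_tac, induction rule: block.induct)
  case (mult a b)
  then show ?case using commute_mult[of v a b] by (simp add: centD(1) block_closed)
next
  case (smult u c)
  then show ?case by (simp add: centD(1) block_closed smult_mult_left smult_mult_right)
qed (simp_all add: centD)

lemma block_subset_cent: "i < n \<Longrightarrow> j < n \<Longrightarrow> i \<noteq> j \<Longrightarrow> e \<in> block i \<Longrightarrow> e \<in> centralizer j"
proof (rotate_tac 3, induction rule: block.induct)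
  case x
  then show ?case by (simp add: centralizer_def xx dx_ne)
next
  case (d k)
  then show ?case by (simp add: centralizer_def dd dx_ne)
qed (simp_all add: cent_one cent_mult cent_smult)

lemma cent_oprod: "i < n \<Longrightarrow> (\<And>j. j < k \<Longrightarrow> f j \<in> centralizer i) \<Longrightarrow> oprod A f k \<in> centralizer i"
proof (induction k)
  case (Suc k)
  have "oprod A f (Suc k) = oprod A f k \<otimes> f k"
    by (rule oprod_Suc) (use Suc.prems centD(1) in blast)
  then show ?case using Suc by (simp add: cent_mult)
qed (simp add: cent_one)

lemma block_oprod_closed: "(\<And>i. i < n \<Longrightarrow> e i \<in> block i) \<Longrightarrow> oprod A e n \<in> carrier A"
  by (simp add: block_closed)

lemma block_oprod_pull:
  assumes "\<And>i. i < n \<Longrightarrow> e i \<in> block i" "j < n"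
  shows "oprod A e n = e j \<otimes> oprod A (e(j := \<one>)) n"
  by (rule oprod_pull) (use assms block_closed block_commute block_subset_cent in auto)

lemma block_oprod_rest:
  assumes "\<And>i. i < n \<Longrightarrow> e i \<in> block i" "j < n"
  shows "oprod A (e(j := \<one>)) n \<in> centralizer j"
  by (rule cent_oprod) (use assms block_subset_cent cent_one in auto)

lemma block_oprod_mult:
  assumes "\<And>i. i < n \<Longrightarrow> e i \<in> block i" "\<And>i. i < n \<Longrightarrow> f i \<in> block i"
  shows "oprod A e n \<otimes> oprod A f n = oprod A (\<lambda>i. e i \<otimes> f i) n"
  by (rule oprod_mult) (use assms block_closed block_commute block_subset_cent in auto)

definition centre :: "'a set" where
  "centre = {v \<in> carrier A. \<forall>a\<in>carrier A. v \<otimes> a = a \<otimes> v}"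

lemma centreD: "v \<in> centre \<Longrightarrow> v \<in> carrier A" "v \<in> centre \<Longrightarrow> a \<in> carrier A \<Longrightarrow> v \<otimes> a = a \<otimes> v"
  by (auto simp: centre_def)

lemma centre_cent: "i < n \<Longrightarrow> v \<in> centre \<Longrightarrow> v \<in> centralizer i"
  by (simp add: centralizer_def centre_def)

lemma oprod_central_update:
  assumes e: "\<And>i. i < n \<Longrightarrow> e i \<in> block i" and j: "j < n" and u: "u \<in> block j"
  shows "u \<otimes> oprod A (e(j := \<one>)) n = oprod A (e(j := u)) n"
proof -
  have "oprod A (e(j := u)) n = (e(j := u)) j \<otimes> oprod A ((e(j := u))(j := \<one>)) n"
    by (rule block_oprod_pull) (use e j u in auto)
  then show ?thesis by simp
qed

text \<open>
  Applying operators for different indices one after the other changes each factor of an ordered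
  product separately, as long as each operator treats the other factors as constants.
\<close>

lemma fold_block:
  assumes "distinct L" "set L \<subseteq> {..<n}" "\<And>i. i < n \<Longrightarrow> e i \<in> block i" "\<And>i. i < n \<Longrightarrow> e' i \<in> block i"
    "Y \<in> centre" "\<And>j v. j \<in> set L \<Longrightarrow> v \<in> centralizer j \<Longrightarrow> T j (e j \<otimes> v) = e' j \<otimes> v"
  shows "fold T L (oprod A e n \<otimes> Y) = oprod A (\<lambda>i. if i \<in> set L then e' i else e i) n \<otimes> Y"
  using assms
proof (induction L arbitrary: e)
  case (Cons j L)
  have j: "j < n" using Cons.prems by simp
  let ?r = "oprod A (e(j := \<one>)) n"
  have r: "?r \<in> centralizer j" by (rule block_oprod_rest) (use Cons.prems j in auto)
  have Y: "Y \<in> centralizer j" using centre_cent j Cons.prems by blast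
  have ej: "e j \<in> carrier A" "e' j \<in> carrier A" using Cons.prems j block_closed by auto
  have "oprod A e n \<otimes> Y = e j \<otimes> (?r \<otimes> Y)"
    using block_oprod_pull[of e j] Cons.prems j r Y ej by (simp add: m_assoc centD(1))
  then have "T j (oprod A e n \<otimes> Y) = e' j \<otimes> (?r \<otimes> Y)"
    using Cons.prems(6)[of j "?r \<otimes> Y"] cent_mult[OF j r Y] by simp
  also have "\<dots> = oprod A (e(j := e' j)) n \<otimes> Y"
    using oprod_central_update[of e j "e' j"] Cons.prems j r Y ej by (simp add: centD(1) flip: m_assoc)
  finally have "fold T (j # L) (oprod A e n \<otimes> Y) = fold T L (oprod A (e(j := e' j)) n \<otimes> Y)"
    by simp
  also have "\<dots> = oprod A (\<lambda>i. if i \<in> set L then e' i else (e(j := e' j)) i) n \<otimes> Y"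
    by (rule Cons.IH) (use Cons.prems j in auto)
  also have "(\<lambda>i. if i \<in> set L then e' i else (e(j := e' j)) i) = (\<lambda>i. if i \<in> set (j # L) then e' i else e i)"
    by auto
  finally show ?case .
qed simp

lemma fold_block_all:
  assumes "distinct L" "set L = {..<n}" "\<And>i. i < n \<Longrightarrow> e i \<in> block i" "\<And>i. i < n \<Longrightarrow> e' i \<in> block i"
    "Y \<in> centre" "\<And>j v. j < n \<Longrightarrow> v \<in> centralizer j \<Longrightarrow> T j (e j \<otimes> v) = e' j \<otimes> v"
  shows "fold T L (oprod A e n \<otimes> Y) = oprod A e' n \<otimes> Y"
proof -
  have "oprod A (\<lambda>i. if i \<in> set L then e' i else e i) n = oprod A e' n"
    by (rule oprod_cong) (use assms in auto)
  then show ?thesis using fold_block[of L e e' Y T] assms by simp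
qed

lemma foldr_block_all:
  assumes "\<And>i. i < n \<Longrightarrow> e i \<in> block i" "\<And>i. i < n \<Longrightarrow> e' i \<in> block i"
    "Y \<in> centre" "\<And>j v. j < n \<Longrightarrow> v \<in> centralizer j \<Longrightarrow> T j (e j \<otimes> v) = e' j \<otimes> v"
  shows "foldr T [0..<n] (oprod A e n \<otimes> Y) = oprod A e' n \<otimes> Y"
  unfolding foldr_conv_fold by (rule fold_block_all) (use assms in auto)

lemma block_oprod_smult:
  "(\<And>i. i < k \<Longrightarrow> e i \<in> carrier A) \<Longrightarrow> oprod A (\<lambda>i. c i \<odot> e i) k = (\<Prod>i<k. c i) \<odot> oprod A e k"
proof (induction k)
  case (Suc k)
  then show ?case
    by (simp add: oprod_Suc smult_mult_left smult_mult_right mult.commute flip: smult_assoc1)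
qed simp

section \<open>Commutators with one variable\<close>

abbreviation ad_x :: "nat \<Rightarrow> 'a \<Rightarrow> 'a" where
  "ad_x i \<equiv> commutator A (x i)"

abbreviation nad_x :: "nat \<Rightarrow> 'a \<Rightarrow> 'a" where
  "nad_x i \<equiv> (\<lambda>s. \<ominus> commutator A (x i) s)"

text \<open>
  The map \<open>-ad x\<^sub>i\<close> lowers the order of a higher derivation by one and commutes with multiplication by
  everything that commutes with \<open>x\<^sub>i\<close>.
\<close>

lemma nad_x_d:
  assumes i: "i < n" and u: "u \<in> carrier A" "x i \<otimes> u = u \<otimes> x i" and w: "w \<in> carrier A" "x i \<otimes> w = w \<otimes> x i"
  shows "nad_x i (w \<otimes> d i l \<otimes> u) = (if l = 0 then \<zero> else w \<otimes> d i (l - 1) \<otimes> u)"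
proof (cases l)
  case 0
  have "x i \<otimes> (w \<otimes> u) = (w \<otimes> u) \<otimes> x i"
    using commute_mult[of "x i" w u] assms by simp
  then show ?thesis using 0 assms by (simp add: commutator_def minus_eq r_neg)
next
  case (Suc k)
  let ?X = "w \<otimes> (x i \<otimes> d i l) \<otimes> u" and ?Z = "w \<otimes> d i k \<otimes> u"
  have cl: "?X \<in> carrier A" "?Z \<in> carrier A" using assms by simp_all
  have "x i \<otimes> (w \<otimes> d i l \<otimes> u) = x i \<otimes> w \<otimes> (d i l \<otimes> u)" using assms(1,2,4) by (simp add: m_assoc)
  also have "\<dots> = ?X" unfolding w(2) using assms(1,2,4) by (simp add: m_assoc)
  finally have 1: "x i \<otimes> (w \<otimes> d i l \<otimes> u) = ?X" .
  have "(w \<otimes> d i l \<otimes> u) \<otimes> x i = w \<otimes> d i l \<otimes> (u \<otimes> x i)" using assms(1,2,4) by (simp add: m_assoc)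
  also have "\<dots> = w \<otimes> (d i l \<otimes> x i) \<otimes> u" unfolding u(2)[symmetric] using assms(1,2,4) by (simp add: m_assoc)
  also have "\<dots> = ?X \<oplus> ?Z" unfolding Suc dx[OF i] using assms(1,2,4) by (simp add: r_distr l_distr)
  finally have 2: "(w \<otimes> d i l \<otimes> u) \<otimes> x i = ?X \<oplus> ?Z" .
  have "commutator A (x i) (w \<otimes> d i l \<otimes> u) = \<ominus> ?Z"
    unfolding commutator_def 1 2 using cl by (simp add: minus_eq minus_add r_neg2)
  then show ?thesis using assms Suc by simp
qed

lemma funpow_nad_x_d:
  assumes i: "i < n" and u: "u \<in> carrier A" "x i \<otimes> u = u \<otimes> x i" and w: "w \<in> carrier A" "x i \<otimes> w = w \<otimes> x i"
  shows "(nad_x i ^^ k) (w \<otimes> d i l \<otimes> u) = (if k \<le> l then w \<otimes> d i (l - k) \<otimes> u else \<zero>)"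
proof (induction k)
  case (Suc k)
  have z: "nad_x i \<zero> = \<zero>" using i by (simp add: commutator_def minus_eq)
  show ?case
    using Suc nad_x_d[OF assms, of "l - k"] z by (cases "k < l") (auto simp: Suc_diff_Suc)
qed (use assms in auto)

lemma funpow_ad_x_eq:
  assumes i: "i < n" and s: "s \<in> carrier A"
  shows "(ad_x i ^^ k) s = (-1) ^ k \<odot> (nad_x i ^^ k) s"
proof (induction k)
  case (Suc k)
  have c: "(nad_x i ^^ k) s \<in> carrier A" using linearD(1)[OF linear_funpow[OF linear_neg_commutator]] i s by blast
  have "(ad_x i ^^ Suc k) s = (-1) ^ k \<odot> ad_x i ((nad_x i ^^ k) s)"
    using Suc linearD(3)[OF linear_commutator[OF x_closed[OF i]] c] by simp
  moreover have "(-1) ^ Suc k \<odot> (\<ominus> ad_x i t) = ((-1) ^ Suc k * (-1)) \<odot> ad_x i t" if "t \<in> carrier A" for t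
    using that i by (subst smult_assoc1) (simp_all add: smult_minus1)
  ultimately show ?case using c by simp
qed (use s in simp)

lemma funpow_ad_x_d:
  assumes i: "i < n" and u: "u \<in> carrier A" "x i \<otimes> u = u \<otimes> x i" and w: "w \<in> carrier A" "x i \<otimes> w = w \<otimes> x i"
  shows "(ad_x i ^^ k) (w \<otimes> d i l \<otimes> u) = (if k \<le> l then (-1) ^ k \<odot> (w \<otimes> d i (l - k) \<otimes> u) else \<zero>)"
  using funpow_nad_x_d[OF assms] funpow_ad_x_eq[OF i] assms by simp

section \<open>Monomials and normal forms\<close>

abbreviation Y :: "(nat \<Rightarrow>\<^sub>0 nat) \<Rightarrow> 'a" where
  "Y \<equiv> mpow A m y"

lemma y_centre: "j < m \<Longrightarrow> y j \<in> centre"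
  by (simp add: centre_def y_central)

lemma centre_one: "\<one> \<in> centre"
  by (simp add: centre_def)

lemma centreI: "v \<in> carrier A \<Longrightarrow> (\<And>a. a \<in> carrier A \<Longrightarrow> v \<otimes> a = a \<otimes> v) \<Longrightarrow> v \<in> centre"
  unfolding centre_def by blast

lemma centre_mult:
  assumes u: "u \<in> centre" and v: "v \<in> centre" shows "u \<otimes> v \<in> centre"
proof (rule centreI)
  show "u \<otimes> v \<in> carrier A" using centreD(1)[OF u] centreD(1)[OF v] by simp
  fix a assume a: "a \<in> carrier A"
  show "(u \<otimes> v) \<otimes> a = a \<otimes> (u \<otimes> v)"
    by (rule commute_mult[OF a centreD(1)[OF u] centreD(1)[OF v] centreD(2)[OF u a] centreD(2)[OF v a]])
qed

lemma centre_add: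
  assumes "u \<in> centre" "v \<in> centre" shows "u \<oplus> v \<in> centre"
proof (rule centreI)
  have c: "u \<in> carrier A" "v \<in> carrier A" using assms by (simp_all add: centreD(1))
  then show "u \<oplus> v \<in> carrier A" by simp
  fix a assume a: "a \<in> carrier A"
  have "(u \<oplus> v) \<otimes> a = u \<otimes> a \<oplus> v \<otimes> a" using a c by (simp add: l_distr)
  also have "\<dots> = a \<otimes> u \<oplus> a \<otimes> v" by (simp only: centreD(2)[OF assms(1) a] centreD(2)[OF assms(2) a])
  also have "\<dots> = a \<otimes> (u \<oplus> v)" using a c by (simp add: r_distr)
  finally show "(u \<oplus> v) \<otimes> a = a \<otimes> (u \<oplus> v)" .
qed

lemma centre_smult:
  assumes "u \<in> centre" shows "c \<odot> u \<in> centre"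
proof (rule centreI)
  have u: "u \<in> carrier A" using assms by (rule centreD)
  then show "c \<odot> u \<in> carrier A" by simp
  fix a assume a: "a \<in> carrier A"
  have "(c \<odot> u) \<otimes> a = c \<odot> (u \<otimes> a)" using a u by (simp add: smult_mult_left)
  also have "\<dots> = c \<odot> (a \<otimes> u)" by (simp only: centreD(2)[OF assms a])
  also have "\<dots> = a \<otimes> (c \<odot> u)" using a u by (simp add: smult_mult_right)
  finally show "(c \<odot> u) \<otimes> a = a \<otimes> (c \<odot> u)" .
qed

lemma subspace_centre: "subspace centre"
proof (rule subspaceI)
  show "centre \<subseteq> carrier A" by (auto dest: centreD(1))
  show "\<zero> \<in> centre" by (rule centreI) simp_all
qed (simp_all add: centre_add centre_smult)

lemma centre_pow: "u \<in> centre \<Longrightarrow> u [^] (k::nat) \<in> centre"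
  by (induction k) (simp_all add: centre_one centre_mult)

lemma centre_oprod: "(\<And>i. i < k \<Longrightarrow> f i \<in> centre) \<Longrightarrow> oprod A f k \<in> centre"
proof (induction k)
  case (Suc k)
  have "oprod A f (Suc k) = oprod A f k \<otimes> f k"
    by (rule oprod_Suc) (use Suc.prems centreD(1) in blast)
  then show ?case using Suc by (simp add: centre_mult)
qed (simp add: centre_one)

lemma Y_centre: "Y \<gamma> \<in> centre"
  unfolding mpow_def by (intro centre_oprod centre_pow y_centre)

lemma Y_closed [simp, intro]: "Y \<gamma> \<in> carrier A"
  using Y_centre centreD by blast

lemma Y_zero [simp]: "Y 0 = \<one>"
  unfolding mpow_def by (rule oprod_one) simp

lemma Y_add: "Y (\<gamma> + \<gamma>') = Y \<gamma> \<otimes> Y \<gamma>'"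
proof -
  have "Y \<gamma> \<otimes> Y \<gamma>' = oprod A (\<lambda>j. y j [^] lookup \<gamma> j \<otimes> y j [^] lookup \<gamma>' j) m"
    unfolding mpow_def by (rule oprod_mult) (auto intro!: centreD(2) centre_pow y_centre)
  also have "\<dots> = Y (\<gamma> + \<gamma>')"
    unfolding mpow_def by (rule oprod_cong) (simp add: nat_pow_mult lookup_add)
  finally show ?thesis by simp
qed

lemma Y_single: "j < m \<Longrightarrow> Y (single j k) = y j [^] k"
proof -
  assume j: "j < m"
  have "Y (single j k) = oprod A (\<lambda>i. if i = j then y j [^] k else \<one>) m"
    unfolding mpow_def by (rule oprod_cong) (auto simp: lookup_single when_def)
  then show ?thesis using oprod_delta[of "y j [^] k" j m] j by simp
qed

text \<open>
  Monomials with an arbitrary choice \<open>F i a b\<close> of the factor in block \<open>i\<close>.  The cases needed are the two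
  normal orderings \<open>dx_mono\<close> and \<open>xd_mono\<close> of \<open>x\<^sub>i\<^sup>a\<close> and \<open>\<partial>\<^sub>i\<^bsup>[b]\<^esup>\<close>, and \<open>x_mono\<close>, which ignores \<open>b\<close>.
\<close>

definition block_mono :: "(nat \<Rightarrow> nat \<Rightarrow> nat \<Rightarrow> 'a) \<Rightarrow> (nat \<Rightarrow>\<^sub>0 nat) \<times> (nat \<Rightarrow>\<^sub>0 nat) \<times> (nat \<Rightarrow>\<^sub>0 nat) \<Rightarrow> 'a" where
  "block_mono F = (\<lambda>(\<alpha>, \<beta>, \<gamma>). oprod A (\<lambda>i. F i (lookup \<alpha> i) (lookup \<beta> i)) n \<otimes> Y \<gamma>)"

abbreviation indices :: "((nat \<Rightarrow>\<^sub>0 nat) \<times> (nat \<Rightarrow>\<^sub>0 nat) \<times> (nat \<Rightarrow>\<^sub>0 nat)) set" where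
  "indices \<equiv> mindex n \<times> mindex n \<times> mindex m"

lemma block_mono_closed:
  assumes "\<And>i a b. i < n \<Longrightarrow> F i a b \<in> block i"
  shows "block_mono F \<tau> \<in> carrier A"
proof -
  have "oprod A (\<lambda>i. F i (lookup \<alpha> i) (lookup \<beta> i)) n \<in> carrier A" for \<alpha> \<beta>
    by (rule block_oprod_closed) (rule assms)
  then show ?thesis by (auto simp: block_mono_def split: prod.split)
qed

text \<open>
  Replacing the factor of one block by a combination of factors of the same shape stays inside the
  span of the monomials.
\<close>

lemma block_mono_update:
  assumes F: "\<And>i a b. i < n \<Longrightarrow> F i a b \<in> block i"
    and i: "i < n" and \<tau>: "(\<alpha>, \<beta>, \<gamma>) \<in> indices"
    and u: "u \<in> span {F i a b | a b. True}"
  shows "u \<otimes> (oprod A ((\<lambda>i. F i (lookup \<alpha> i) (lookup \<beta> i))(i := \<one>)) n \<otimes> Y \<gamma>)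
     \<in> span (block_mono F ` indices)"
proof -
  let ?e = "\<lambda>\<alpha> \<beta> i. F i (lookup \<alpha> i) (lookup \<beta> i)"
  define r where "r = oprod A ((?e \<alpha> \<beta>)(i := \<one>)) n"
  have r: "r \<in> carrier A" unfolding r_def by (intro oprod_closed) (use F block_closed in auto)
  have sub: "{F i a b | a b. True} \<subseteq> carrier A" using F[OF i] block_closed[OF i] by auto
  have "span {F i a b | a b. True} \<subseteq> carrier A" using span_subset_subspace[OF sub] by simp
  then have cl: "u \<in> span {F i a b | a b. True} \<Longrightarrow> u \<in> carrier A" for u by blast
  show ?thesis using u unfolding r_def[symmetric]
  proof induction
    case zero
    then show ?case using r by (simp add: span.zero)
  next
    case (base c)
    then obtain a b where c: "c = F i a b" by auto
    have "c \<otimes> r = oprod A ((?e \<alpha> \<beta>)(i := c)) n"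
      unfolding c r_def by (rule oprod_central_update) (use F i in auto)
    also have "\<dots> = oprod A (?e (Poly_Mapping.update i a \<alpha>) (Poly_Mapping.update i b \<beta>)) n"
      by (rule oprod_cong) (auto simp: c lookup_update)
    finally have "c \<otimes> (r \<otimes> Y \<gamma>) = block_mono F (Poly_Mapping.update i a \<alpha>, Poly_Mapping.update i b \<beta>, \<gamma>)"
      using c F[OF i] block_closed[OF i] r by (simp add: block_mono_def flip: m_assoc)
    then show ?case using \<tau> i by (auto intro!: span.base mindex_update)
  next
    case (add u v)
    then show ?case using cl[of u] cl[of v] r by (simp add: l_distr span.add)
  next
    case (smult u c)
    then show ?case using cl[of u] r by (simp add: smult_mult_left span.smult)
  qed
qed

lemma y_mult_block_mono:
  assumes F: "\<And>i a b. i < n \<Longrightarrow> F i a b \<in> block i" and j: "j < m" and \<tau>: "\<tau> \<in> indices"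
  shows "y j \<otimes> block_mono F \<tau> \<in> span (block_mono F ` indices)"
proof -
  obtain \<alpha> \<beta> \<gamma> where t: "\<tau> = (\<alpha>, \<beta>, \<gamma>)" by (cases \<tau>)
  let ?E = "oprod A (\<lambda>i. F i (lookup \<alpha> i) (lookup \<beta> i)) n"
  have E: "?E \<in> carrier A" by (rule block_oprod_closed) (rule F)
  have "y j \<otimes> (?E \<otimes> Y \<gamma>) = (y j \<otimes> ?E) \<otimes> Y \<gamma>" using E j by (simp add: m_assoc)
  also have "\<dots> = ?E \<otimes> (y j \<otimes> Y \<gamma>)" using E j by (simp add: y_central m_assoc)
  also have "\<dots> = ?E \<otimes> Y (single j 1 + \<gamma>)"
    using j by (simp only: Y_add Y_single) simp
  finally have "y j \<otimes> block_mono F \<tau> = block_mono F (\<alpha>, \<beta>, single j 1 + \<gamma>)"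
    by (simp add: block_mono_def t)
  then show ?thesis using \<tau> j by (auto simp: t intro!: span.base mindex_add mindex_single)
qed

lemma one_block_mono:
  assumes F1: "\<And>i. i < n \<Longrightarrow> F i 0 0 = \<one>"
  shows "\<one> \<in> span (block_mono F ` indices)"
proof -
  have "oprod A (\<lambda>i. F i 0 0) n = \<one>" by (rule oprod_one) (rule F1)
  then have "block_mono F (0, 0, 0) = \<one>" by (simp add: block_mono_def)
  moreover have "block_mono F (0, 0, 0) \<in> span (block_mono F ` indices)"
    by (intro span.base imageI) (simp add: mindex_zero)
  ultimately show ?thesis by simp
qed

lemma span_stable_left:
  assumes B: "B \<subseteq> carrier A" and s: "s \<in> carrier A" "\<And>b. b \<in> B \<Longrightarrow> s \<otimes> b \<in> span B" and u: "u \<in> span B"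
  shows "s \<otimes> u \<in> span B"
proof -
  have cl: "u \<in> span B \<Longrightarrow> u \<in> carrier A" for u using span_subset_subspace[OF B] by auto
  from u show ?thesis
  proof induction
    case (add u v) then show ?case using cl s by (simp add: r_distr span.add)
  next
    case (smult u c) then show ?case using cl s by (simp add: smult_mult_right span.smult)
  qed (use s in \<open>auto intro: span.zero\<close>)
qed

abbreviation generators :: "'a set" where
  "generators \<equiv> x ` {..<n} \<union> case_prod d ` ({..<n} \<times> UNIV) \<union> y ` {..<m}"

lemma generators_cases:
  assumes "g \<in> generators"
  obtains i where "i < n" "g = x i" | i k where "i < n" "g = d i k" | j where "j < m" "g = y j"
  using assms by auto

text \<open>
  The elements that map the span to itself by left multiplication form a subalgebra.  It contains the
  generators, hence everything, and the span contains the unit.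
\<close>

lemma left_stable_span_eq_carrier:
  assumes B: "B \<subseteq> carrier A" "\<one> \<in> span B" and g: "\<And>g b. g \<in> generators \<Longrightarrow> b \<in> B \<Longrightarrow> g \<otimes> b \<in> span B"
  shows "carrier A = span B"
proof -
  have cl: "u \<in> span B \<Longrightarrow> u \<in> carrier A" for u using span_subset_subspace[OF B(1)] by auto
  have "s \<in> carrier A \<and> (\<forall>u\<in>span B. s \<otimes> u \<in> span B)" if "s \<in> gen_alg generators" for s
    using that
  proof induction
    case (base b)
    then have "b \<in> carrier A" by (elim generators_cases) auto
    then show ?case using span_stable_left[OF B(1)] g base by blast
  next
    case (add s t)
    then have "(s \<oplus> t) \<otimes> u \<in> span B" if "u \<in> span B" for u
      using that cl[OF that] span.add[of "s \<otimes> u" B "t \<otimes> u"] by (simp add: l_distr)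
    then show ?case using add by simp
  next
    case (mult s t)
    then have "(s \<otimes> t) \<otimes> u \<in> span B" if "u \<in> span B" for u
      using that cl[OF that] by (simp add: m_assoc)
    then show ?case using mult by simp
  next
    case (smult s c)
    then have "(c \<odot> s) \<otimes> u \<in> span B" if "u \<in> span B" for u
      using that cl[OF that] span.smult[of "s \<otimes> u" B c] by (simp add: smult_mult_left)
    then show ?case using smult by simp
  next
    case one then show ?case by (simp add: cl)
  qed
  then have "s \<otimes> \<one> \<in> span B" if "s \<in> carrier A" for s using that generated B(2) by blast
  then show ?thesis using cl by auto
qed

lemma x_pow_comm: "i < n \<Longrightarrow> x i \<otimes> x i [^] (a::nat) = x i [^] a \<otimes> x i"
  using nat_pow_Suc2[of "x i" a] by simp

text \<open>
  The Leibniz rule for higher derivations, by induction on \<open>a\<close> with Pascal's rule.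
\<close>

lemma leibniz:
  assumes i: "i < n"
  shows "d i k \<otimes> x i [^] (a::nat) = finsum A (\<lambda>j. of_nat (a choose j) \<odot> (x i [^] (a - j) \<otimes> d i (k - j))) {..k}"
proof (induction a arbitrary: k)
  case 0
  have "finsum A (\<lambda>j. of_nat (0 choose j) \<odot> (x i [^] (0 - j) \<otimes> d i (k - j))) {..k}
      = finsum A (\<lambda>j. if j = 0 then d i k else \<zero>) {..k}"
    by (rule finsum_cong') (use i in \<open>auto simp: binomial_eq_0\<close>)
  then show ?case using i add.finprod_singleton_swap[of 0 "{..k}" "\<lambda>_. d i k"] by simp
next
  case (Suc a)
  show ?case
  proof (cases k)
    case 0
    then show ?thesis using i by simp
  next
    case (Suc k')
    let ?f = "\<lambda>a k j. of_nat (a choose j) \<odot> (x i [^] (a - j) \<otimes> d i (k - j))"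
    have "d i k \<otimes> x i [^] Suc a = (d i k \<otimes> x i) \<otimes> x i [^] a"
      using i by (simp add: m_assoc x_pow_comm)
    also have "\<dots> = x i \<otimes> (d i k \<otimes> x i [^] a) \<oplus> d i k' \<otimes> x i [^] a"
      unfolding Suc dx[OF i] using i by (simp add: l_distr m_assoc)
    also have "\<dots> = x i \<otimes> finsum A (?f a k) {..k} \<oplus> finsum A (?f a k') {..k'}"
      by (simp only: Suc.IH)
    also have "finsum A (?f a k) {..k} = finsum A (\<lambda>j. ?f a k (Suc j)) {..k'} \<oplus> x i [^] a \<otimes> d i k"
      using i unfolding Suc by (subst finsum_Suc2) auto
    also have "x i \<otimes> (finsum A (\<lambda>j. ?f a k (Suc j)) {..k'} \<oplus> x i [^] a \<otimes> d i k)
        = finsum A (\<lambda>j. x i \<otimes> ?f a k (Suc j)) {..k'} \<oplus> x i [^] Suc a \<otimes> d i k"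
      using i by (simp add: r_distr finsum_rdistr m_assoc[symmetric] x_pow_comm)
    also have "finsum A (\<lambda>j. x i \<otimes> ?f a k (Suc j)) {..k'}
        = finsum A (\<lambda>j. of_nat (a choose Suc j) \<odot> (x i [^] (a - j) \<otimes> d i (k' - j))) {..k'}"
    proof (rule finsum_cong', goal_cases)
      case (3 j)
      show ?case
      proof (cases "Suc j \<le> a")
        case True
        then have "a - j = Suc (a - Suc j)" by simp
        then show ?thesis using i Suc by (simp add: smult_mult_right x_pow_comm m_assoc[symmetric])
      qed (use i in \<open>simp add: binomial_eq_0\<close>)
    qed (use i in auto)
    finally have "d i k \<otimes> x i [^] Suc a = finsum A (\<lambda>j. of_nat (a choose Suc j) \<odot> (x i [^] (a - j) \<otimes> d i (k' - j))) {..k'}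
       \<oplus> finsum A (?f a k') {..k'} \<oplus> x i [^] Suc a \<otimes> d i k"
      using i by (simp add: a_ac)
    also have "finsum A (\<lambda>j. of_nat (a choose Suc j) \<odot> (x i [^] (a - j) \<otimes> d i (k' - j))) {..k'}
       \<oplus> finsum A (?f a k') {..k'} = finsum A (\<lambda>j. ?f (Suc a) k (Suc j)) {..k'}"
      using i by (subst finsum_addf[symmetric])
        (auto intro!: finsum_cong' simp: Suc smult_l_distr a_comm)
    also have "\<dots> \<oplus> x i [^] Suc a \<otimes> d i k = finsum A (?f (Suc a) k) {..k}"
      using i unfolding Suc by (subst finsum_Suc2) auto
    finally show ?thesis .
  qed
qed

definition dx_mono :: "nat \<Rightarrow> nat \<Rightarrow> nat \<Rightarrow> 'a" where
  "dx_mono i a b = d i b \<otimes> x i [^] a"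

definition xd_mono :: "nat \<Rightarrow> nat \<Rightarrow> nat \<Rightarrow> 'a" where
  "xd_mono i a b = x i [^] a \<otimes> d i b"

lemma dx_mono_block: "i < n \<Longrightarrow> dx_mono i a b \<in> block i"
  unfolding dx_mono_def by (intro block.mult block.d block_pow block.x)

lemma xd_mono_block: "i < n \<Longrightarrow> xd_mono i a b \<in> block i"
  unfolding xd_mono_def by (intro block.mult block.d block_pow block.x)

text \<open>
  Moving \<open>x\<^sub>i\<close> past \<open>\<partial>\<^sub>i\<^bsup>[b]\<^esup>\<close> produces one additional term of lower order.
\<close>

lemma generator_dx_mono:
  assumes i: "i < n" and g: "g = x i \<or> (\<exists>k. g = d i k)"
  shows "g \<otimes> dx_mono i a b \<in> span {dx_mono i a b | a b. True}"
  using g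
proof
  assume g: "g = x i"
  show ?thesis
  proof (cases b)
    case 0
    then have "g \<otimes> dx_mono i a b = dx_mono i (Suc a) 0" using i by (simp add: g dx_mono_def x_pow_comm)
    then show ?thesis by (auto intro: span.base)
  next
    case (Suc b')
    have "g \<otimes> dx_mono i a b = (x i \<otimes> d i b) \<otimes> x i [^] a" using i by (simp add: g dx_mono_def m_assoc)
    also have "\<dots> = dx_mono i (Suc a) b \<oplus> (-1) \<odot> dx_mono i a b'"
      using i unfolding Suc xd[OF i]
      by (simp add: dx_mono_def x_pow_comm minus_eq l_distr l_minus m_assoc smult_minus1)
    finally show ?thesis by (auto intro!: span.add span.smult intro: span.base)
  qed
next
  assume "\<exists>k. g = d i k"
  then obtain k where g: "g = d i k" ..
  have "g \<otimes> dx_mono i a b = (d i k \<otimes> d i b) \<otimes> x i [^] a" using i by (simp add: g dx_mono_def m_assoc)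
  also have "\<dots> = of_nat ((k + b) choose k) \<odot> dx_mono i a (k + b)"
    using i by (simp add: d_mult dx_mono_def smult_mult_left)
  finally show ?thesis by (auto intro!: span.smult intro: span.base)
qed

text \<open>
  A higher derivation is moved past a power of \<open>x\<^sub>i\<close> with the Leibniz rule.
\<close>

lemma generator_xd_mono:
  assumes i: "i < n" and g: "g = x i \<or> (\<exists>k. g = d i k)"
  shows "g \<otimes> xd_mono i a b \<in> span {xd_mono i a b | a b. True}"
  using g
proof
  assume g: "g = x i"
  then have "g \<otimes> xd_mono i a b = xd_mono i (Suc a) b"
    using i by (simp add: xd_mono_def x_pow_comm flip: m_assoc)
  then show ?thesis by (auto intro: span.base)
next
  let ?B = "{xd_mono i a b | a b. True}"
  have "?B \<subseteq> carrier A" using i by (auto simp: xd_mono_def)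
  note sub = subspace_span[OF this]
  assume "\<exists>k. g = d i k"
  then obtain k where g: "g = d i k" ..
  let ?f = "\<lambda>j. of_nat (a choose j) \<odot> (x i [^] (a - j) \<otimes> d i (k - j))"
  have "g \<otimes> xd_mono i a b = (d i k \<otimes> x i [^] a) \<otimes> d i b" using i by (simp add: g xd_mono_def m_assoc)
  also have "\<dots> = finsum A (\<lambda>j. ?f j \<otimes> d i b) {..k}"
    unfolding leibniz[OF i] by (rule finsum_ldistr) (use i in auto)
  also have "\<dots> \<in> span ?B"
  proof (rule finsum_subspace[OF sub])
    fix j
    have "?f j \<otimes> d i b = of_nat (a choose j) \<odot> (of_nat (((k - j) + b) choose (k - j)) \<odot> xd_mono i (a - j) ((k - j) + b))"
      using i by (simp add: xd_mono_def smult_mult_left smult_mult_right m_assoc d_mult)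
    also have "\<dots> \<in> span ?B" by (intro span.smult span.base) auto
    finally show "?f j \<otimes> d i b \<in> span ?B" .
  qed simp
  finally show ?thesis .
qed

lemma carrier_eq_span_block_mono:
  assumes F: "\<And>i a b. i < n \<Longrightarrow> F i a b \<in> block i" and F1: "\<And>i. i < n \<Longrightarrow> F i 0 0 = \<one>"
    and step: "\<And>i g a b. i < n \<Longrightarrow> g = x i \<or> (\<exists>k. g = d i k) \<Longrightarrow> g \<otimes> F i a b \<in> span {F i a b | a b. True}"
  shows "carrier A = span (block_mono F ` indices)"
proof (rule left_stable_span_eq_carrier)
  let ?B = "block_mono F ` indices"
  show "?B \<subseteq> carrier A" using block_mono_closed F by blast
  show "\<one> \<in> span ?B" by (rule one_block_mono) (rule F1)
  fix g b assume g: "g \<in> generators" and "b \<in> ?B"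
  then obtain \<alpha> \<beta> \<gamma> where t: "(\<alpha>, \<beta>, \<gamma>) \<in> indices" and b: "b = block_mono F (\<alpha>, \<beta>, \<gamma>)" by auto
  let ?e = "\<lambda>i. F i (lookup \<alpha> i) (lookup \<beta> i)"
  have *: "g \<otimes> b \<in> span ?B" if i: "i < n" and gi: "g = x i \<or> (\<exists>k. g = d i k)" for i
  proof -
    let ?r = "oprod A (?e(i := \<one>)) n"
    have r: "?r \<in> carrier A" using block_oprod_rest[of ?e i] i F centD(1) by blast
    have ei: "?e i \<in> carrier A" "g \<in> carrier A" using F i block_closed gi by auto
    have "b = ?e i \<otimes> (?r \<otimes> Y \<gamma>)"
      using block_oprod_pull[of ?e i] i F r ei by (simp add: b block_mono_def m_assoc)
    then have "g \<otimes> b = (g \<otimes> ?e i) \<otimes> (?r \<otimes> Y \<gamma>)" using ei r by (simp add: m_assoc)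
    also have "\<dots> \<in> span ?B"
      by (rule block_mono_update) (use F t i step gi in auto)
    finally show ?thesis .
  qed
  from g show "g \<otimes> b \<in> span ?B"
  proof (cases rule: generators_cases)
    case (3 j)
    then show ?thesis using y_mult_block_mono[of F j] F t b by blast
  qed (use * in blast)+
qed

lemma carrier_eq_span_dx: "carrier A = span (block_mono dx_mono ` indices)"
  by (rule carrier_eq_span_block_mono[of dx_mono, OF dx_mono_block _ generator_dx_mono]) (simp_all add: dx_mono_def)

lemma carrier_eq_span_xd: "carrier A = span (block_mono xd_mono ` indices)"
  by (rule carrier_eq_span_block_mono[of xd_mono, OF xd_mono_block _ generator_xd_mono]) (simp_all add: xd_mono_def)

section \<open>The operators \<open>\<phi>\<close> and \<open>\<psi>\<close> in one variable\<close>

lemma block_mono_split: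
  assumes "\<And>i a b. i < n \<Longrightarrow> F i a b \<in> block i" "i < n"
  shows "\<exists>a b. \<exists>v\<in>centralizer i. block_mono F \<tau> = F i a b \<otimes> v"
proof -
  obtain \<alpha> \<beta> \<gamma> where t: "\<tau> = (\<alpha>, \<beta>, \<gamma>)" by (cases \<tau>)
  let ?e = "\<lambda>i. F i (lookup \<alpha> i) (lookup \<beta> i)"
  define r where "r = oprod A (?e(i := \<one>)) n"
  have r: "r \<in> centralizer i" unfolding r_def by (rule block_oprod_rest) (use assms in auto)
  have e: "?e i \<in> carrier A" using assms block_closed by blast
  have "oprod A ?e n = ?e i \<otimes> r" unfolding r_def by (rule block_oprod_pull) (use assms in auto)
  then have "block_mono F \<tau> = ?e i \<otimes> (r \<otimes> Y \<gamma>)"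
    using centD(1)[OF r] e by (simp add: block_mono_def t m_assoc)
  then show ?thesis using cent_mult[OF assms(2) r centre_cent[OF assms(2) Y_centre]] by blast
qed

text \<open>
  Local nilpotency makes the sums that define \<open>phi_d\<close> and \<open>psi_d\<close> finite.  It suffices to check it on
  normally ordered monomials, where \<open>ad x\<^sub>i\<close> lowers the order in \<open>\<partial>\<^sub>i\<close>.
\<close>

lemma ad_x_nilpotent:
  assumes i: "i < n" and s: "s \<in> carrier A"
  shows "\<exists>N. \<forall>k\<ge>N. (ad_x i ^^ k) s = \<zero>"
proof -
  have lin: "linear (carrier A) (carrier A) (ad_x i ^^ k)" for k
    by (intro linear_funpow linear_commutator x_closed i)
  have sub: "block_mono dx_mono ` indices \<subseteq> carrier A" using block_mono_closed dx_mono_block by blast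
  have z: "(ad_x i ^^ k) \<zero> = \<zero>" for k by (rule linear_zero[OF lin]) simp_all
  have "s \<in> span (block_mono dx_mono ` indices)" using s carrier_eq_span_dx by simp
  then have "s \<in> carrier A \<and> (\<exists>N. \<forall>k\<ge>N. (ad_x i ^^ k) s = \<zero>)"
  proof induction
    case (base b)
    then obtain \<tau> where b: "b = block_mono dx_mono \<tau>" by auto
    obtain a c v where v: "v \<in> centralizer i" "block_mono dx_mono \<tau> = dx_mono i a c \<otimes> v"
      using block_mono_split[of dx_mono, OF dx_mono_block i] by blast
    have vc: "v \<in> carrier A" by (rule centD(1)[OF v(1)])
    let ?u = "x i [^] a \<otimes> v"
    have u: "?u \<in> carrier A" "x i \<otimes> ?u = ?u \<otimes> x i"
      using i vc commute_mult[of "x i" "x i [^] a" v] x_pow_comm[OF i, of a] centD(2)[OF v(1)] by simp_all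
    have "b = \<one> \<otimes> d i c \<otimes> ?u" using v i vc by (simp add: b dx_mono_def m_assoc)
    then have "(ad_x i ^^ k) b = \<zero>" if "k \<ge> Suc c" for k
      using funpow_ad_x_d[OF i u, of \<one> k c] i that by simp
    then show ?case using subsetD[OF sub base] by (intro conjI exI[of _ "Suc c"] allI impI)
  next
    case (add u v)
    then obtain N M where "\<forall>k\<ge>N. (ad_x i ^^ k) u = \<zero>" "\<forall>k\<ge>M. (ad_x i ^^ k) v = \<zero>" by blast
    then have "(ad_x i ^^ k) (u \<oplus> v) = \<zero>" if "k \<ge> max N M" for k
      using add that by (simp add: linearD(2)[OF lin])
    then show ?case using add by blast
  next
    case (smult u c)
    then obtain N where "\<forall>k\<ge>N. (ad_x i ^^ k) u = \<zero>" by blast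
    then have "(ad_x i ^^ k) (c \<odot> u) = \<zero>" if "k \<ge> N" for k
      using smult that by (simp add: linearD(3)[OF lin])
    then show ?case using smult by blast
  qed (use z in auto)
  then show ?thesis by blast
qed

lemma finite_ad_x:
  assumes "i < n" "s \<in> carrier A" "\<And>k. (ad_x i ^^ k) s = \<zero> \<Longrightarrow> f k = \<zero>"
  shows "finite {k. f k \<noteq> \<zero>}"
proof -
  obtain N where "\<forall>k\<ge>N. (ad_x i ^^ k) s = \<zero>" using ad_x_nilpotent[OF assms(1,2)] by blast
  then have "{k. f k \<noteq> \<zero>} \<subseteq> {..<N}" using assms(3) by (metis (mono_tags, lifting) lessThan_iff linorder_not_le mem_Collect_eq subsetI)
  then show ?thesis by (rule finite_subset) simp
qed

lemma linear_phi_d: "i < n \<Longrightarrow> linear (carrier A) (carrier A) (phi_d A x d i)"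
  unfolding phi_d_def
proof (rule linear_fsum)
  assume i: "i < n"
  show "linear (carrier A) (carrier A) (\<lambda>s. d i k \<otimes> (ad_x i ^^ k) s)" for k
    by (rule linear_comp[OF linear_mult_left linear_funpow[OF linear_commutator]]) (use i in simp_all)
  show "finite {k. d i k \<otimes> (ad_x i ^^ k) s \<noteq> \<zero>}" if "s \<in> carrier A" for s
    by (rule finite_ad_x[OF i that]) (use i in simp)
qed simp

lemma linear_psi_d: "i < n \<Longrightarrow> linear (carrier A) (carrier A) (psi_d A x d i)"
  unfolding psi_d_def
proof (rule linear_fsum)
  assume i: "i < n"
  show "linear (carrier A) (carrier A) (\<lambda>s. (ad_x i ^^ k) s \<otimes> d i k)" for k
    by (rule linear_comp[OF linear_mult_right linear_funpow[OF linear_commutator]]) (use i in simp_all)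
  show "finite {k. (ad_x i ^^ k) s \<otimes> d i k \<noteq> \<zero>}" if "s \<in> carrier A" for s
    by (rule finite_ad_x[OF i that]) (use i in simp)
qed simp

lemma psi_d_mult:
  assumes i: "i < n" and s: "s \<in> carrier A" and v: "v \<in> centralizer i"
  shows "psi_d A x d i (s \<otimes> v) = psi_d A x d i s \<otimes> v"
proof -
  have vc: "v \<in> carrier A" "x i \<otimes> v = v \<otimes> x i" using centD[OF v] by simp_all
  have e: "(ad_x i ^^ k) (s \<otimes> v) \<otimes> d i k = ((ad_x i ^^ k) s \<otimes> d i k) \<otimes> v" for k
  proof -
    have "(ad_x i ^^ k) (s \<otimes> v) \<otimes> d i k = (ad_x i ^^ k) s \<otimes> (v \<otimes> d i k)"
      using i s vc by (simp add: funpow_commutator_mult_commuting m_assoc)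
    then show ?thesis unfolding centD(3)[OF v] using i s vc(1) by (simp add: m_assoc)
  qed
  have "psi_d A x d i (s \<otimes> v) = fsum A (\<lambda>k. ((ad_x i ^^ k) s \<otimes> d i k) \<otimes> v) UNIV"
    unfolding psi_d_def e ..
  also have "\<dots> = psi_d A x d i s \<otimes> v"
    unfolding psi_d_def
    by (rule fsum_mult_right[OF _ finite_ad_x[OF i s]]) (use i s vc in simp_all)
  finally show ?thesis .
qed

lemma alternating_choose_sum:
  "(\<Sum>k\<le>l. (-1) ^ k * of_nat (l choose k) :: 'k) = (if l = 0 then 1 else 0)"
  using choose_alternating_sum[of l, where 'a = 'k] by simp

text \<open>
  The term for \<open>k\<close> is \<open>(-1)\<^sup>k \<partial>\<^sub>i\<^bsup>[k]\<^esup> \<partial>\<^sub>i\<^bsup>[l - k]\<^esup> u = (-1)\<^sup>k (l choose k) \<partial>\<^sub>i\<^bsup>[l]\<^esup> u\<close>.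
\<close>

lemma phi_d_d:
  assumes i: "i < n" and u: "u \<in> carrier A" "x i \<otimes> u = u \<otimes> x i"
  shows "phi_d A x d i (d i l \<otimes> u) = (if l = 0 then u else \<zero>)"
proof -
  have e: "d i k \<otimes> (ad_x i ^^ k) (d i l \<otimes> u) =
      (if k \<le> l then ((-1) ^ k * of_nat (l choose k)) \<odot> (d i l \<otimes> u) else \<zero>)" for k
  proof -
    have "d i k \<otimes> (d i (l - k) \<otimes> u) = of_nat (l choose k) \<odot> (d i l \<otimes> u)" if "k \<le> l"
      using i u that d_mult[OF i, of k "l - k"] by (simp add: smult_mult_left flip: m_assoc)
    then show ?thesis
      using funpow_ad_x_d[OF i u, of \<one> k l] i u by (simp add: smult_mult_right smult_assoc1)
  qed
  have "phi_d A x d i (d i l \<otimes> u) = finsum A (\<lambda>k. d i k \<otimes> (ad_x i ^^ k) (d i l \<otimes> u)) {..l}"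
    unfolding phi_d_def by (rule fsum_superset) (use i u in \<open>auto simp: fsupp_def e\<close>)
  also have "\<dots> = finsum A (\<lambda>k. ((-1) ^ k * of_nat (l choose k)) \<odot> (d i l \<otimes> u)) {..l}"
    by (rule finsum_cong') (use i u in \<open>auto simp: e\<close>)
  also have "\<dots> = (\<Sum>k\<le>l. (-1) ^ k * of_nat (l choose k)) \<odot> (d i l \<otimes> u)"
    using i u by (intro finsum_smult_left) auto
  finally show ?thesis using i u by (auto simp: alternating_choose_sum)
qed

lemma psi_d_d:
  assumes i: "i < n" and u: "u \<in> carrier A" "x i \<otimes> u = u \<otimes> x i"
  shows "psi_d A x d i (u \<otimes> d i l) = (if l = 0 then u else \<zero>)"
proof -
  have e: "(ad_x i ^^ k) (u \<otimes> d i l) \<otimes> d i k =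
      (if k \<le> l then ((-1) ^ k * of_nat (l choose k)) \<odot> (u \<otimes> d i l) else \<zero>)" for k
  proof -
    have "u \<otimes> d i (l - k) \<otimes> d i k = of_nat (l choose k) \<odot> (u \<otimes> d i l)" if "k \<le> l"
      using i u that d_mult[OF i, of "l - k" k] binomial_symmetric[OF that]
      by (simp add: smult_mult_right m_assoc)
    then show ?thesis
      using funpow_ad_x_d[OF i _ _ u, of \<one> k l] i u by (simp add: smult_mult_left smult_assoc1)
  qed
  have "psi_d A x d i (u \<otimes> d i l) = finsum A (\<lambda>k. (ad_x i ^^ k) (u \<otimes> d i l) \<otimes> d i k) {..l}"
    unfolding psi_d_def by (rule fsum_superset) (use i u in \<open>auto simp: fsupp_def e\<close>)
  also have "\<dots> = finsum A (\<lambda>k. ((-1) ^ k * of_nat (l choose k)) \<odot> (u \<otimes> d i l)) {..l}"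
    by (rule finsum_cong') (use i u in \<open>auto simp: e\<close>)
  also have "\<dots> = (\<Sum>k\<le>l. (-1) ^ k * of_nat (l choose k)) \<odot> (u \<otimes> d i l)"
    using i u by (intro finsum_smult_left) auto
  finally show ?thesis using i u by (auto simp: alternating_choose_sum)
qed

text \<open>
  Induction on \<open>a\<close>: one factor \<open>x\<^sub>i\<close> is moved to the right through \<open>\<partial>\<^sub>i\<^bsup>[k]\<^esup>\<close>, and the two resulting terms
  combine by Pascal's rule.
\<close>

lemma phi_d_normal:
  assumes i: "i < n" and u: "u \<in> carrier A" "x i \<otimes> u = u \<otimes> x i"
  shows "phi_d A x d i (d i l \<otimes> (x i [^] (a::nat) \<otimes> (d i k \<otimes> u))) =
    (if l = 0 then ((-1) ^ k * of_nat (a choose k)) \<odot> (x i [^] (a - k) \<otimes> u) else \<zero>)"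
  using u
proof (induction a arbitrary: k u)
  case 0
  have "d i l \<otimes> (x i [^] (0::nat) \<otimes> (d i k \<otimes> u)) = of_nat ((l + k) choose l) \<odot> (d i (l + k) \<otimes> u)"
    using i 0 by (simp add: d_mult smult_mult_left flip: m_assoc)
  then show ?case
    using i 0 linearD(3)[OF linear_phi_d[OF i]] phi_d_d[OF i 0, of "l + k"] by (simp add: binomial_eq_0)
next
  case (Suc a)
  let ?L = "\<lambda>w. d i l \<otimes> (x i [^] a \<otimes> w)"
  have "(x i \<otimes> u) \<otimes> x i = x i \<otimes> (u \<otimes> x i)" using i Suc.prems(1) by (simp add: m_assoc)
  then have xu: "x i \<otimes> u \<in> carrier A" "x i \<otimes> (x i \<otimes> u) = (x i \<otimes> u) \<otimes> x i"
    using i Suc.prems by simp_all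
  have pull: "d i l \<otimes> (x i [^] Suc a \<otimes> (d i k \<otimes> u)) = ?L (x i \<otimes> (d i k \<otimes> u))"
    using i Suc.prems(1) by (simp add: m_assoc)
  show ?case
  proof (cases k)
    case 0
    have "?L (x i \<otimes> (d i k \<otimes> u)) = ?L (d i 0 \<otimes> (x i \<otimes> u))"
      using i Suc.prems(1) by (simp add: 0)
    then show ?thesis unfolding pull using Suc.IH[OF xu, of 0] i Suc.prems(1)
      by (simp add: 0 m_assoc)
  next
    case (Suc k')
    have "x i \<otimes> (d i k \<otimes> u) = (x i \<otimes> d i k) \<otimes> u" using i Suc.prems(1) by (simp add: m_assoc)
    also have "\<dots> = d i k \<otimes> (x i \<otimes> u) \<oplus> (-1) \<odot> (d i k' \<otimes> u)"
      using i Suc.prems(1) unfolding Suc xd[OF i]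
      by (simp add: minus_eq l_distr l_minus m_assoc smult_minus1)
    finally have "?L (x i \<otimes> (d i k \<otimes> u)) = ?L (d i k \<otimes> (x i \<otimes> u)) \<oplus> (-1) \<odot> ?L (d i k' \<otimes> u)"
      using i Suc.prems(1) by (simp add: r_distr smult_mult_right)
    then have *: "phi_d A x d i (?L (x i \<otimes> (d i k \<otimes> u))) =
        phi_d A x d i (?L (d i k \<otimes> (x i \<otimes> u))) \<oplus> (-1) \<odot> phi_d A x d i (?L (d i k' \<otimes> u))"
      using i Suc.prems(1) by (simp add: linearD[OF linear_phi_d[OF i]])
    show ?thesis
    proof (cases "l = 0")
      case False
      then show ?thesis unfolding pull * using Suc.IH[OF xu, of k] Suc.IH[OF Suc.prems, of k'] by simp
    next
      case l: True
      have "of_nat (a choose k) \<odot> (x i [^] (a - k) \<otimes> (x i \<otimes> u)) = of_nat (a choose k) \<odot> (x i [^] (a - k') \<otimes> u)"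
      proof (cases "k \<le> a")
        case True
        then have "a - k' = Suc (a - k)" using Suc by simp
        then show ?thesis using i Suc.prems(1) by (simp add: m_assoc)
      qed (use i Suc.prems(1) in \<open>simp add: binomial_eq_0\<close>)
      then have "phi_d A x d i (?L (x i \<otimes> (d i k \<otimes> u))) =
         ((-1) ^ k * of_nat (a choose k)) \<odot> (x i [^] (a - k') \<otimes> u) \<oplus>
         (-1) \<odot> (((-1) ^ k' * of_nat (a choose k')) \<odot> (x i [^] (a - k') \<otimes> u))"
        unfolding * using Suc.IH[OF xu, of k] Suc.IH[OF Suc.prems, of k'] l i Suc.prems(1) xu(1)
        by (simp add: smult_assoc1)
      also have "\<dots> = ((-1) ^ k * of_nat (a choose k) + (-1) * ((-1) ^ k' * of_nat (a choose k'))) \<odot> (x i [^] (a - k') \<otimes> u)"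
        using i Suc.prems(1) by (subst smult_l_distr) (simp_all flip: smult_assoc1)
      also have "(-1) ^ k * of_nat (a choose k) + (-1) * ((-1) ^ k' * of_nat (a choose k')) = ((-1) ^ k * of_nat (Suc a choose k) :: 'k)"
        by (simp add: Suc algebra_simps)
      finally show ?thesis unfolding pull using l Suc by simp
    qed
  qed
qed

text \<open>
  As for \<open>phi_d_normal\<close>, but \<open>x\<^sub>i\<close> is moved to the left, which produces no signs.
\<close>

lemma psi_d_normal:
  assumes i: "i < n" and u: "u \<in> carrier A" "x i \<otimes> u = u \<otimes> x i"
  shows "psi_d A x d i (u \<otimes> (d i k \<otimes> (x i [^] (a::nat) \<otimes> d i l))) =
    (if l = 0 then of_nat (a choose k) \<odot> (u \<otimes> x i [^] (a - k)) else \<zero>)"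
  using u
proof (induction a arbitrary: k u)
  case 0
  have "u \<otimes> (d i k \<otimes> (x i [^] (0::nat) \<otimes> d i l)) = of_nat ((k + l) choose k) \<odot> (u \<otimes> d i (k + l))"
    using i 0 by (simp add: d_mult smult_mult_right)
  then show ?case
    using i 0 linearD(3)[OF linear_psi_d[OF i]] psi_d_d[OF i 0, of "k + l"] by (simp add: binomial_eq_0)
next
  case (Suc a)
  let ?R = "\<lambda>w k. w \<otimes> (d i k \<otimes> (x i [^] a \<otimes> d i l))"
  have "x i \<otimes> (u \<otimes> x i) = (x i \<otimes> u) \<otimes> x i" using i Suc.prems(1) by (simp add: m_assoc)
  then have xu: "u \<otimes> x i \<in> carrier A" "x i \<otimes> (u \<otimes> x i) = (u \<otimes> x i) \<otimes> x i"
    using i Suc.prems by simp_all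
  have pull: "u \<otimes> (d i k \<otimes> (x i [^] Suc a \<otimes> d i l)) = u \<otimes> ((d i k \<otimes> x i) \<otimes> (x i [^] a \<otimes> d i l))"
    using i Suc.prems(1) x_pow_comm[OF i, of a] by (simp add: m_assoc) (simp flip: m_assoc)
  have xx: "u \<otimes> x i \<otimes> x i [^] b = u \<otimes> x i [^] Suc b" for b :: nat
    using i Suc.prems(1) x_pow_comm[OF i, of b] by (simp add: m_assoc)
  show ?case
  proof (cases k)
    case 0
    then have "u \<otimes> ((d i k \<otimes> x i) \<otimes> (x i [^] a \<otimes> d i l)) = ?R (u \<otimes> x i) 0"
      using i Suc.prems(1) by (simp add: m_assoc)
    then show ?thesis unfolding pull using Suc.IH[OF xu, of 0] i Suc.prems(1) xx[of a]
      by (simp add: 0)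
  next
    case (Suc k')
    have "u \<otimes> ((d i k \<otimes> x i) \<otimes> (x i [^] a \<otimes> d i l)) = ?R (u \<otimes> x i) k \<oplus> ?R u k'"
      using i Suc.prems(1) unfolding Suc dx[OF i] by (simp add: l_distr r_distr m_assoc)
    then have *: "psi_d A x d i (u \<otimes> ((d i k \<otimes> x i) \<otimes> (x i [^] a \<otimes> d i l))) =
        psi_d A x d i (?R (u \<otimes> x i) k) \<oplus> psi_d A x d i (?R u k')"
      using i Suc.prems(1) by (simp add: linearD[OF linear_psi_d[OF i]])
    show ?thesis
    proof (cases "l = 0")
      case False
      then show ?thesis unfolding pull * using Suc.IH[OF xu, of k] Suc.IH[OF Suc.prems, of k'] by simp
    next
      case l: True
      have "of_nat (a choose k) \<odot> (u \<otimes> x i \<otimes> x i [^] (a - k)) = of_nat (a choose k) \<odot> (u \<otimes> x i [^] (a - k'))"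
      proof (cases "k \<le> a")
        case True
        then have "a - k' = Suc (a - k)" using Suc by simp
        then show ?thesis using xx by simp
      qed (use i Suc.prems(1) in \<open>simp add: binomial_eq_0\<close>)
      then show ?thesis
        unfolding pull * using Suc.IH[OF xu, of k] Suc.IH[OF Suc.prems, of k'] l i Suc.prems(1) Suc
        by (simp add: add.commute flip: smult_l_distr)
    qed
  qed
qed

section \<open>Extracting the constant term in the variables x\<close>

text \<open>
  In the Leibniz rule for \<open>\<partial>\<^sub>i\<^bsup>[q]\<^esup> x\<^sub>i\<^bsup>q\<^esup>\<close> all intermediate binomial coefficients vanish in characteristic \<open>p\<close>.
  Hence \<open>ad \<partial>\<^sub>i\<^bsup>[q]\<^esup>\<close> is the derivative with respect to \<open>x\<^sub>i\<^bsup>q\<^esup>\<close>.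
\<close>

lemma commutator_d_x_prime_power:
  assumes i: "i < n"
  shows "commutator A (d i (p ^ k)) (x i [^] (p ^ k)) = \<one>"
proof -
  let ?q = "p ^ k"
  obtain q' where q: "?q = Suc q'" using prime by (metis gr0_conv_Suc prime_gt_0_nat zero_less_power)
  let ?f = "\<lambda>j. of_nat (?q choose j) \<odot> (x i [^] (?q - j) \<otimes> d i (?q - j))"
  have "d i ?q \<otimes> x i [^] ?q = finsum A ?f {..Suc q'}"
    using leibniz[OF i, of ?q ?q] by (simp add: q)
  also have "\<dots> = finsum A (\<lambda>j. ?f (Suc j)) {..q'} \<oplus> ?f 0"
    by (rule finsum_Suc2) (use i in auto)
  also have "finsum A (\<lambda>j. ?f (Suc j)) {..q'} = finsum A (\<lambda>j. if j = q' then \<one> else \<zero>) {..q'}"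
  proof (rule finsum_cong', goal_cases)
    case (3 j)
    show ?case
    proof (cases "j = q'")
      case False
      then have "of_nat (?q choose Suc j) = (0::'k)"
        using 3 q of_nat_choose_prime_power[OF char(1) prime, of "Suc j" k] by simp
      then show ?thesis using False i by simp
    qed (use q i in simp)
  qed auto
  also have "\<dots> = \<one>"
    using add.finprod_singleton_swap[of q' "{..q'}" "\<lambda>_. \<one>"] by simp
  finally have "d i ?q \<otimes> x i [^] ?q = \<one> \<oplus> x i [^] ?q \<otimes> d i ?q" using i by simp
  then show ?thesis using i by (simp add: commutator_def minus_eq a_assoc r_neg)
qed

lemma phi_x_factor_pow:
  assumes i: "i < n" and v: "v \<in> centralizer i"
  shows "phi_x_factor p A x d i k (x i [^] (p ^ k * b) \<otimes> v) = (if p dvd b then x i [^] (p ^ k * b) \<otimes> v else \<zero>)"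
  unfolding phi_x_factor_def
proof (rule truncated_exponential[OF char(1) prime])
  let ?z = "x i [^] (p ^ k)"
  have vc: "v \<in> carrier A" using centD[OF v] by simp
  then show "x i [^] (p ^ k * b) \<otimes> v \<in> carrier A" using i by simp
  fix j
  have "(commutator A (d i (p ^ k)) ^^ j) (?z [^] b \<otimes> v) = of_nat (fact j * (b choose j)) \<odot> (?z [^] (b - j) \<otimes> v)"
    by (rule funpow_commutator_pow) (use i vc centD(3)[OF v] commutator_d_x_prime_power in simp_all)
  then have "x i [^] (p ^ k * j) \<otimes> (commutator A (d i (p ^ k)) ^^ j) (x i [^] (p ^ k * b) \<otimes> v)
     = of_nat (fact j * (b choose j)) \<odot> (?z [^] j \<otimes> ?z [^] (b - j) \<otimes> v)"
    using i vc by (simp add: nat_pow_pow smult_mult_right m_assoc)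
  also have "\<dots> = of_nat (fact j * (b choose j)) \<odot> (?z [^] b \<otimes> v)"
    using i by (cases "j \<le> b") (simp_all add: nat_pow_mult binomial_eq_0 vc)
  finally show "x i [^] (p ^ k * j) \<otimes> (commutator A (d i (p ^ k)) ^^ j) (x i [^] (p ^ k * b) \<otimes> v)
     = of_nat (fact j * (b choose j)) \<odot> (x i [^] (p ^ k * b) \<otimes> v)"
    using i by (simp add: nat_pow_pow)
qed

lemma linear_phi_x_factor:
  assumes i: "i < n"
  shows "linear (carrier A) (carrier A) (phi_x_factor p A x d i k)"
  unfolding phi_x_factor_def
proof (rule linear_finsum)
  fix j
  have "linear (carrier A) (carrier A) (\<lambda>s. x i [^] (p ^ k * j) \<otimes> (commutator A (d i (p ^ k)) ^^ j) s)"
    by (rule linear_comp[OF linear_mult_left linear_funpow[OF linear_commutator]]) (use i in simp_all)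
  then show "linear (carrier A) (carrier A)
     (\<lambda>s. ((-1) ^ j / of_nat (fact j)) \<odot> (x i [^] (p ^ k * j) \<otimes> (commutator A (d i (p ^ k)) ^^ j) s))"
    by (rule linear_comp[OF linear_smult, rotated]) simp
qed simp_all

lemma p_ge_2: "p \<ge> 2"
  using prime by (rule prime_ge_2_nat)

lemma fold_phi_x_factor_pow:
  assumes i: "i < n" and v: "v \<in> centralizer i"
  shows "fold (phi_x_factor p A x d i) [0..<N] (x i [^] (a::nat) \<otimes> v) = (if p ^ N dvd a then x i [^] a \<otimes> v else \<zero>)"
proof (rule fold_sieve)
  show "phi_x_factor p A x d i N \<zero> = \<zero>" for N
    by (rule linear_zero[OF linear_phi_x_factor[OF i]]) simp_all
qed (use p_ge_2 phi_x_factor_pow[OF i v] in simp_all)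

text \<open>
  The result is the constant term in \<open>x\<^sub>i\<close>.
\<close>

lemma phi_x_pow:
  assumes i: "i < n" and v: "v \<in> centralizer i"
  shows "phi_x p A x d i (x i [^] (a::nat) \<otimes> v) = (if a = 0 then v else \<zero>)"
  unfolding phi_x_def
  by (rule inf_comp_eqI[of a])
    (use centD(1)[OF v] in \<open>simp add: fold_phi_x_factor_pow[OF i v] not_dvd_large_power[OF p_ge_2]\<close>)

definition x_mono :: "nat \<Rightarrow> nat \<Rightarrow> nat \<Rightarrow> 'a" where
  "x_mono i a b = x i [^] a"

lemma x_mono_block: "i < n \<Longrightarrow> x_mono i a b \<in> block i"
  unfolding x_mono_def by (intro block_pow block.x)

text \<open>
  The span of the monomials without derivations, on which the maps \<open>phi_x\<close> are defined.
\<close>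

abbreviation S :: "'a set" where
  "S \<equiv> span (block_mono x_mono ` indices)"

lemma x_mono_carrier: "block_mono x_mono ` indices \<subseteq> carrier A"
  using block_mono_closed x_mono_block by blast

lemma subspace_S: "subspace S"
  by (rule subspace_span[OF x_mono_carrier])

lemma linear_phi_x:
  assumes i: "i < n"
  shows "linear S S (phi_x p A x d i)"
  unfolding phi_x_def
proof (rule linear_inf_comp[OF x_mono_carrier])
  show "S \<subseteq> carrier A" using subspaceD(1)[OF subspace_S] by blast
  fix b assume b: "b \<in> block_mono x_mono ` indices"
  then obtain \<tau> where "b = block_mono x_mono \<tau>" by auto
  then obtain a v where v: "v \<in> centralizer i" "b = x i [^] (a::nat) \<otimes> v"
    using block_mono_split[of x_mono, OF x_mono_block i] unfolding x_mono_def by blast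
  have "\<forall>N\<ge>a. fold (phi_x_factor p A x d i) [0..<N] b = (if a = 0 then b else \<zero>)"
    unfolding v(2) by (simp add: fold_phi_x_factor_pow[OF i v(1)] not_dvd_large_power[OF p_ge_2])
  moreover have "(if a = 0 then b else \<zero>) \<in> S" using b by (auto intro: span.base span.zero)
  ultimately show "\<exists>w\<in>S. \<exists>M. \<forall>N\<ge>M. fold (phi_x_factor p A x d i) [0..<N] b = w" by blast
qed (use linear_phi_x_factor[OF i] subspace_S in simp_all)

lemma linear_fold_phi_x: "linear S S (fold (phi_x p A x d) [0..<n])"
  by (rule linear_fold) (simp add: linear_phi_x)

lemma fold_phi_x_mono:
  assumes "a \<in> mindex n"
  shows "fold (phi_x p A x d) [0..<n] (block_mono x_mono (a, b, \<gamma>)) = (if a = 0 then Y \<gamma> else \<zero>)"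
proof -
  let ?e = "\<lambda>i. x_mono i (lookup a i) (lookup b i)"
  let ?e' = "\<lambda>i. (if lookup a i = 0 then 1 else 0) \<odot> \<one>"
  have "fold (phi_x p A x d) [0..<n] (oprod A ?e n \<otimes> Y \<gamma>) = oprod A ?e' n \<otimes> Y \<gamma>"
  proof (rule fold_block_all)
    fix j v assume "j < n" "v \<in> centralizer j"
    then show "phi_x p A x d j (?e j \<otimes> v) = ?e' j \<otimes> v"
      by (simp add: x_mono_def phi_x_pow centD(1))
  qed (simp_all add: x_mono_block block.smult[OF block.one] Y_centre atLeast0LessThan)
  also have "oprod A ?e' n = (\<Prod>i<n. if lookup a i = 0 then 1 else 0) \<odot> oprod A (\<lambda>i. \<one>) n"
    by (rule block_oprod_smult) simp
  also have "oprod A (\<lambda>i. \<one>) n = \<one>" by (rule oprod_one) simp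
  also have "(\<Prod>i<n. if lookup a i = 0 then 1 else 0) = (if a = 0 then 1 else 0 :: 'k)"
  proof (cases "a = 0")
    case False
    then obtain i where "i < n" "lookup a i \<noteq> 0" using mindex_eqI[OF assms mindex_zero] by auto
    then show ?thesis using False by (simp add: prod_zero_iff) blast
  qed simp
  finally show ?thesis by (simp add: block_mono_def)
qed

section \<open>Extracting the constant term in the variables y\<close>

lemma Y_subset: "Y ` mindex m \<subseteq> carrier A"
  by auto

lemma subspace_P: "subspace P"
  unfolding P by (rule subspace_span[OF Y_subset])

lemma P_closed: "u \<in> P \<Longrightarrow> u \<in> carrier A"
  using subspaceD(1)[OF subspace_P] .

lemma Y_in_P: "\<gamma> \<in> mindex m \<Longrightarrow> Y \<gamma> \<in> P"
  unfolding P by (intro span.base imageI)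

lemma P_subset_centre: "P \<subseteq> centre"
  unfolding P by (rule span_subset_subspace) (use Y_centre subspace_centre in auto)

lemma linear_span_eqI:
  assumes T: "linear (span B) W T" "linear (span B) W T'" and B: "B \<subseteq> carrier A" and W: "subspace W"
    and eq: "\<And>b. b \<in> B \<Longrightarrow> T b = T' b" and u: "u \<in> span B"
  shows "T u = T' u"
  using u
proof induction
  case zero
  show ?case using linear_zero[OF T(1) subspace_span[OF B] W] linear_zero[OF T(2) subspace_span[OF B] W] by simp
qed (simp_all add: eq linearD(2,3)[OF T(1)] linearD(2,3)[OF T(2)])

lemma linear_Y_mult:
  assumes g: "\<gamma> \<in> mindex m"
  shows "linear P P (\<lambda>s. Y \<gamma> \<otimes> s)"
  unfolding P
proof (rule linear_image_span)
  show "linear (span (Y ` mindex m)) (carrier A) (\<lambda>s. Y \<gamma> \<otimes> s)"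
    by (rule linear_subset[OF linear_mult_left]) (use span_subset_subspace[OF Y_subset] in auto)
  fix b assume "b \<in> Y ` mindex m"
  then show "Y \<gamma> \<otimes> b \<in> span (Y ` mindex m)"
    by (auto intro!: span.base imageI mindex_add g simp flip: Y_add)
qed (use subspace_P P Y_subset in simp_all)

abbreviation hasse :: "(nat \<Rightarrow>\<^sub>0 nat) \<Rightarrow> 'a \<Rightarrow> 'a" where
  "hasse \<gamma> \<equiv> hderiv A P m y \<gamma>"

text \<open>
  The locale axiom gives existence of a map with these properties, and uniqueness holds because the
  monomials \<open>Y \<epsilon>\<close> span \<open>P\<close>.  So the definite description is meaningful.
\<close>

lemma hasse_properties:
  assumes g: "\<gamma> \<in> mindex m"
  shows "linear P P (hasse \<gamma>)"
    and "\<epsilon> \<in> mindex m \<Longrightarrow> hasse \<gamma> (Y \<epsilon>) =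
      of_nat (\<Prod>j<m. lookup \<epsilon> j choose lookup \<gamma> j) \<odot> Y (\<epsilon> - \<gamma>)"
proof -
  let ?Q = "\<lambda>D. D \<in> P \<rightarrow>\<^sub>E P \<and>
     (\<forall>u\<in>P. \<forall>v\<in>P. D (u \<oplus> v) = D u \<oplus> D v) \<and>
     (\<forall>c. \<forall>u\<in>P. D (c \<odot> u) = c \<odot> D u) \<and>
     (\<forall>\<epsilon>\<in>mindex m. D (Y \<epsilon>) =
        of_nat (\<Prod>j<m. lookup \<epsilon> j choose lookup \<gamma> j) \<odot> Y (\<epsilon> - \<gamma>))"
  obtain D where D: "linear P P D" "\<forall>\<epsilon>\<in>mindex m. D (Y \<epsilon>) =
        of_nat (\<Prod>j<m. lookup \<epsilon> j choose lookup \<gamma> j) \<odot> Y (\<epsilon> - \<gamma>)"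
    using hasse_derivation[OF g] by blast
  have ex: "?Q (restrict D P)"
    using D Y_in_P by (simp add: linear_def subspaceD(3,4)[OF subspace_P])
  have un: "D1 = D2" if "?Q D1" "?Q D2" for D1 D2
  proof (rule extensionalityI[of _ P])
    show "D1 \<in> extensional P" "D2 \<in> extensional P" using that by (auto simp: PiE_def)
    have lin: "linear P P D1" "linear P P D2" using that by (auto simp: linear_def)
    have eq: "D1 b = D2 b" if "b \<in> Y ` mindex m" for b
      using \<open>?Q D1\<close> \<open>?Q D2\<close> that by auto
    fix u assume "u \<in> P"
    then show "D1 u = D2 u"
      using linear_span_eqI[OF _ _ Y_subset subspace_P eq, folded P, OF lin] by blast
  qed
  have "?Q (hasse \<gamma>)"
    unfolding hderiv_def by (rule theI[of ?Q, OF ex]) (rule un[OF _ ex])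
  then show "linear P P (hasse \<gamma>)" "\<epsilon> \<in> mindex m \<Longrightarrow> hasse \<gamma> (Y \<epsilon>) =
      of_nat (\<Prod>j<m. lookup \<epsilon> j choose lookup \<gamma> j) \<odot> Y (\<epsilon> - \<gamma>)"
    by (auto simp: linear_def)
qed

text \<open>
  The coefficient \<open>q b choose q\<close> equals \<open>b\<close> in characteristic \<open>p\<close>, so on monomials whose exponent in
  \<open>y\<^sub>j\<close> is divisible by \<open>q = p\<^sup>k\<close> the higher derivation of order \<open>q\<close> is the derivative with respect
  to \<open>y\<^sub>j\<^bsup>q\<^esup>\<close>.
\<close>

lemma funpow_hasse_single:
  assumes j: "j < m" and e: "\<epsilon> \<in> mindex m" "lookup \<epsilon> j = p ^ k * b"
  shows "(hasse (single j (p ^ k)) ^^ l) (Y \<epsilon>)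
    = of_nat (fact l * (b choose l)) \<odot> Y (\<epsilon> - single j (p ^ k * l))"
  unfolding prod_falling_factorial[symmetric]
proof (induction l)
  case (Suc l)
  let ?q = "p ^ k"
  let ?s = "single j ?q" and ?e = "\<epsilon> - single j (?q * l)"
  note h = hasse_properties[OF mindex_single[OF j, of ?q]]
  have e': "?e \<in> mindex m" by (rule mindex_diff[OF e(1)])
  have "(\<Prod>i<m. lookup ?e i choose lookup ?s i) =
      (\<Prod>i<m. if i = j then ?q * (b - l) choose ?q else 1)"
    by (rule prod.cong) (auto simp: lookup_minus lookup_single when_def e(2) diff_mult_distrib2)
  then have c: "(\<Prod>i<m. lookup ?e i choose lookup ?s i) = ?q * (b - l) choose ?q"
    using j by simp
  have "?e - ?s = \<epsilon> - single j (?q * Suc l)"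
    by (rule poly_mapping_eqI) (auto simp: lookup_minus lookup_single when_def)
  then have "hasse ?s (Y ?e) = of_nat (b - l) \<odot> Y (\<epsilon> - single j (?q * Suc l))"
    by (simp only: h(2)[OF e'] c of_nat_choose_mult_prime_power[OF char(1) prime])
  then show ?case using Suc.IH linearD(3)[OF h(1) Y_in_P[OF e']] by (simp flip: smult_assoc1)
qed simp

lemma theta_factor_Y:
  assumes j: "j < m" and e: "\<epsilon> \<in> mindex m" "lookup \<epsilon> j = p ^ k * b"
  shows "theta_factor p A P m y j k (Y \<epsilon>) = (if p dvd b then Y \<epsilon> else \<zero>)"
  unfolding theta_factor_def
proof (rule truncated_exponential[OF char(1) prime Y_closed])
  fix l
  have "y j [^] (p ^ k * l) \<otimes> Y (\<epsilon> - single j (p ^ k * l)) = Y \<epsilon>" if "l \<le> b"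
  proof -
    have "single j (p ^ k * l) + (\<epsilon> - single j (p ^ k * l)) = \<epsilon>"
      by (rule poly_mapping_eqI) (use that e(2) in \<open>auto simp: lookup_add lookup_minus lookup_single when_def\<close>)
    then show ?thesis using Y_single[OF j, of "p ^ k * l"] by (metis Y_add)
  qed
  then show "y j [^] (p ^ k * l) \<otimes> (hasse (single j (p ^ k)) ^^ l) (Y \<epsilon>)
      = of_nat (fact l * (b choose l)) \<odot> Y \<epsilon>"
    unfolding funpow_hasse_single[OF assms]
    using j by (cases "l \<le> b") (simp_all add: smult_mult_right binomial_eq_0)
qed

lemma linear_theta_factor:
  assumes j: "j < m"
  shows "linear P P (theta_factor p A P m y j k)"
  unfolding theta_factor_def
proof (rule linear_finsum)
  fix l
  have "linear P P (\<lambda>s. Y (single j (p ^ k * l)) \<otimes> (hasse (single j (p ^ k)) ^^ l) s)"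
    by (rule linear_comp[OF linear_Y_mult linear_funpow[OF hasse_properties(1)]]) (use j in \<open>simp_all add: mindex_single\<close>)
  then show "linear P P
     (\<lambda>s. ((-1) ^ l / of_nat (fact l)) \<odot> (y j [^] (p ^ k * l) \<otimes> (hasse (single j (p ^ k)) ^^ l) s))"
    unfolding Y_single[OF j] by (rule linear_comp[OF linear_smult[OF subspace_P]])
qed (simp_all add: subspace_P)

lemma fold_theta_factor_Y:
  assumes j: "j < m" and e: "\<epsilon> \<in> mindex m"
  shows "fold (theta_factor p A P m y j) [0..<N] (Y \<epsilon>) = (if p ^ N dvd lookup \<epsilon> j then Y \<epsilon> else \<zero>)"
proof (rule fold_sieve)
  show "theta_factor p A P m y j N \<zero> = \<zero>" for N
    by (rule linear_zero[OF linear_theta_factor[OF j] subspace_P subspace_P])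
qed (use p_ge_2 theta_factor_Y[OF j e] in simp_all)

lemma theta_Y:
  assumes j: "j < m" and e: "\<epsilon> \<in> mindex m"
  shows "theta p A P m y j (Y \<epsilon>) = (if lookup \<epsilon> j = 0 then Y \<epsilon> else \<zero>)"
  unfolding theta_def
  by (rule inf_comp_eqI[of "lookup \<epsilon> j"])
    (simp add: fold_theta_factor_Y[OF assms] not_dvd_large_power[OF p_ge_2])

lemma linear_theta:
  assumes j: "j < m"
  shows "linear P P (theta p A P m y j)"
proof -
  have "linear (span (Y ` mindex m)) P (inf_comp (theta_factor p A P m y j))"
  proof (rule linear_inf_comp[OF Y_subset subspace_P])
    fix b assume "b \<in> Y ` mindex m"
    then obtain \<epsilon> where e: "\<epsilon> \<in> mindex m" "b = Y \<epsilon>" by auto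
    have "\<forall>N\<ge>lookup \<epsilon> j. fold (theta_factor p A P m y j) [0..<N] b
        = (if lookup \<epsilon> j = 0 then b else \<zero>)"
      unfolding e(2) by (simp add: fold_theta_factor_Y[OF j e(1)] not_dvd_large_power[OF p_ge_2])
    moreover have "(if lookup \<epsilon> j = 0 then b else \<zero>) \<in> P"
      using e Y_in_P subspaceD(2)[OF subspace_P] by simp
    ultimately show "\<exists>w\<in>P. \<exists>M. \<forall>N\<ge>M. fold (theta_factor p A P m y j) [0..<N] b = w" by blast
  qed (use linear_theta_factor[OF j] subspace_P P in simp_all)
  then show ?thesis using P by (simp add: theta_def)
qed

abbreviation scalars :: "'a set" where
  "scalars \<equiv> range (\<lambda>c. c \<odot> \<one>)"

lemma subspace_scalars: "subspace scalars"
proof (rule subspaceI)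
  show "\<zero> \<in> scalars" by (rule image_eqI[of _ _ 0]) simp_all
  fix u v assume "u \<in> scalars" "v \<in> scalars"
  then obtain a b where "u = a \<odot> \<one>" "v = b \<odot> \<one>" by auto
  then show "u \<oplus> v \<in> scalars" by (simp flip: smult_l_distr)
next
  fix c u assume "u \<in> scalars"
  then obtain a where "u = a \<odot> \<one>" by auto
  then show "c \<odot> u \<in> scalars" by (simp flip: smult_assoc1)
qed auto

lemma fold_theta_Y:
  assumes "set L \<subseteq> {..<m}" "\<epsilon> \<in> mindex m"
  shows "fold (theta p A P m y) L (Y \<epsilon>) = (if \<forall>j\<in>set L. lookup \<epsilon> j = 0 then Y \<epsilon> else \<zero>)"
  using assms
proof (induction L)
  case (Cons j L)
  have "fold (theta p A P m y) L \<zero> = \<zero>"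
    by (rule linear_zero[OF linear_fold subspace_P subspace_P]) (use Cons.prems linear_theta in auto)
  then show ?case using Cons theta_Y[of j \<epsilon>] by auto
qed simp

lemma phi_P_Y:
  assumes e: "\<epsilon> \<in> mindex m"
  shows "phi_P p A P m y (Y \<epsilon>) = (if \<epsilon> = 0 then \<one> else \<zero>)"
proof -
  have "(\<forall>j\<in>set [0..<m]. lookup \<epsilon> j = 0) \<longleftrightarrow> \<epsilon> = 0"
    using mindex_eqI[OF e mindex_zero] by auto
  moreover have "phi_P p A P m y (Y \<epsilon>) = (if \<forall>j\<in>set [0..<m]. lookup \<epsilon> j = 0 then Y \<epsilon> else \<zero>)"
    unfolding phi_P_def by (rule fold_theta_Y) (use e in auto)
  ultimately show ?thesis by simp
qed

lemma linear_phi_P: "linear P scalars (phi_P p A P m y)"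
proof -
  have lin: "linear P P (phi_P p A P m y)"
    unfolding phi_P_def by (rule linear_fold) (simp add: linear_theta)
  have one: "\<one> \<in> scalars" by (rule image_eqI[of _ _ 1]) simp_all
  have v: "phi_P p A P m y b \<in> scalars" if "b \<in> Y ` mindex m" for b
  proof -
    obtain \<epsilon> where "\<epsilon> \<in> mindex m" "b = Y \<epsilon>" using \<open>b \<in> Y ` mindex m\<close> by auto
    then show ?thesis using one subspaceD(2)[OF subspace_scalars] by (simp add: phi_P_Y)
  qed
  show ?thesis
    using linear_image_span[of "Y ` mindex m" P _ scalars, folded P, OF lin v Y_subset subspace_scalars subspace_P] .
qed

text \<open>
  The coefficient of \<open>Y \<gamma>\<close> as a multiple of the unit: differentiate with order \<open>\<gamma>\<close>, then take the constant
  term.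
\<close>

definition y_coeff :: "(nat \<Rightarrow>\<^sub>0 nat) \<Rightarrow> 'a \<Rightarrow> 'a" where
  "y_coeff \<gamma> u = phi_P p A P m y (hasse \<gamma> u)"

lemma linear_y_coeff: "\<gamma> \<in> mindex m \<Longrightarrow> linear P scalars (y_coeff \<gamma>)"
  unfolding y_coeff_def by (rule linear_comp[OF linear_phi_P hasse_properties(1)])

lemma y_coeff_Y:
  assumes g: "\<gamma> \<in> mindex m" and g': "\<gamma>' \<in> mindex m"
  shows "y_coeff \<gamma> (Y \<gamma>') = (if \<gamma>' = \<gamma> then \<one> else \<zero>)"
proof -
  let ?c = "\<Prod>j<m. lookup \<gamma>' j choose lookup \<gamma> j"
  have *: "y_coeff \<gamma> (Y \<gamma>') = of_nat ?c \<odot> (if \<gamma>' - \<gamma> = 0 then \<one> else \<zero>)"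
    using Y_in_P[OF mindex_diff[OF g']]
    by (simp only: y_coeff_def hasse_properties(2)[OF g g'] linearD(3)[OF linear_phi_P] phi_P_Y[OF mindex_diff[OF g']])
  show ?thesis
  proof (cases "\<gamma>' = \<gamma>")
    case False
    then obtain j where j: "j < m" "lookup \<gamma>' j \<noteq> lookup \<gamma> j"
      using mindex_eqI[OF g' g] by blast
    show ?thesis
    proof (cases "lookup \<gamma>' j < lookup \<gamma> j")
      case True
      then have c: "?c = 0" using j(1) by (intro prod_zero) auto
      show ?thesis unfolding * c using False by simp
    next
      case less: False
      then have "lookup (\<gamma>' - \<gamma>) j \<noteq> 0" using j(2) by (simp add: lookup_minus)
      then have "\<gamma>' - \<gamma> \<noteq> 0" by (metis lookup_zero)
      then show ?thesis using False * by simp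
    qed
  qed (use * in simp)
qed

section \<open>Extracting coefficients\<close>

lemma linear_mdelta: "linear (carrier A) (carrier A) (mdelta A n x \<beta>)"
  unfolding mdelta_def by (intro linear_foldr linear_funpow linear_neg_commutator) simp

lemma dpow_closed [simp, intro]: "dpow A n d \<alpha> \<in> carrier A"
  unfolding dpow_def by (rule oprod_closed) simp

lemma dpow_mpow: "dpow A n d \<beta> \<otimes> mpow A n x \<alpha> \<otimes> Y \<gamma> = block_mono dx_mono (\<alpha>, \<beta>, \<gamma>)"
  unfolding dpow_def mpow_def block_mono_def prod.case dx_mono_def
  by (subst block_oprod_mult) (auto intro: block.d block_pow block.x)

lemma mpow_dpow: "mpow A n x \<alpha> \<otimes> dpow A n d \<beta> \<otimes> Y \<gamma> = block_mono xd_mono (\<alpha>, \<beta>, \<gamma>)"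
  unfolding dpow_def mpow_def block_mono_def prod.case xd_mono_def
  by (subst block_oprod_mult) (auto intro: block.d block_pow block.x)

abbreviation ind :: "bool \<Rightarrow> 'k" where
  "ind b \<equiv> (if b then 1 else 0)"

lemma nad_x_mult_cent:
  assumes i: "i < n" and e: "e \<in> carrier A" and v: "v \<in> centralizer i"
  shows "(nad_x i ^^ k) (e \<otimes> v) = (nad_x i ^^ k) e \<otimes> v"
proof (induction k)
  case (Suc k)
  have "(nad_x i ^^ k) e \<in> carrier A"
    by (rule linearD(1)[OF linear_funpow[OF linear_neg_commutator] e]) (use i in simp)
  then show ?case using Suc i centD[OF v] by (simp add: commutator_mult_commuting l_minus)
qed simp

text \<open>
  Only the order \<open>b\<close> of the derivation is lowered; a monomial of too small order is killed.
\<close>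

lemma mdelta_block_mono:
  assumes F: "\<And>i a b. i < n \<Longrightarrow> F i a b \<in> block i"
    and d: "\<And>i a b k. i < n \<Longrightarrow> (nad_x i ^^ k) (F i a b) = ind (k \<le> b) \<odot> F i a (b - k)"
  shows "mdelta A n x \<beta> (block_mono F (\<alpha>', \<beta>', \<gamma>')) =
    oprod A (\<lambda>i. ind (lookup \<beta> i \<le> lookup \<beta>' i) \<odot>
       F i (lookup \<alpha>' i) (lookup \<beta>' i - lookup \<beta> i)) n \<otimes> Y \<gamma>'"
  unfolding mdelta_def block_mono_def prod.case
proof (rule foldr_block_all)
  fix j v assume j: "j < n" and v: "v \<in> centralizer j"
  show "(nad_x j ^^ lookup \<beta> j) (F j (lookup \<alpha>' j) (lookup \<beta>' j) \<otimes> v) =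
    ind (lookup \<beta> j \<le> lookup \<beta>' j) \<odot>
       F j (lookup \<alpha>' j) (lookup \<beta>' j - lookup \<beta> j) \<otimes> v"
    using nad_x_mult_cent[OF j block_closed[OF j F[OF j]] v] d[OF j] by simp
qed (simp_all add: F block.smult Y_centre)

text \<open>
  The last step is common to both normal orderings, which differ in the sign \<open>s\<close>.  Once the derivations are
  removed, \<open>phi_x\<close> selects \<open>\<alpha>' - \<alpha> = 0\<close>.  As the difference is truncated, this only means
  \<open>\<alpha>' \<le> \<alpha>\<close>; for \<open>\<alpha>'\<^sub>i < \<alpha>\<^sub>i\<close> the binomial coefficient \<open>\<alpha>'\<^sub>i choose \<alpha>\<^sub>i\<close> vanishes.
\<close>

lemma coefficient_extraction:
  assumes span: "carrier A = span (block_mono F ` indices)" "\<And>i a b. i < n \<Longrightarrow> F i a b \<in> block i"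
    and G: "linear (carrier A) (carrier A) G" and \<alpha>: "\<alpha> \<in> mindex n" and \<beta>: "\<beta> \<in> mindex n"
    and G_mono: "\<And>\<alpha>' \<beta>' \<gamma>'. G (block_mono F (\<alpha>', \<beta>', \<gamma>')) =
       oprod A (\<lambda>i. (ind (lookup \<beta>' i = lookup \<beta> i) *
            (s ^ lookup \<alpha> i * of_nat (lookup \<alpha>' i choose lookup \<alpha> i)))
          \<odot> x i [^] (lookup \<alpha>' i - lookup \<alpha> i)) n \<otimes> Y \<gamma>'"
  shows "linear (carrier A) P (\<lambda>b. fold (phi_x p A x d) [0..<n] (G b))"
    and "(\<alpha>', \<beta>', \<gamma>') \<in> indices \<Longrightarrow> fold (phi_x p A x d) [0..<n] (G (block_mono F (\<alpha>', \<beta>', \<gamma>'))) =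
          (ind (\<alpha>' = \<alpha> \<and> \<beta>' = \<beta>) * s ^ mdeg n \<alpha>) \<odot> Y \<gamma>'"
proof -
  let ?B = "block_mono F ` indices"
  have B: "?B \<subseteq> carrier A" using block_mono_closed span(2) by blast
  let ?c = "\<lambda>\<alpha>' \<beta>'. \<Prod>i<n. ind (lookup \<beta>' i = lookup \<beta> i) *
            (s ^ lookup \<alpha> i * of_nat (lookup \<alpha>' i choose lookup \<alpha> i))"
  have G': "G (block_mono F (\<alpha>', \<beta>', \<gamma>')) = ?c \<alpha>' \<beta>' \<odot> block_mono x_mono (\<alpha>' - \<alpha>, 0, \<gamma>')" for \<alpha>' \<beta>' \<gamma>'
    unfolding G_mono
    by (subst block_oprod_smult) (simp_all add: block_mono_def x_mono_def lookup_minus smult_mult_left)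
  have xS: "block_mono x_mono (\<alpha>' - \<alpha>, 0, \<gamma>') \<in> S" if "\<alpha>' \<in> mindex n" "\<gamma>' \<in> mindex m" for \<alpha>' \<gamma>'
    using that by (intro span.base imageI) (simp add: mindex_diff mindex_zero)
  have GS: "linear (carrier A) S G"
  proof (rule linear_image_span[of ?B "carrier A" G S, folded span(1), OF G _ B subspace_S subspace_carrier])
    fix b assume "b \<in> ?B"
    then obtain \<alpha>' \<beta>' \<gamma>' where "b = block_mono F (\<alpha>', \<beta>', \<gamma>')" "\<alpha>' \<in> mindex n" "\<gamma>' \<in> mindex m" by auto
    then show "G b \<in> S" using xS by (simp add: G' span.smult)
  qed
  have lin: "linear (carrier A) S (\<lambda>b. fold (phi_x p A x d) [0..<n] (G b))"
    by (rule linear_comp[OF linear_fold_phi_x GS])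
  have c: "(if \<alpha>' - \<alpha> = 0 then ?c \<alpha>' \<beta>' else 0) = ind (\<alpha>' = \<alpha> \<and> \<beta>' = \<beta>) * s ^ mdeg n \<alpha>"
    if t1: "\<alpha>' \<in> mindex n" and t2: "\<beta>' \<in> mindex n" for \<alpha>' \<beta>'
  proof (cases "\<alpha>' = \<alpha> \<and> \<beta>' = \<beta>")
    case True
    then show ?thesis by (simp add: mdeg_def power_sum)
  next
    case False
    then consider i where "i < n" "lookup \<beta>' i \<noteq> lookup \<beta> i"
      | i where "i < n" "lookup \<alpha>' i \<noteq> lookup \<alpha> i"
      using mindex_eqI[OF t1 \<alpha>] mindex_eqI[OF t2 \<beta>] by blast
    then have "\<alpha>' - \<alpha> = 0 \<Longrightarrow> ?c \<alpha>' \<beta>' = 0"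
    proof cases
      case (1 i) then show ?thesis by (intro prod_zero) auto
    next
      case (2 i)
      assume "\<alpha>' - \<alpha> = 0"
      then have "lookup (\<alpha>' - \<alpha>) i = 0" by simp
      then have "lookup \<alpha>' i < lookup \<alpha> i" using 2 by (simp add: lookup_minus)
      then have "of_nat (lookup \<alpha>' i choose lookup \<alpha> i) = (0 :: 'k)"
        by (simp add: binomial_eq_0)
      then show ?thesis using 2 by (intro prod_zero) auto
    qed
    then have z: "(if \<alpha>' - \<alpha> = 0 then ?c \<alpha>' \<beta>' else 0) = 0"
      by (metis (no_types, lifting))
    show ?thesis unfolding z by (simp only: if_not_P[OF False] mult_zero_left)
  qed
  show val: "fold (phi_x p A x d) [0..<n] (G (block_mono F (\<alpha>', \<beta>', \<gamma>'))) =
          (ind (\<alpha>' = \<alpha> \<and> \<beta>' = \<beta>) * s ^ mdeg n \<alpha>) \<odot> Y \<gamma>'" if t: "(\<alpha>', \<beta>', \<gamma>') \<in> indices" for \<alpha>' \<beta>' \<gamma>'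
  proof -
    have "fold (phi_x p A x d) [0..<n] (G (block_mono F (\<alpha>', \<beta>', \<gamma>')))
        = ?c \<alpha>' \<beta>' \<odot> (if \<alpha>' - \<alpha> = 0 then Y \<gamma>' else \<zero>)"
      unfolding G' using xS t
      by (simp add: linearD(3)[OF linear_fold_phi_x] fold_phi_x_mono mindex_diff)
    also have "\<dots> = (if \<alpha>' - \<alpha> = 0 then ?c \<alpha>' \<beta>' else 0) \<odot> Y \<gamma>'" by simp
    also have "\<dots> = (ind (\<alpha>' = \<alpha> \<and> \<beta>' = \<beta>) * s ^ mdeg n \<alpha>) \<odot> Y \<gamma>'"
      using c t by (simp only: mem_Sigma_iff)
    finally show ?thesis .
  qed
  show "linear (carrier A) P (\<lambda>b. fold (phi_x p A x d) [0..<n] (G b))"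
  proof (rule linear_image_span[of ?B S _ P, folded span(1), OF lin _ B subspace_P subspace_S])
    fix b assume "b \<in> ?B"
    then obtain \<alpha>' \<beta>' \<gamma>' where "b = block_mono F (\<alpha>', \<beta>', \<gamma>')" "(\<alpha>', \<beta>', \<gamma>') \<in> indices" by auto
    then show "fold (phi_x p A x d) [0..<n] (G b) \<in> P"
      using val Y_in_P by (auto simp: subspaceD(4)[OF subspace_P])
  qed
qed

lemma funpow_nad_dx_mono:
  assumes i: "i < n"
  shows "(nad_x i ^^ k) (dx_mono i a b) = ind (k \<le> b) \<odot> dx_mono i a (b - k)"
  using funpow_nad_x_d[OF i _ x_pow_comm[OF i], of a \<one> k b] i by (simp add: dx_mono_def)

lemma funpow_nad_xd_mono:
  assumes i: "i < n"
  shows "(nad_x i ^^ k) (xd_mono i a b) = ind (k \<le> b) \<odot> xd_mono i a (b - k)"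
  using funpow_nad_x_d[OF i _ _ _ x_pow_comm[OF i], of \<one> a k b] i by (simp add: xd_mono_def)

lemma phi_D_extraction:
  assumes \<alpha>: "\<alpha> \<in> mindex n" and \<beta>: "\<beta> \<in> mindex n"
  defines "G \<equiv> \<lambda>b. fold (phi_d A x d) [0..<n] (mdelta A n x \<beta> b \<otimes> dpow A n d \<alpha>)"
  shows "linear (carrier A) P (\<lambda>b. fold (phi_x p A x d) [0..<n] (G b))"
    and "(\<alpha>', \<beta>', \<gamma>') \<in> indices \<Longrightarrow> fold (phi_x p A x d) [0..<n] (G (block_mono dx_mono (\<alpha>', \<beta>', \<gamma>'))) =
          (ind (\<alpha>' = \<alpha> \<and> \<beta>' = \<beta>) * (-1) ^ mdeg n \<alpha>) \<odot> Y \<gamma>'"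
proof -
  let ?l = lookup
  have lin: "linear (carrier A) (carrier A) G"
    unfolding G_def
    by (rule linear_comp[OF linear_fold linear_comp[OF linear_mult_right linear_mdelta]]) (simp_all add: linear_phi_d)
  have mono: "G (block_mono dx_mono (\<alpha>', \<beta>', \<gamma>')) =
       oprod A (\<lambda>i. (ind (?l \<beta>' i = ?l \<beta> i) * ((-1) ^ ?l \<alpha> i * of_nat (?l \<alpha>' i choose ?l \<alpha> i)))
          \<odot> x i [^] (?l \<alpha>' i - ?l \<alpha> i)) n \<otimes> Y \<gamma>'" for \<alpha>' \<beta>' \<gamma>'
  proof -
    let ?e = "\<lambda>i. ind (?l \<beta> i \<le> ?l \<beta>' i) \<odot> dx_mono i (?l \<alpha>' i) (?l \<beta>' i - ?l \<beta> i)"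
    have e: "?e i \<in> block i" if "i < n" for i using that by (intro block.smult dx_mono_block)
    have D: "mdelta A n x \<beta> (block_mono dx_mono (\<alpha>', \<beta>', \<gamma>')) = oprod A ?e n \<otimes> Y \<gamma>'"
      by (rule mdelta_block_mono) (simp_all add: dx_mono_block funpow_nad_dx_mono)
    have E: "oprod A ?e n \<in> carrier A" by (rule block_oprod_closed) (rule e)
    have "mdelta A n x \<beta> (block_mono dx_mono (\<alpha>', \<beta>', \<gamma>')) \<otimes> dpow A n d \<alpha>
        = (oprod A ?e n \<otimes> dpow A n d \<alpha>) \<otimes> Y \<gamma>'"
      unfolding D using E centreD(2)[OF Y_centre, of "dpow A n d \<alpha>" \<gamma>'] by (simp add: m_assoc)
    also have "oprod A ?e n \<otimes> dpow A n d \<alpha> = oprod A (\<lambda>i. ?e i \<otimes> d i (?l \<alpha> i)) n"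
      unfolding dpow_def by (rule block_oprod_mult) (use e block.d in auto)
    finally have 1: "G (block_mono dx_mono (\<alpha>', \<beta>', \<gamma>')) =
        fold (phi_d A x d) [0..<n] (oprod A (\<lambda>i. ?e i \<otimes> d i (?l \<alpha> i)) n \<otimes> Y \<gamma>')"
      by (simp add: G_def)
    show ?thesis unfolding 1
    proof (rule fold_block_all)
      fix j v assume j: "j < n" and v: "v \<in> centralizer j"
      have vc: "v \<in> carrier A" "x j \<otimes> v = v \<otimes> x j" using centD[OF v] by simp_all
      have cl: "dx_mono j (?l \<alpha>' j) (?l \<beta>' j - ?l \<beta> j) \<in> carrier A" using block_closed[OF j dx_mono_block[OF j]] .
      have "?e j \<otimes> d j (?l \<alpha> j) \<otimes> v = ind (?l \<beta> j \<le> ?l \<beta>' j) \<odot>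
          (d j (?l \<beta>' j - ?l \<beta> j) \<otimes> (x j [^] ?l \<alpha>' j \<otimes> (d j (?l \<alpha> j) \<otimes> v)))"
        using j vc(1) cl by (simp add: smult_mult_left dx_mono_def m_assoc)
      then have "phi_d A x d j (?e j \<otimes> d j (?l \<alpha> j) \<otimes> v) = ind (?l \<beta> j \<le> ?l \<beta>' j) \<odot>
         phi_d A x d j (d j (?l \<beta>' j - ?l \<beta> j) \<otimes> (x j [^] ?l \<alpha>' j \<otimes> (d j (?l \<alpha> j) \<otimes> v)))"
        using j vc(1) linearD(3)[OF linear_phi_d[OF j]] by simp
      then show "phi_d A x d j (?e j \<otimes> d j (?l \<alpha> j) \<otimes> v) = (ind (?l \<beta>' j = ?l \<beta> j) * ((-1) ^ ?l \<alpha> j * of_nat (?l \<alpha>' j choose ?l \<alpha> j)))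
          \<odot> x j [^] (?l \<alpha>' j - ?l \<alpha> j) \<otimes> v"
        unfolding phi_d_normal[OF j vc] using j vc(1) by (auto simp: smult_mult_left)
    next
      show "?e i \<otimes> d i (?l \<alpha> i) \<in> block i" if "i < n" for i using e[OF that] block.d by (rule block.mult)
    qed (simp_all add: block.smult block_pow block.x Y_centre atLeast0LessThan)
  qed
  show "linear (carrier A) P (\<lambda>b. fold (phi_x p A x d) [0..<n] (G b))"
    by (rule coefficient_extraction(1)[OF carrier_eq_span_dx dx_mono_block lin \<alpha> \<beta> mono])
  show "fold (phi_x p A x d) [0..<n] (G (block_mono dx_mono (\<alpha>', \<beta>', \<gamma>'))) =
          (ind (\<alpha>' = \<alpha> \<and> \<beta>' = \<beta>) * (-1) ^ mdeg n \<alpha>) \<odot> Y \<gamma>'" if "(\<alpha>', \<beta>', \<gamma>') \<in> indices"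
    by (rule coefficient_extraction(2)[OF carrier_eq_span_dx dx_mono_block lin \<alpha> \<beta> mono that])
qed

lemma psi_D_extraction:
  assumes \<alpha>: "\<alpha> \<in> mindex n" and \<beta>: "\<beta> \<in> mindex n"
  defines "G \<equiv> \<lambda>b. foldr (psi_d A x d) [0..<n] (dpow A n d \<alpha> \<otimes> mdelta A n x \<beta> b)"
  shows "linear (carrier A) P (\<lambda>b. fold (phi_x p A x d) [0..<n] (G b))"
    and "(\<alpha>', \<beta>', \<gamma>') \<in> indices \<Longrightarrow> fold (phi_x p A x d) [0..<n] (G (block_mono xd_mono (\<alpha>', \<beta>', \<gamma>'))) =
          (ind (\<alpha>' = \<alpha> \<and> \<beta>' = \<beta>) * 1 ^ mdeg n \<alpha>) \<odot> Y \<gamma>'"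
proof -
  let ?l = lookup
  have lin: "linear (carrier A) (carrier A) G"
    unfolding G_def
    by (rule linear_comp[OF linear_foldr linear_comp[OF linear_mult_left linear_mdelta]]) (simp_all add: linear_psi_d)
  have mono: "G (block_mono xd_mono (\<alpha>', \<beta>', \<gamma>')) =
       oprod A (\<lambda>i. (ind (?l \<beta>' i = ?l \<beta> i) * (1 ^ ?l \<alpha> i * of_nat (?l \<alpha>' i choose ?l \<alpha> i)))
          \<odot> x i [^] (?l \<alpha>' i - ?l \<alpha> i)) n \<otimes> Y \<gamma>'" for \<alpha>' \<beta>' \<gamma>'
  proof -
    let ?e = "\<lambda>i. ind (?l \<beta> i \<le> ?l \<beta>' i) \<odot> xd_mono i (?l \<alpha>' i) (?l \<beta>' i - ?l \<beta> i)"
    have e: "?e i \<in> block i" if "i < n" for i using that by (intro block.smult xd_mono_block)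
    have D: "mdelta A n x \<beta> (block_mono xd_mono (\<alpha>', \<beta>', \<gamma>')) = oprod A ?e n \<otimes> Y \<gamma>'"
      by (rule mdelta_block_mono) (simp_all add: xd_mono_block funpow_nad_xd_mono)
    have E: "oprod A ?e n \<in> carrier A" by (rule block_oprod_closed) (rule e)
    have "dpow A n d \<alpha> \<otimes> mdelta A n x \<beta> (block_mono xd_mono (\<alpha>', \<beta>', \<gamma>'))
        = (dpow A n d \<alpha> \<otimes> oprod A ?e n) \<otimes> Y \<gamma>'"
      unfolding D using E by (simp add: m_assoc)
    also have "dpow A n d \<alpha> \<otimes> oprod A ?e n = oprod A (\<lambda>i. d i (?l \<alpha> i) \<otimes> ?e i) n"
      unfolding dpow_def by (rule block_oprod_mult) (use e block.d in auto)
    finally have 1: "G (block_mono xd_mono (\<alpha>', \<beta>', \<gamma>')) =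
        foldr (psi_d A x d) [0..<n] (oprod A (\<lambda>i. d i (?l \<alpha> i) \<otimes> ?e i) n \<otimes> Y \<gamma>')"
      by (simp add: G_def)
    show ?thesis unfolding 1
    proof (rule foldr_block_all)
      fix j v assume j: "j < n" and v: "v \<in> centralizer j"
      have vc: "v \<in> carrier A" using centD[OF v] by simp
      have cl: "xd_mono j (?l \<alpha>' j) (?l \<beta>' j - ?l \<beta> j) \<in> carrier A" using block_closed[OF j xd_mono_block[OF j]] .
      let ?w = "d j (?l \<alpha> j) \<otimes> (x j [^] ?l \<alpha>' j \<otimes> d j (?l \<beta>' j - ?l \<beta> j))"
      have "d j (?l \<alpha> j) \<otimes> ?e j \<otimes> v = (ind (?l \<beta> j \<le> ?l \<beta>' j) \<odot> ?w) \<otimes> v"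
        using j vc cl by (simp add: smult_mult_right xd_mono_def)
      then have "psi_d A x d j (d j (?l \<alpha> j) \<otimes> ?e j \<otimes> v) = ind (?l \<beta> j \<le> ?l \<beta>' j) \<odot> psi_d A x d j ?w \<otimes> v"
        using j linearD(3)[OF linear_psi_d[OF j]] psi_d_mult[OF j _ v] by simp
      then show "psi_d A x d j (d j (?l \<alpha> j) \<otimes> ?e j \<otimes> v) = (ind (?l \<beta>' j = ?l \<beta> j) * (1 ^ ?l \<alpha> j * of_nat (?l \<alpha>' j choose ?l \<alpha> j)))
          \<odot> x j [^] (?l \<alpha>' j - ?l \<alpha> j) \<otimes> v"
        using psi_d_normal[OF j one_closed, of "?l \<alpha> j" "?l \<alpha>' j" "?l \<beta>' j - ?l \<beta> j"] j vc by auto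
    next
      show "d i (?l \<alpha> i) \<otimes> ?e i \<in> block i" if "i < n" for i using block.d e[OF that] by (rule block.mult)
    qed (simp_all add: block.smult block_pow block.x Y_centre)
  qed
  show "linear (carrier A) P (\<lambda>b. fold (phi_x p A x d) [0..<n] (G b))"
    by (rule coefficient_extraction(1)[OF carrier_eq_span_xd xd_mono_block lin \<alpha> \<beta> mono])
  show "fold (phi_x p A x d) [0..<n] (G (block_mono xd_mono (\<alpha>', \<beta>', \<gamma>'))) =
          (ind (\<alpha>' = \<alpha> \<and> \<beta>' = \<beta>) * 1 ^ mdeg n \<alpha>) \<odot> Y \<gamma>'" if "(\<alpha>', \<beta>', \<gamma>') \<in> indices"
    by (rule coefficient_extraction(2)[OF carrier_eq_span_xd xd_mono_block lin \<alpha> \<beta> mono that])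
qed

section \<open>Expansions in normally ordered monomials\<close>

text \<open>
  Both sides depend linearly on \<open>a\<close>, so the identity is proved by induction over the span.  For a monomial
  the sum has a single non-zero term, in which the sign \<open>s\<^bsup>|\<alpha>|\<^esup>\<close> appears twice.
\<close>

lemma expansion:
  assumes F: "carrier A = span (block_mono F ` indices)" "\<And>i a b. i < n \<Longrightarrow> F i a b \<in> block i"
    and C: "\<And>\<alpha> \<beta>. \<alpha> \<in> mindex n \<Longrightarrow> \<beta> \<in> mindex n \<Longrightarrow> linear (carrier A) P (C \<alpha> \<beta>)"
    and C_mono: "\<And>\<alpha> \<beta> \<alpha>' \<beta>' \<gamma>'. \<alpha> \<in> mindex n \<Longrightarrow> \<beta> \<in> mindex n \<Longrightarrow> (\<alpha>', \<beta>', \<gamma>') \<in> indices \<Longrightarrow>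
        C \<alpha> \<beta> (block_mono F (\<alpha>', \<beta>', \<gamma>')) = (ind (\<alpha>' = \<alpha> \<and> \<beta>' = \<beta>) * s ^ mdeg n \<alpha>) \<odot> Y \<gamma>'"
    and s: "s * s = 1" and a: "a \<in> carrier A"
  shows "has_fsum A (\<lambda>(\<alpha>, \<beta>, \<gamma>). s ^ mdeg n \<alpha> \<odot> (y_coeff \<gamma> (C \<alpha> \<beta> a) \<otimes> block_mono F (\<alpha>, \<beta>, \<gamma>))) indices a"
proof -
  let ?T = "\<lambda>\<tau> a. case \<tau> of (\<alpha>, \<beta>, \<gamma>) \<Rightarrow> s ^ mdeg n \<alpha> \<odot> (y_coeff \<gamma> (C \<alpha> \<beta> a) \<otimes> block_mono F (\<alpha>, \<beta>, \<gamma>))"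
  have Fc: "block_mono F \<tau> \<in> carrier A" for \<tau> by (rule block_mono_closed) (rule F(2))
  have lin: "linear (carrier A) (carrier A) (?T \<tau>)" if t: "\<tau> \<in> indices" for \<tau>
  proof -
    obtain \<alpha> \<beta> \<gamma> where \<tau>: "\<tau> = (\<alpha>, \<beta>, \<gamma>)" "\<alpha> \<in> mindex n" "\<beta> \<in> mindex n" "\<gamma> \<in> mindex m"
      using t by (cases \<tau>) auto
    have "linear (carrier A) scalars (\<lambda>a. y_coeff \<gamma> (C \<alpha> \<beta> a))"
      by (rule linear_comp[OF linear_y_coeff[OF \<tau>(4)] C[OF \<tau>(2,3)]])
    then have "linear (carrier A) (carrier A) (\<lambda>a. y_coeff \<gamma> (C \<alpha> \<beta> a))"
      by (rule linear_subset) (use subspaceD(1)[OF subspace_scalars] in auto)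
    then show ?thesis
      unfolding \<tau>(1) prod.case
      by (rule linear_comp[OF linear_smult[OF subspace_carrier] linear_comp[OF linear_mult_right[OF Fc]]])
  qed
  have cl: "?T \<tau> b \<in> carrier A" if "\<tau> \<in> indices" "b \<in> carrier A" for \<tau> b
    using linearD(1)[OF lin[OF that(1)] that(2)] .
  have ss: "s ^ k * s ^ k = 1" for k using s by (simp flip: power_mult_distrib)
  have mono_val: "?T \<tau> (block_mono F \<tau>') = (if \<tau> = \<tau>' then block_mono F \<tau>' else \<zero>)"
    if t: "\<tau> \<in> indices" and t': "\<tau>' \<in> indices" for \<tau> \<tau>'
  proof -
    obtain \<alpha> \<beta> \<gamma> where \<tau>: "\<tau> = (\<alpha>, \<beta>, \<gamma>)" "\<alpha> \<in> mindex n" "\<beta> \<in> mindex n" "\<gamma> \<in> mindex m"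
      using t by (cases \<tau>) auto
    obtain \<alpha>' \<beta>' \<gamma>' where \<tau>': "\<tau>' = (\<alpha>', \<beta>', \<gamma>')" "\<gamma>' \<in> mindex m" "(\<alpha>', \<beta>', \<gamma>') \<in> indices"
      using t' by (cases \<tau>') auto
    have "y_coeff \<gamma> (C \<alpha> \<beta> (block_mono F \<tau>')) =
        (ind (\<alpha>' = \<alpha> \<and> \<beta>' = \<beta>) * s ^ mdeg n \<alpha>) \<odot> (if \<gamma>' = \<gamma> then \<one> else \<zero>)"
      unfolding \<tau>'(1) C_mono[OF \<tau>(2,3) \<tau>'(3)]
      by (simp only: linearD(3)[OF linear_y_coeff[OF \<tau>(4)] Y_in_P[OF \<tau>'(2)]] y_coeff_Y[OF \<tau>(4) \<tau>'(2)])
    then show ?thesis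
      using ss unfolding \<tau>(1) prod.case
      by (auto simp: \<tau>'(1) Fc smult_mult_left simp flip: smult_assoc1)
  qed
  have "has_fsum A (\<lambda>\<tau>. ?T \<tau> a) indices a \<and> a \<in> carrier A" if "a \<in> span (block_mono F ` indices)" for a
    using that
  proof induction
    case zero
    have "?T \<tau> \<zero> = \<zero>" if "\<tau> \<in> indices" for \<tau>
      by (rule linear_zero[OF lin[OF that] subspace_carrier subspace_carrier])
    then show ?case by (simp only: has_fsum_zero zero_closed)
  next
    case (base b)
    then obtain \<tau>' where t: "\<tau>' \<in> indices" "b = block_mono F \<tau>'" by blast
    have v: "?T \<tau> b = (if \<tau> = \<tau>' then b else \<zero>)" if "\<tau> \<in> indices" for \<tau>
      using mono_val[OF that t(1)] by (simp only: t(2))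
    have "has_fsum A (\<lambda>\<tau>. ?T \<tau> b) indices (?T \<tau>' b)"
      by (rule has_fsum_single[OF t(1)]) (use v t Fc in simp_all)
    moreover have "?T \<tau>' b = b" using v[OF t(1)] by simp
    ultimately show ?case using Fc t(2) by metis
  next
    case (add u v)
    have "has_fsum A (\<lambda>\<tau>. ?T \<tau> u \<oplus> ?T \<tau> v) indices (u \<oplus> v)"
      by (rule has_fsum_add) (use add cl in blast)+
    moreover have "?T \<tau> (u \<oplus> v) = ?T \<tau> u \<oplus> ?T \<tau> v" if "\<tau> \<in> indices" for \<tau>
      by (rule linearD(2)[OF lin[OF that]]) (use add in simp_all)
    ultimately show ?case using has_fsum_cong[of indices "\<lambda>\<tau>. ?T \<tau> (u \<oplus> v)"] cl add by simp
  next
    case (smult u c)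
    have "has_fsum A (\<lambda>\<tau>. c \<odot> ?T \<tau> u) indices (c \<odot> u)"
      by (rule has_fsum_smult) (use smult cl in blast)+
    moreover have "?T \<tau> (c \<odot> u) = c \<odot> ?T \<tau> u" if "\<tau> \<in> indices" for \<tau>
      by (rule linearD(3)[OF lin[OF that]]) (use smult in simp)
    ultimately show ?case using has_fsum_cong[of indices "\<lambda>\<tau>. ?T \<tau> (c \<odot> u)"] cl smult by simp
  qed
  then show ?thesis using a F(1) by blast
qed

definition phi_coeff :: "(nat \<Rightarrow>\<^sub>0 nat) \<Rightarrow> (nat \<Rightarrow>\<^sub>0 nat) \<Rightarrow> (nat \<Rightarrow>\<^sub>0 nat) \<Rightarrow> 'a \<Rightarrow> 'a" where
  "phi_coeff \<alpha> \<beta> \<gamma> a = phi_P p A P m y (hderiv A P m y \<gamma> (phi_D p A n x d (mdelta A n x \<beta> a \<otimes> dpow A n d \<alpha>)))"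

definition psi_coeff :: "(nat \<Rightarrow>\<^sub>0 nat) \<Rightarrow> (nat \<Rightarrow>\<^sub>0 nat) \<Rightarrow> (nat \<Rightarrow>\<^sub>0 nat) \<Rightarrow> 'a \<Rightarrow> 'a" where
  "psi_coeff \<alpha> \<beta> \<gamma> a = phi_P p A P m y (hderiv A P m y \<gamma> (psi_D p A n x d (dpow A n d \<alpha> \<otimes> mdelta A n x \<beta> a)))"

lemma linear_phi_coeff: "(\<alpha>, \<beta>, \<gamma>) \<in> indices \<Longrightarrow> linear (carrier A) scalars (phi_coeff \<alpha> \<beta> \<gamma>)"
  unfolding phi_coeff_def phi_D_def
  using linear_comp[OF linear_y_coeff[unfolded y_coeff_def] phi_D_extraction(1)] by simp

lemma linear_psi_coeff: "(\<alpha>, \<beta>, \<gamma>) \<in> indices \<Longrightarrow> linear (carrier A) scalars (psi_coeff \<alpha> \<beta> \<gamma>)"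
  unfolding psi_coeff_def psi_D_def
  using linear_comp[OF linear_y_coeff[unfolded y_coeff_def] psi_D_extraction(1)] by simp

lemma scalar_closed: "u \<in> scalars \<Longrightarrow> u \<in> carrier A"
  using subspaceD(1)[OF subspace_scalars] .

lemma mpow_x_closed [simp, intro]: "mpow A n x \<alpha> \<in> carrier A"
  unfolding mpow_def by (rule oprod_closed) simp

lemma phi_expansion:
  assumes a: "a \<in> carrier A"
  shows "has_fsum A (\<lambda>(\<alpha>, \<beta>, \<gamma>). (-1) ^ mdeg n \<alpha> \<odot>
      (phi_coeff \<alpha> \<beta> \<gamma> a \<otimes> dpow A n d \<beta> \<otimes> mpow A n x \<alpha> \<otimes> Y \<gamma>)) indices a"
proof -
  have c: "phi_coeff \<alpha> \<beta> \<gamma> a \<in> carrier A" if "(\<alpha>, \<beta>, \<gamma>) \<in> indices" for \<alpha> \<beta> \<gamma>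
    by (rule scalar_closed[OF linearD(1)[OF linear_phi_coeff[OF that] a]])
  have bc: "block_mono dx_mono \<tau> \<in> carrier A" for \<tau> by (rule block_mono_closed) (rule dx_mono_block)
  have "has_fsum A (\<lambda>(\<alpha>, \<beta>, \<gamma>). (-1) ^ mdeg n \<alpha> \<odot> (phi_coeff \<alpha> \<beta> \<gamma> a \<otimes> block_mono dx_mono (\<alpha>, \<beta>, \<gamma>))) indices a"
    unfolding phi_coeff_def phi_D_def
    by (rule expansion[OF carrier_eq_span_dx dx_mono_block phi_D_extraction, unfolded y_coeff_def])
      (simp_all add: a)
  moreover have "(case \<tau> of (\<alpha>, \<beta>, \<gamma>) \<Rightarrow> (-1) ^ mdeg n \<alpha> \<odot>
      (phi_coeff \<alpha> \<beta> \<gamma> a \<otimes> dpow A n d \<beta> \<otimes> mpow A n x \<alpha> \<otimes> Y \<gamma>)) =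
    (case \<tau> of (\<alpha>, \<beta>, \<gamma>) \<Rightarrow> (-1) ^ mdeg n \<alpha> \<odot> (phi_coeff \<alpha> \<beta> \<gamma> a \<otimes> block_mono dx_mono (\<alpha>, \<beta>, \<gamma>)))"
    "(case \<tau> of (\<alpha>, \<beta>, \<gamma>) \<Rightarrow> (-1) ^ mdeg n \<alpha> \<odot> (phi_coeff \<alpha> \<beta> \<gamma> a \<otimes> block_mono dx_mono (\<alpha>, \<beta>, \<gamma>))) \<in> carrier A"
    if "\<tau> \<in> indices" for \<tau>
    using that c by (auto simp: m_assoc bc simp flip: dpow_mpow split: prod.splits)
  ultimately show ?thesis by (subst has_fsum_cong) auto
qed

lemma psi_expansion:
  assumes a: "a \<in> carrier A"
  shows "has_fsum A (\<lambda>(\<alpha>, \<beta>, \<gamma>).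
      psi_coeff \<alpha> \<beta> \<gamma> a \<otimes> mpow A n x \<alpha> \<otimes> dpow A n d \<beta> \<otimes> Y \<gamma>) indices a"
proof -
  have c: "psi_coeff \<alpha> \<beta> \<gamma> a \<in> carrier A" if "(\<alpha>, \<beta>, \<gamma>) \<in> indices" for \<alpha> \<beta> \<gamma>
    by (rule scalar_closed[OF linearD(1)[OF linear_psi_coeff[OF that] a]])
  have bc: "block_mono xd_mono \<tau> \<in> carrier A" for \<tau> by (rule block_mono_closed) (rule xd_mono_block)
  have "has_fsum A (\<lambda>(\<alpha>, \<beta>, \<gamma>). 1 ^ mdeg n \<alpha> \<odot> (psi_coeff \<alpha> \<beta> \<gamma> a \<otimes> block_mono xd_mono (\<alpha>, \<beta>, \<gamma>))) indices a"
    unfolding psi_coeff_def psi_D_def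
    by (rule expansion[OF carrier_eq_span_xd xd_mono_block psi_D_extraction, unfolded y_coeff_def])
      (simp_all add: a)
  moreover have "(case \<tau> of (\<alpha>, \<beta>, \<gamma>) \<Rightarrow>
      psi_coeff \<alpha> \<beta> \<gamma> a \<otimes> mpow A n x \<alpha> \<otimes> dpow A n d \<beta> \<otimes> Y \<gamma>) =
    (case \<tau> of (\<alpha>, \<beta>, \<gamma>) \<Rightarrow> 1 ^ mdeg n \<alpha> \<odot> (psi_coeff \<alpha> \<beta> \<gamma> a \<otimes> block_mono xd_mono (\<alpha>, \<beta>, \<gamma>)))"
    "(case \<tau> of (\<alpha>, \<beta>, \<gamma>) \<Rightarrow> 1 ^ mdeg n \<alpha> \<odot> (psi_coeff \<alpha> \<beta> \<gamma> a \<otimes> block_mono xd_mono (\<alpha>, \<beta>, \<gamma>))) \<in> carrier A"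
    if "\<tau> \<in> indices" for \<tau>
    using that c by (auto simp: m_assoc bc simp flip: mpow_dpow split: prod.splits)
  ultimately show ?thesis by (subst has_fsum_cong) auto
qed

section \<open>The centre\<close>

lemma commutator_centre: "b \<in> centre \<Longrightarrow> r \<in> carrier A \<Longrightarrow> commutator A r b = \<zero>"
  using centreD(2)[of b r] centreD(1)[of b] by (simp add: commutator_def minus_eq r_neg)

text \<open>
  The commutators with a central element vanish.
\<close>

lemma mdelta_centre:
  assumes b: "b \<in> centre" and \<beta>: "\<beta> \<in> mindex n"
  shows "mdelta A n x \<beta> b = (if \<beta> = 0 then b else \<zero>)"
proof -
  have lin: "linear (carrier A) (carrier A) (nad_x i ^^ k)" if "i < n" for i k
    by (intro linear_funpow linear_neg_commutator x_closed that)
  have z: "(nad_x i ^^ k) \<zero> = \<zero>" if "i < n" for i k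
    by (rule linear_zero[OF lin[OF that]]) simp_all
  have nb: "(nad_x i ^^ k) b = (if k = 0 then b else \<zero>)" if i: "i < n" for i k
  proof (cases k)
    case (Suc k')
    have "(nad_x i ^^ k) b = (nad_x i ^^ k') (nad_x i b)" by (simp add: Suc funpow_Suc_right del: funpow.simps)
    then show ?thesis using commutator_centre[OF b x_closed[OF i]] z[OF i] Suc by simp
  qed simp
  have "foldr (\<lambda>i. nad_x i ^^ lookup \<beta> i) L b =
      (if \<forall>i\<in>set L. lookup \<beta> i = 0 then b else \<zero>)" if "set L \<subseteq> {..<n}" for L
    using that by (induction L) (auto simp: nb z)
  from this[of "[0..<n]"] show ?thesis
    using mindex_eqI[OF \<beta> mindex_zero] by (auto simp: mdelta_def atLeast0LessThan)
qed

text \<open>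
  For central \<open>b\<close> the map \<open>phi_d\<close> sees \<open>b \<partial>\<^sub>i\<^bsup>[l]\<^esup>\<close> as \<open>\<partial>\<^sub>i\<^bsup>[l]\<^esup>\<close> times a constant.
\<close>

lemma phi_centre:
  assumes b: "b \<in> centre" and \<alpha>: "\<alpha> \<in> mindex n"
  shows "fold (phi_d A x d) [0..<n] (b \<otimes> dpow A n d \<alpha>) = (if \<alpha> = 0 then b else \<zero>)"
proof -
  let ?l = lookup
  have "b \<otimes> dpow A n d \<alpha> = oprod A (\<lambda>i. d i (?l \<alpha> i)) n \<otimes> b"
    using centreD(2)[OF b, of "dpow A n d \<alpha>"] by (simp add: dpow_def)
  also have "fold (phi_d A x d) [0..<n] \<dots> = oprod A (\<lambda>i. ind (?l \<alpha> i = 0) \<odot> \<one>) n \<otimes> b"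
  proof (rule fold_block_all)
    fix j v assume j: "j < n" and v: "v \<in> centralizer j"
    show "phi_d A x d j (d j (?l \<alpha> j) \<otimes> v) = ind (?l \<alpha> j = 0) \<odot> \<one> \<otimes> v"
      using phi_d_d[OF j centD(1)[OF v] centD(2)[OF v, symmetric], of "?l \<alpha> j"] centD(1)[OF v] by simp
  qed (simp_all add: block.smult block.one block.d b atLeast0LessThan)
  also have "oprod A (\<lambda>i. ind (?l \<alpha> i = 0) \<odot> \<one>) n = (\<Prod>i<n. ind (?l \<alpha> i = 0)) \<odot> oprod A (\<lambda>i. \<one>) n"
    by (rule block_oprod_smult) simp
  also have "oprod A (\<lambda>i. \<one>) n = \<one>" by (rule oprod_one) simp
  also have "(\<Prod>i<n. ind (?l \<alpha> i = 0)) = ind (\<alpha> = 0)"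
  proof (cases "\<alpha> = 0")
    case False
    then obtain i where "i < n" "?l \<alpha> i \<noteq> 0" using mindex_eqI[OF \<alpha> mindex_zero] by auto
    then show ?thesis using False by (simp add: prod_zero_iff) blast
  qed simp
  finally show ?thesis using centreD(1)[OF b] by simp
qed

text \<open>
  In the expansion of a central element only the terms with \<open>\<alpha> = \<beta> = 0\<close> survive, and these are scalar multiples
  of monomials in \<open>y\<close>.
\<close>

lemma centre_eq_P: "centre = P"
proof
  show "centre \<subseteq> P"
  proof
    fix b assume b: "b \<in> centre"
    have bc: "b \<in> carrier A" using centreD(1)[OF b] .
    let ?t = "\<lambda>(\<alpha>, \<beta>, \<gamma>). (-1) ^ mdeg n \<alpha> \<odot>
      (phi_coeff \<alpha> \<beta> \<gamma> b \<otimes> dpow A n d \<beta> \<otimes> mpow A n x \<alpha> \<otimes> Y \<gamma>)"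
    have "?t \<tau> \<in> P" if t: "\<tau> \<in> indices" for \<tau>
    proof -
      obtain \<alpha> \<beta> \<gamma> where \<tau>: "\<tau> = (\<alpha>, \<beta>, \<gamma>)" "\<alpha> \<in> mindex n" "\<beta> \<in> mindex n" "\<gamma> \<in> mindex m"
        using t by (cases \<tau>) auto
      have S: "phi_coeff \<alpha> \<beta> \<gamma> b \<in> scalars"
        by (rule linearD(1)[OF linear_phi_coeff bc]) (use \<tau> in simp)
      show ?thesis
      proof (cases "\<alpha> = 0 \<and> \<beta> = 0")
        case True
        have "dpow A n d 0 = \<one>" unfolding dpow_def by (rule oprod_one) simp
        moreover have "mpow A n x 0 = \<one>" unfolding mpow_def by (rule oprod_one) simp
        moreover obtain c where "phi_coeff \<alpha> \<beta> \<gamma> b = c \<odot> \<one>" using S by auto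
        ultimately have "?t \<tau> = (-1) ^ mdeg n \<alpha> \<odot> (c \<odot> Y \<gamma>)"
          using True \<tau>(1) by (simp add: smult_mult_left)
        then show ?thesis using Y_in_P[OF \<tau>(4)] by (simp add: subspaceD(4)[OF subspace_P])
      next
        case False
        have lz: "fold (phi_d A x d) [0..<n] \<zero> = \<zero>"
          by (rule linear_zero[OF linear_fold[where V = "carrier A"]]) (simp_all add: linear_phi_d)
        have "fold (phi_d A x d) [0..<n] (mdelta A n x \<beta> b \<otimes> dpow A n d \<alpha>) = \<zero>"
          unfolding mdelta_centre[OF b \<tau>(3)] using False phi_centre[OF b \<tau>(2)] lz by auto
        moreover have "fold (phi_x p A x d) [0..<n] \<zero> = \<zero>"
          by (rule linear_zero[OF linear_fold_phi_x subspace_S subspace_S])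
        moreover have "phi_P p A P m y (hderiv A P m y \<gamma> \<zero>) = \<zero>"
          using linear_zero[OF linear_y_coeff[OF \<tau>(4)] subspace_P subspace_scalars] by (simp add: y_coeff_def)
        ultimately have "phi_coeff \<alpha> \<beta> \<gamma> b = \<zero>" by (simp add: phi_coeff_def phi_D_def)
        then show ?thesis using \<tau>(1) subspaceD(2)[OF subspace_P] by simp
      qed
    qed
    moreover have "finite (fsupp A ?t indices)" "b = finsum A ?t (fsupp A ?t indices)"
      using phi_expansion[OF bc] by (simp_all add: has_fsum_def fsum_def)
    ultimately show "b \<in> P"
      using finsum_subspace[OF subspace_P, of "fsupp A ?t indices" ?t] by (auto simp: fsupp_def)
  qed
qed (rule P_subset_centre)

end

lemma monoid_algebra_minus:
  assumes "monoid M" "g \<in> carrier (monoid_algebra M :: ('k::field, _) module)"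
  shows "f \<ominus>\<^bsub>monoid_algebra M\<^esub> g = f - g"
proof -
  interpret A: kalg "monoid_algebra M :: ('k, _) module" by (rule kalg_monoid_algebra[OF assms(1)])
  have "- g \<in> carrier (monoid_algebra M)"
    using assms(2) by (auto simp: monoid_algebra_sel in_keys_iff)
  then have "\<ominus>\<^bsub>monoid_algebra M\<^esub> g = - g"
    by (intro A.minus_equality) (use assms(2) in \<open>simp_all add: monoid_algebra_sel\<close>)
  then show ?thesis by (simp add: A.minus_eq monoid_algebra_sel)
qed

context kalg_pres
begin

lemma cls_eq_of_rel: "a \<ominus> b \<in> S \<Longrightarrow> a \<in> carrier A \<Longrightarrow> b \<in> carrier A \<Longrightarrow> cls a = cls b"
  using cls_eq_iff rel_in_I by blast

lemma cls_commute: "commutator A a b \<in> S \<Longrightarrow> a \<in> carrier A \<Longrightarrow> b \<in> carrier A \<Longrightarrow>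
    cls a \<otimes>\<^bsub>Q\<^esub> cls b = cls b \<otimes>\<^bsub>Q\<^esub> cls a"
  using cls_eq_of_rel[of "a \<otimes> b" "b \<otimes> a"] by (simp add: commutator_def quot_sel)

end

section \<open>Tensor products\<close>

locale kalg_tensor = D: kalg D + P: kalg P for D :: "('k::field, 'a) module" and P :: "('k, 'b) module"
begin

abbreviation "M \<equiv> monoid_algebra (D \<times>\<times> P) :: ('k, 'a \<times> 'b \<Rightarrow>\<^sub>0 'k) module"
abbreviation "R \<equiv> tensor_rels D P"

lemma monoid_DP: "monoid (D \<times>\<times> P)"
  by (intro DirProd_monoid D.is_monoid P.is_monoid)

lemma bas_M: "d \<in> carrier D \<Longrightarrow> f \<in> carrier P \<Longrightarrow> bas (d, f) \<in> carrier M"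
  by (simp add: monoid_algebra_sel bas_def)

lemma single_M: "d \<in> carrier D \<Longrightarrow> f \<in> carrier P \<Longrightarrow> single (d, f) c \<in> carrier M"
  by (simp add: monoid_algebra_sel)

lemma M_diff: "f \<in> carrier M \<Longrightarrow> g \<in> carrier M \<Longrightarrow> f - g \<in> carrier M"
  using keys_diff[of f g] by (auto simp: monoid_algebra_sel)

lemma M_add: "f \<in> carrier M \<Longrightarrow> g \<in> carrier M \<Longrightarrow> f + g \<in> carrier M"
  using keys_add[of f g] by (auto simp: monoid_algebra_sel)

lemma rels_M: "R \<subseteq> carrier M"
  unfolding tensor_rels_def by (auto intro!: M_diff bas_M single_M)

sublocale M: kalg M
  by (rule kalg_monoid_algebra[OF monoid_DP])

sublocale T: kalg_pres M R
  by unfold_locales (rule rels_M)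

abbreviation "A \<equiv> alg_tensor D P"

lemma A_eq: "A = alg_quot M R"
  by (simp add: alg_tensor_def)

lemma kalg_A: "kalg A"
  unfolding A_eq by (rule T.kalg_quot)

lemma tens_eq: "tens D P d f = T.cls (bas (d, f))"
  by (simp add: tens_def)

lemma tens_closed: "d \<in> carrier D \<Longrightarrow> f \<in> carrier P \<Longrightarrow> tens D P d f \<in> carrier A"
  unfolding A_eq tens_eq by (intro T.quot_cls_in bas_M)

lemma tens_one: "tens D P \<one>\<^bsub>D\<^esub> \<one>\<^bsub>P\<^esub> = \<one>\<^bsub>A\<^esub>"
  unfolding A_eq tens_eq by (simp add: T.quot_sel monoid_algebra_sel)

lemma tens_mult: "d \<in> carrier D \<Longrightarrow> d' \<in> carrier D \<Longrightarrow> f \<in> carrier P \<Longrightarrow> f' \<in> carrier P \<Longrightarrow>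
    tens D P d f \<otimes>\<^bsub>A\<^esub> tens D P d' f' = tens D P (d \<otimes>\<^bsub>D\<^esub> d') (f \<otimes>\<^bsub>P\<^esub> f')"
  unfolding A_eq tens_eq by (simp add: T.quot_sel(5) bas_M monoid_algebra_mult_bas)

lemma cls_eqI: "a - b \<in> R \<Longrightarrow> a \<in> carrier M \<Longrightarrow> b \<in> carrier M \<Longrightarrow> T.cls a = T.cls b"
  using T.cls_eq_of_rel[of a b] monoid_algebra_minus[OF monoid_DP] by metis

lemma rels_intros:
  "d \<in> carrier D \<Longrightarrow> d' \<in> carrier D \<Longrightarrow> f \<in> carrier P \<Longrightarrow>
    bas (d \<oplus>\<^bsub>D\<^esub> d', f) - bas (d, f) - bas (d', f) \<in> R"
  "d \<in> carrier D \<Longrightarrow> f \<in> carrier P \<Longrightarrow> f' \<in> carrier P \<Longrightarrow>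
    bas (d, f \<oplus>\<^bsub>P\<^esub> f') - bas (d, f) - bas (d, f') \<in> R"
  "d \<in> carrier D \<Longrightarrow> f \<in> carrier P \<Longrightarrow> bas (c \<odot>\<^bsub>D\<^esub> d, f) - single (d, f) c \<in> R"
  "d \<in> carrier D \<Longrightarrow> f \<in> carrier P \<Longrightarrow> bas (d, c \<odot>\<^bsub>P\<^esub> f) - single (d, f) c \<in> R"
  unfolding tensor_rels_def by blast+

lemma tens_add_left:
  assumes "d \<in> carrier D" "d' \<in> carrier D" "f \<in> carrier P"
  shows "tens D P (d \<oplus>\<^bsub>D\<^esub> d') f = tens D P d f \<oplus>\<^bsub>A\<^esub> tens D P d' f"
proof -
  have "T.cls (bas (d \<oplus>\<^bsub>D\<^esub> d', f)) = T.cls (bas (d, f) \<oplus>\<^bsub>M\<^esub> bas (d', f))"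
    by (rule cls_eqI) (use assms rels_intros(1)[OF assms] in
        \<open>simp_all add: bas_M M_add monoid_algebra_sel(4) diff_diff_eq\<close>)
  then show ?thesis unfolding A_eq tens_eq using assms by (simp add: T.quot_sel(4) bas_M)
qed

lemma tens_add_right:
  assumes "d \<in> carrier D" "f \<in> carrier P" "f' \<in> carrier P"
  shows "tens D P d (f \<oplus>\<^bsub>P\<^esub> f') = tens D P d f \<oplus>\<^bsub>A\<^esub> tens D P d f'"
proof -
  have "T.cls (bas (d, f \<oplus>\<^bsub>P\<^esub> f')) = T.cls (bas (d, f) \<oplus>\<^bsub>M\<^esub> bas (d, f'))"
    by (rule cls_eqI) (use assms rels_intros(2)[OF assms] in
        \<open>simp_all add: bas_M M_add monoid_algebra_sel(4) diff_diff_eq\<close>)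
  then show ?thesis unfolding A_eq tens_eq using assms by (simp add: T.quot_sel(4) bas_M)
qed

lemma single_eq_smult_bas: "single u c = c \<odot>\<^bsub>M\<^esub> bas u"
  by (simp add: monoid_algebra_sel bas_def)

lemma tens_smult_left:
  assumes "d \<in> carrier D" "f \<in> carrier P"
  shows "tens D P (c \<odot>\<^bsub>D\<^esub> d) f = c \<odot>\<^bsub>A\<^esub> tens D P d f"
proof -
  have "T.cls (bas (c \<odot>\<^bsub>D\<^esub> d, f)) = T.cls (c \<odot>\<^bsub>M\<^esub> bas (d, f))"
    by (rule cls_eqI) (use assms rels_intros(3)[OF assms] in \<open>simp_all add: bas_M single_eq_smult_bas\<close>)
  then show ?thesis unfolding A_eq tens_eq using assms by (simp add: T.quot_smult bas_M)
qed

lemma tens_smult_right: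
  assumes "d \<in> carrier D" "f \<in> carrier P"
  shows "tens D P d (c \<odot>\<^bsub>P\<^esub> f) = c \<odot>\<^bsub>A\<^esub> tens D P d f"
proof -
  have "T.cls (bas (d, c \<odot>\<^bsub>P\<^esub> f)) = T.cls (c \<odot>\<^bsub>M\<^esub> bas (d, f))"
    by (rule cls_eqI) (use assms rels_intros(4)[OF assms] in \<open>simp_all add: bas_M single_eq_smult_bas\<close>)
  then show ?thesis unfolding A_eq tens_eq using assms by (simp add: T.quot_smult bas_M)
qed

text \<open>
  The tensor product is spanned by the pure tensors.
\<close>

lemma A_induct [consumes 1, case_names tens add smult]:
  assumes a: "a \<in> carrier A"
    and tens: "\<And>d f. d \<in> carrier D \<Longrightarrow> f \<in> carrier P \<Longrightarrow> Q (tens D P d f)"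
    and add: "\<And>u v. u \<in> carrier A \<Longrightarrow> v \<in> carrier A \<Longrightarrow> Q u \<Longrightarrow> Q v \<Longrightarrow> Q (u \<oplus>\<^bsub>A\<^esub> v)"
    and smult: "\<And>c u. u \<in> carrier A \<Longrightarrow> Q u \<Longrightarrow> Q (c \<odot>\<^bsub>A\<^esub> u)"
  shows "Q a"
proof -
  interpret A: kalg A by (rule kalg_A)
  obtain z where z: "z \<in> carrier M" "a = T.cls z"
    using a unfolding A_eq T.quot_sel(1) by blast
  from z(1) have "keys z \<subseteq> carrier (D \<times>\<times> P)" by (simp add: monoid_algebra_sel)
  then have "Q (T.cls z)"
  proof (induction z rule: poly_mapping_span_induct)
    case zero
    have "\<zero>\<^bsub>A\<^esub> = 0 \<odot>\<^bsub>A\<^esub> tens D P \<one>\<^bsub>D\<^esub> \<one>\<^bsub>P\<^esub>" by (simp add: tens_one)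
    then have "Q \<zero>\<^bsub>A\<^esub>" using smult[of "tens D P \<one>\<^bsub>D\<^esub> \<one>\<^bsub>P\<^esub>" 0] tens tens_closed by simp
    then show ?case by (simp add: A_eq T.quot_sel(3) monoid_algebra_sel)
  next
    case (single u c)
    obtain d f where u: "u = (d, f)" "d \<in> carrier D" "f \<in> carrier P" using single by (cases u) auto
    have "T.cls (single u c) = c \<odot>\<^bsub>A\<^esub> tens D P d f"
      unfolding A_eq tens_eq single_eq_smult_bas u(1) using u by (simp add: T.quot_smult bas_M)
    then show ?case using u smult tens tens_closed by simp
  next
    case (add f g)
    have c: "f \<in> carrier M" "g \<in> carrier M" using add by (auto simp: monoid_algebra_sel)
    have "T.cls (f + g) = T.cls f \<oplus>\<^bsub>A\<^esub> T.cls g"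
      unfolding A_eq using T.quot_sel(4)[OF c] by (simp add: monoid_algebra_sel)
    then show ?case using add.IH assms(3)[of "T.cls f" "T.cls g"] c by (simp add: A_eq T.quot_cls_in)
  qed
  then show ?thesis using z by simp
qed

section \<open>Maps on \<open>P\<^sub>m\<close> induced on the tensor product\<close>

definition right_map :: "('b \<Rightarrow> 'b) \<Rightarrow> ('a \<times> 'b \<Rightarrow>\<^sub>0 'k) \<Rightarrow> 'a \<times> 'b \<Rightarrow>\<^sub>0 'k" where
  "right_map g = lin_ext (\<lambda>(d, f). bas (d, g f))"

lemma right_map_simps:
  "right_map g (u + v) = right_map g u + right_map g v"
  "right_map g (u - v) = right_map g u - right_map g v"
  "right_map g (scal c u) = scal c (right_map g u)"
  "right_map g (bas (d, f)) = bas (d, g f)"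
  "right_map g (single (d, f) c) = single (d, g f) c"
  "right_map g 0 = 0"
  by (simp_all add: right_map_def lin_ext_add lin_ext_minus lin_ext_scal lin_ext_bas lin_ext_single lin_ext_zero)
    (simp add: bas_def scal_simps)

lemma M_mult_diff:
  "(f - f') \<otimes>\<^bsub>M\<^esub> g = f \<otimes>\<^bsub>M\<^esub> g - f' \<otimes>\<^bsub>M\<^esub> g"
  "g \<otimes>\<^bsub>M\<^esub> (f - f') = g \<otimes>\<^bsub>M\<^esub> f - g \<otimes>\<^bsub>M\<^esub> f'"
  using monoid_algebra_mult_add(1)[where f = "f - f'" and f' = f' and M = "D \<times>\<times> P" and g = g]
    monoid_algebra_mult_add(2)[where f = "f - f'" and f' = f' and M = "D \<times>\<times> P" and g = g] by (simp_all add: algebra_simps)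

text \<open>
  Multiplying a bilinearity relator by basis elements on both sides gives a relator of the same kind, and
  so does applying the linear map \<open>g\<close> to the second components.
\<close>

lemma right_map_rel:
  assumes g: "\<And>f. f \<in> carrier P \<Longrightarrow> g f \<in> carrier P"
      "\<And>f f'. f \<in> carrier P \<Longrightarrow> f' \<in> carrier P \<Longrightarrow> g (f \<oplus>\<^bsub>P\<^esub> f') = g f \<oplus>\<^bsub>P\<^esub> g f'"
      "\<And>c f. f \<in> carrier P \<Longrightarrow> g (c \<odot>\<^bsub>P\<^esub> f) = c \<odot>\<^bsub>P\<^esub> g f"
    and r: "r \<in> R" and s: "d1 \<in> carrier D" "f1 \<in> carrier P" and t: "d2 \<in> carrier D" "f2 \<in> carrier P"
  shows "right_map g (bas (d1, f1) \<otimes>\<^bsub>M\<^esub> r \<otimes>\<^bsub>M\<^esub> bas (d2, f2)) \<in> R"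
proof -
  note simps = M_mult_diff monoid_algebra_mult_bas single_eq_smult_bas monoid_algebra_sel(5) monoid_algebra_mult_scal right_map_simps
  consider (1) d d' f where "r = bas (d \<oplus>\<^bsub>D\<^esub> d', f) - bas (d, f) - bas (d', f)" "d \<in> carrier D" "d' \<in> carrier D" "f \<in> carrier P"
    | (2) d f f' where "r = bas (d, f \<oplus>\<^bsub>P\<^esub> f') - bas (d, f) - bas (d, f')" "d \<in> carrier D" "f \<in> carrier P" "f' \<in> carrier P"
    | (3) c d f where "r = bas (c \<odot>\<^bsub>D\<^esub> d, f) - single (d, f) c" "d \<in> carrier D" "f \<in> carrier P"
    | (4) c d f where "r = bas (d, c \<odot>\<^bsub>P\<^esub> f) - single (d, f) c" "d \<in> carrier D" "f \<in> carrier P"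
    using r unfolding tensor_rels_def by blast
  then show ?thesis
  proof cases
    case (1 d d' f)
    have "right_map g (bas (d1, f1) \<otimes>\<^bsub>M\<^esub> r \<otimes>\<^bsub>M\<^esub> bas (d2, f2)) =
      bas ((d1 \<otimes>\<^bsub>D\<^esub> d \<otimes>\<^bsub>D\<^esub> d2) \<oplus>\<^bsub>D\<^esub> (d1 \<otimes>\<^bsub>D\<^esub> d' \<otimes>\<^bsub>D\<^esub> d2), g (f1 \<otimes>\<^bsub>P\<^esub> f \<otimes>\<^bsub>P\<^esub> f2))
      - bas (d1 \<otimes>\<^bsub>D\<^esub> d \<otimes>\<^bsub>D\<^esub> d2, g (f1 \<otimes>\<^bsub>P\<^esub> f \<otimes>\<^bsub>P\<^esub> f2)) - bas (d1 \<otimes>\<^bsub>D\<^esub> d' \<otimes>\<^bsub>D\<^esub> d2, g (f1 \<otimes>\<^bsub>P\<^esub> f \<otimes>\<^bsub>P\<^esub> f2))"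
      using 1 s t by (simp add: simps D.l_distr D.r_distr)
    then show ?thesis using 1 s t g(1) rels_intros(1) by simp
  next
    case (2 d f f')
    have "right_map g (bas (d1, f1) \<otimes>\<^bsub>M\<^esub> r \<otimes>\<^bsub>M\<^esub> bas (d2, f2)) =
      bas (d1 \<otimes>\<^bsub>D\<^esub> d \<otimes>\<^bsub>D\<^esub> d2, g (f1 \<otimes>\<^bsub>P\<^esub> f \<otimes>\<^bsub>P\<^esub> f2) \<oplus>\<^bsub>P\<^esub> g (f1 \<otimes>\<^bsub>P\<^esub> f' \<otimes>\<^bsub>P\<^esub> f2))
      - bas (d1 \<otimes>\<^bsub>D\<^esub> d \<otimes>\<^bsub>D\<^esub> d2, g (f1 \<otimes>\<^bsub>P\<^esub> f \<otimes>\<^bsub>P\<^esub> f2)) - bas (d1 \<otimes>\<^bsub>D\<^esub> d \<otimes>\<^bsub>D\<^esub> d2, g (f1 \<otimes>\<^bsub>P\<^esub> f' \<otimes>\<^bsub>P\<^esub> f2))"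
      using 2 s t by (simp add: simps P.l_distr P.r_distr g(2))
    then show ?thesis using 2 s t g(1) rels_intros(2) by simp
  next
    case (3 c d f)
    have "right_map g (bas (d1, f1) \<otimes>\<^bsub>M\<^esub> r \<otimes>\<^bsub>M\<^esub> bas (d2, f2)) =
      bas (c \<odot>\<^bsub>D\<^esub> (d1 \<otimes>\<^bsub>D\<^esub> d \<otimes>\<^bsub>D\<^esub> d2), g (f1 \<otimes>\<^bsub>P\<^esub> f \<otimes>\<^bsub>P\<^esub> f2))
      - single (d1 \<otimes>\<^bsub>D\<^esub> d \<otimes>\<^bsub>D\<^esub> d2, g (f1 \<otimes>\<^bsub>P\<^esub> f \<otimes>\<^bsub>P\<^esub> f2)) c"
      using 3 s t by (simp add: simps D.smult_mult_left D.smult_mult_right)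
    then show ?thesis using 3 s t g(1) rels_intros(3) by simp
  next
    case (4 c d f)
    have "right_map g (bas (d1, f1) \<otimes>\<^bsub>M\<^esub> r \<otimes>\<^bsub>M\<^esub> bas (d2, f2)) =
      bas (d1 \<otimes>\<^bsub>D\<^esub> d \<otimes>\<^bsub>D\<^esub> d2, c \<odot>\<^bsub>P\<^esub> g (f1 \<otimes>\<^bsub>P\<^esub> f \<otimes>\<^bsub>P\<^esub> f2))
      - single (d1 \<otimes>\<^bsub>D\<^esub> d \<otimes>\<^bsub>D\<^esub> d2, g (f1 \<otimes>\<^bsub>P\<^esub> f \<otimes>\<^bsub>P\<^esub> f2)) c"
      using 4 s t by (simp add: simps P.smult_mult_left P.smult_mult_right g(3))
    then show ?thesis using 4 s t g(1) rels_intros(4) by simp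
  qed
qed

text \<open>
  The map \<open>right_map g\<close> is not multiplicative, so the elements that it maps into the ideal do not form an ideal
  for an obvious reason.  But those \<open>z\<close> for which all products \<open>u z v\<close> are mapped into the ideal do.
\<close>

lemma right_map_ideal:
  assumes g: "\<And>f. f \<in> carrier P \<Longrightarrow> g f \<in> carrier P"
      "\<And>f f'. f \<in> carrier P \<Longrightarrow> f' \<in> carrier P \<Longrightarrow> g (f \<oplus>\<^bsub>P\<^esub> f') = g f \<oplus>\<^bsub>P\<^esub> g f'"
      "\<And>c f. f \<in> carrier P \<Longrightarrow> g (c \<odot>\<^bsub>P\<^esub> f) = c \<odot>\<^bsub>P\<^esub> g f"
    and z: "z \<in> T.I"
  shows "right_map g z \<in> T.I"
proof -
  let ?N = "{z \<in> carrier M. \<forall>u\<in>carrier M. \<forall>v\<in>carrier M. right_map g (u \<otimes>\<^bsub>M\<^esub> z \<otimes>\<^bsub>M\<^esub> v) \<in> T.I}"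
  have add: "a \<in> T.I \<Longrightarrow> b \<in> T.I \<Longrightarrow> a + b \<in> T.I" for a b
    using T.I.a_closed[of a b] by (simp add: monoid_algebra_sel)
  have zero: "0 \<in> T.I" using T.I.zero_closed by (simp add: monoid_algebra_sel)
  have sc: "a \<in> T.I \<Longrightarrow> scal c a \<in> T.I" for a c
    using T.smult_I[of a c] by (simp add: monoid_algebra_sel)
  have neg: "scal (-1) a = - a" for a :: "'a \<times> 'b \<Rightarrow>\<^sub>0 'k"
    by (rule poly_mapping_eqI) (simp add: lookup_scal)
  have R: "R \<subseteq> ?N"
  proof
    fix r assume r: "r \<in> R"
    have "right_map g (u \<otimes>\<^bsub>M\<^esub> r \<otimes>\<^bsub>M\<^esub> v) \<in> T.I" if "u \<in> carrier M" "v \<in> carrier M" for u v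
    proof -
      from that have u: "keys u \<subseteq> carrier (D \<times>\<times> P)" and v: "keys v \<subseteq> carrier (D \<times>\<times> P)"
        by (auto simp: monoid_algebra_sel)
      from u show ?thesis
      proof (induction u rule: poly_mapping_span_induct)
        case (single s c)
        note s = this
        from v show ?case
        proof (induction v rule: poly_mapping_span_induct)
          case (single t e)
          obtain d1 f1 d2 f2 where st: "s = (d1, f1)" "t = (d2, f2)" by (cases s, cases t)
          have "right_map g (bas s \<otimes>\<^bsub>M\<^esub> r \<otimes>\<^bsub>M\<^esub> bas t) \<in> T.I"
            unfolding st by (rule T.rel_in_I, rule right_map_rel[OF g r]) (use s single st in auto)
          then show ?case
            by (simp add: single_eq_smult_bas monoid_algebra_sel(5) monoid_algebra_mult_scal right_map_simps sc)
        qed (simp_all add: monoid_algebra_mult_add right_map_simps zero add)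
      qed (simp_all add: monoid_algebra_mult_add right_map_simps zero add)
    qed
    then show "r \<in> ?N" using r rels_M by blast
  qed
  have "ideal ?N M"
  proof (rule idealI)
    fix a b assume a: "a \<in> ?N" and b: "b \<in> carrier M"
    then show "b \<otimes>\<^bsub>M\<^esub> a \<in> ?N" "a \<otimes>\<^bsub>M\<^esub> b \<in> ?N" by (auto simp: M.m_assoc) (auto simp flip: M.m_assoc)
  next
    have "subgroup ?N (add_monoid M)"
    proof (rule M.add.subgroupI)
      show "?N \<noteq> {}" using right_map_simps(6) zero by (auto simp: monoid_algebra_sel(3) intro!: exI[of _ 0] M.zero_closed[unfolded monoid_algebra_sel])
      fix a assume a: "a \<in> ?N"
      have "\<ominus>\<^bsub>M\<^esub> a = scal (-1) a" using a M.smult_minus1[of a] by (simp add: monoid_algebra_sel)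
      then show "\<ominus>\<^bsub>M\<^esub> a \<in> ?N"
        using a M.smult_closed[of a "-1"]
        by (auto simp: monoid_algebra_sel(5) monoid_algebra_mult_scal right_map_simps sc)
    next
      fix a b assume "a \<in> ?N" "b \<in> ?N"
      then show "a \<oplus>\<^bsub>M\<^esub> b \<in> ?N"
        using M.a_closed[of a b] by (auto simp: monoid_algebra_sel(4) monoid_algebra_mult_add right_map_simps add)
    qed auto
    then show "subgroup ?N (add_monoid M)" .
  qed (rule M.ring_axioms)
  then have "z \<in> ?N" using T.I_least[OF _ R] z by blast
  then have "right_map g (\<one>\<^bsub>M\<^esub> \<otimes>\<^bsub>M\<^esub> z \<otimes>\<^bsub>M\<^esub> \<one>\<^bsub>M\<^esub>) \<in> T.I" by blast
  then show ?thesis using \<open>z \<in> ?N\<close> by simp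
qed

lemma tens_one_map_well_defined:
  assumes g: "\<And>f. f \<in> carrier P \<Longrightarrow> g f \<in> carrier P"
      "\<And>f f'. f \<in> carrier P \<Longrightarrow> f' \<in> carrier P \<Longrightarrow> g (f \<oplus>\<^bsub>P\<^esub> f') = g f \<oplus>\<^bsub>P\<^esub> g f'"
      "\<And>c f. f \<in> carrier P \<Longrightarrow> g (c \<odot>\<^bsub>P\<^esub> f) = c \<odot>\<^bsub>P\<^esub> g f"
    and f: "f \<in> carrier P" "f' \<in> carrier P" and eq: "tens D P d f = tens D P d f'" and d: "d \<in> carrier D"
  shows "tens D P d (g f) = tens D P d (g f')"
proof -
  have c: "bas (d, f) \<in> carrier M" "bas (d, f') \<in> carrier M"
    "bas (d, g f) \<in> carrier M" "bas (d, g f') \<in> carrier M" using f d g(1) by (auto intro: bas_M)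
  have "bas (d, f) - bas (d, f') \<in> T.I"
    using eq c T.cls_eq_iff monoid_algebra_minus[OF monoid_DP] unfolding tens_eq by metis
  then have "bas (d, g f) - bas (d, g f') \<in> T.I"
    using right_map_ideal[of g, OF g] by (metis right_map_simps(2,4))
  then show ?thesis
    using c T.cls_eq_iff monoid_algebra_minus[OF monoid_DP] unfolding tens_eq by metis
qed

end

section \<open>The algebra \<open>D(P\<^sub>n) \<otimes> P\<^sub>m\<close>\<close>

lemma kalg_free_alg: "kalg (free_alg n)"
  unfolding free_alg_def
  by (rule kalg_monoid_algebra) (unfold_locales, auto)

lemma kalg_poly_alg: "kalg (poly_alg m)"
  unfolding poly_alg_def
  by (rule kalg_monoid_algebra) (unfold_locales, auto simp: mindex_add mindex_zero add.assoc)

lemma free_alg_sel: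
  "carrier (free_alg n) = {f. keys f \<subseteq> lists (gens n)}" "\<one>\<^bsub>free_alg n\<^esub> = bas []"
  "\<zero>\<^bsub>free_alg n\<^esub> = 0" "f \<oplus>\<^bsub>free_alg n\<^esub> g = f + g" "c \<odot>\<^bsub>free_alg n\<^esub> f = scal c f"
  by (simp_all add: free_alg_def monoid_algebra_sel)

lemma fX_closed: "i < n \<Longrightarrow> fX i \<in> carrier (free_alg n)"
  by (simp add: free_alg_sel fX_def bas_def gens_def)

lemma fD_closed: "i < n \<Longrightarrow> fD i k \<in> carrier (free_alg n)"
  by (simp add: free_alg_sel fD_def bas_def gens_def)

lemma kalg_pres_diff_rels: "kalg_pres (free_alg n) (diff_rels n)"
proof (intro kalg_pres.intro kalg_pres_axioms.intro kalg_free_alg)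
  interpret F: kalg "free_alg n" by (rule kalg_free_alg)
  show "diff_rels n \<subseteq> carrier (free_alg n)"
    unfolding diff_rels_def Let_def
    by (auto intro!: F.commutator_closed F.minus_closed F.m_closed F.smult_closed fX_closed fD_closed)
qed

lemma poly_alg_sel:
  "carrier (poly_alg m) = {f. keys f \<subseteq> mindex m}" "\<one>\<^bsub>poly_alg m\<^esub> = bas 0"
  "\<zero>\<^bsub>poly_alg m\<^esub> = 0" "f \<oplus>\<^bsub>poly_alg m\<^esub> g = f + g" "c \<odot>\<^bsub>poly_alg m\<^esub> f = scal c f"
  "bas \<epsilon> \<otimes>\<^bsub>poly_alg m\<^esub> bas \<epsilon>' = bas (\<epsilon> + \<epsilon>')"
  by (simp_all add: poly_alg_def monoid_algebra_sel monoid_algebra_mult_bas)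

lemma bas_poly: "\<epsilon> \<in> mindex m \<Longrightarrow> bas \<epsilon> \<in> carrier (poly_alg m)"
  by (simp add: poly_alg_sel bas_def)

text \<open>
  The parameter \<open>ty\<close> fixes the base field, which is not determined by \<open>n\<close> and \<open>m\<close>.
\<close>

locale DP_algebra = fixes n m :: nat and ty :: "'k::field itself"
begin

abbreviation "F \<equiv> free_alg n :: ('k, gen list \<Rightarrow>\<^sub>0 'k) module"

sublocale F: kalg_pres F "diff_rels n"
  by (rule kalg_pres_diff_rels)

lemma kalg_diff_ops: "kalg (diff_ops n :: ('k, 'k dop) module)"
  unfolding diff_ops_def by (rule F.kalg_quot)

sublocale kalg_tensor "diff_ops n :: ('k, 'k dop) module" "poly_alg m"
  by (intro kalg_tensor.intro kalg_diff_ops kalg_poly_alg)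

abbreviation "B \<equiv> DP n m :: ('k, 'k dpol) module"

lemma A_eq_DP: "A = B"
  by (simp add: DP_def)

sublocale B: kalg B
  using kalg_A by (simp add: A_eq_DP)

lemma diff_ops_sel:
  "carrier (diff_ops n :: ('k, 'k dop) module) = F.cls ` carrier F"
  "\<one>\<^bsub>diff_ops n\<^esub> = F.cls (bas [])"
  by (simp_all add: diff_ops_def F.quot_sel free_alg_sel)

section \<open>Relations between the generators\<close>

abbreviation "X i \<equiv> F.cls (fX i)"
abbreviation "\<Delta> i k \<equiv> F.cls (fD i k)"

lemma XD_closed: "i < n \<Longrightarrow> X i \<in> carrier (diff_ops n)" "i < n \<Longrightarrow> \<Delta> i k \<in> carrier (diff_ops n)"
  by (simp_all add: diff_ops_sel fX_closed fD_closed)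

lemma D_0: "\<Delta> i 0 = \<one>\<^bsub>diff_ops n\<^esub>"
  by (simp add: diff_ops_sel fD_def)

lemma D_xx:
  assumes "i < n" "j < n"
  shows "X i \<otimes>\<^bsub>diff_ops n\<^esub> X j = X j \<otimes>\<^bsub>diff_ops n\<^esub> X i"
proof -
  have "commutator F (fX i) (fX j) \<in> diff_rels n"
    using assms unfolding diff_rels_def Let_def by blast
  then show ?thesis unfolding diff_ops_def
    by (rule F.cls_commute[OF _ fX_closed fX_closed]) (use assms in auto)
qed

text \<open>
  The defining relations concern orders at least one; for order zero the derivation is the unit.
\<close>

lemma D_dd:
  assumes "i < n" "j < n"
  shows "\<Delta> i k \<otimes>\<^bsub>diff_ops n\<^esub> \<Delta> j l = \<Delta> j l \<otimes>\<^bsub>diff_ops n\<^esub> \<Delta> i k"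
proof (cases "k = 0 \<or> l = 0")
  case True
  then show ?thesis by (elim disjE) (use XD_closed assms in \<open>simp_all add: D_0\<close>)
next
  case False
  then have "1 \<le> k" "1 \<le> l" by auto
  then have "commutator F (fD i k) (fD j l) \<in> diff_rels n"
    using assms unfolding diff_rels_def Let_def by blast
  then show ?thesis unfolding diff_ops_def
    by (rule F.cls_commute[OF _ fD_closed fD_closed]) (use assms in auto)
qed

lemma D_d_mult:
  assumes "i < n"
  shows "\<Delta> i k \<otimes>\<^bsub>diff_ops n\<^esub> \<Delta> i l = of_nat ((k + l) choose k) \<odot>\<^bsub>diff_ops n\<^esub> \<Delta> i (k + l)"
proof (cases "k = 0 \<or> l = 0")
  case True
  then show ?thesis by (elim disjE) (use XD_closed assms in \<open>simp_all add: D_0\<close>)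
next
  case False
  then have "1 \<le> k" "1 \<le> l" by auto
  then have "fD i k \<otimes>\<^bsub>F\<^esub> fD i l \<ominus>\<^bsub>F\<^esub> of_nat ((k + l) choose k) \<odot>\<^bsub>F\<^esub> fD i (k + l) \<in> diff_rels n"
    using assms unfolding diff_rels_def Let_def by blast
  then have "F.cls (fD i k \<otimes>\<^bsub>F\<^esub> fD i l) = F.cls (of_nat ((k + l) choose k) \<odot>\<^bsub>F\<^esub> fD i (k + l))"
    by (rule F.cls_eq_of_rel) (use assms in \<open>simp_all add: fD_closed\<close>)
  then show ?thesis unfolding diff_ops_def
    by (simp add: F.quot_sel(5) F.quot_smult fD_closed assms)
qed

lemma D_dx_general:
  assumes "i < n" "j < n"
  shows "\<Delta> i (Suc k) \<otimes>\<^bsub>diff_ops n\<^esub> X j =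
    X j \<otimes>\<^bsub>diff_ops n\<^esub> \<Delta> i (Suc k) \<oplus>\<^bsub>diff_ops n\<^esub> (if i = j then 1 else 0) \<odot>\<^bsub>diff_ops n\<^esub> \<Delta> i k"
proof -
  let ?c = "if i = j then 1 else 0 :: 'k"
  let ?u = "fD i (Suc k) \<otimes>\<^bsub>F\<^esub> fX j" and ?v = "fX j \<otimes>\<^bsub>F\<^esub> fD i (Suc k)"
  have cl: "?u \<in> carrier F" "?v \<in> carrier F" "fD i k \<in> carrier F"
    using assms by (simp_all add: fX_closed fD_closed)
  have "commutator F (fD i (Suc k)) (fX j) \<ominus>\<^bsub>F\<^esub> ?c \<odot>\<^bsub>F\<^esub> fD i (Suc k - 1) \<in> diff_rels n"
    unfolding diff_rels_def Let_def
    by (rule UnI2, intro CollectI exI[of _ i] exI[of _ j] exI[of _ "Suc k"] conjI refl) (use assms in simp_all)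
  then have "F.cls (?u \<ominus>\<^bsub>F\<^esub> ?v) = F.cls (?c \<odot>\<^bsub>F\<^esub> fD i k)"
    unfolding commutator_def diff_Suc_1 by (rule F.cls_eq_of_rel) (use cl in simp_all)
  then have "F.cls (?v \<oplus>\<^bsub>F\<^esub> (?u \<ominus>\<^bsub>F\<^esub> ?v)) = F.cls ?v \<oplus>\<^bsub>diff_ops n\<^esub> F.cls (?c \<odot>\<^bsub>F\<^esub> fD i k)"
    using cl unfolding diff_ops_def by (simp add: F.quot_sel(4)[symmetric])
  moreover have "?v \<oplus>\<^bsub>F\<^esub> (?u \<ominus>\<^bsub>F\<^esub> ?v) = ?u"
    using cl F.a_lcomm[of ?v ?u "\<ominus>\<^bsub>F\<^esub> ?v"] by (simp add: F.minus_eq F.r_neg)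
  ultimately have "F.cls ?u = F.cls ?v \<oplus>\<^bsub>diff_ops n\<^esub> F.cls (?c \<odot>\<^bsub>F\<^esub> fD i k)" by simp
  then show ?thesis unfolding diff_ops_def
    using assms cl by (simp only: F.quot_sel(5) F.quot_smult fX_closed fD_closed)
qed

abbreviation "\<iota> d \<equiv> tens (diff_ops n) (poly_alg m) d \<one>\<^bsub>poly_alg m\<^esub> :: 'k dpol"
abbreviation "\<kappa> f \<equiv> tens (diff_ops n) (poly_alg m) \<one>\<^bsub>diff_ops n\<^esub> f :: 'k dpol"

lemma iota_simps:
  "u \<in> carrier (diff_ops n) \<Longrightarrow> \<iota> u \<in> carrier B"
  "u \<in> carrier (diff_ops n) \<Longrightarrow> v \<in> carrier (diff_ops n) \<Longrightarrow> \<iota> (u \<otimes>\<^bsub>diff_ops n\<^esub> v) = \<iota> u \<otimes>\<^bsub>B\<^esub> \<iota> v"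
  "u \<in> carrier (diff_ops n) \<Longrightarrow> v \<in> carrier (diff_ops n) \<Longrightarrow> \<iota> (u \<oplus>\<^bsub>diff_ops n\<^esub> v) = \<iota> u \<oplus>\<^bsub>B\<^esub> \<iota> v"
  "u \<in> carrier (diff_ops n) \<Longrightarrow> \<iota> (c \<odot>\<^bsub>diff_ops n\<^esub> u) = c \<odot>\<^bsub>B\<^esub> \<iota> u"
  "\<iota> \<one>\<^bsub>diff_ops n\<^esub> = \<one>\<^bsub>B\<^esub>"
  by (simp_all add: tens_closed tens_mult tens_add_left tens_smult_left tens_one flip: A_eq_DP)

lemma kappa_simps:
  "f \<in> carrier (poly_alg m) \<Longrightarrow> \<kappa> f \<in> carrier B"
  "f \<in> carrier (poly_alg m) \<Longrightarrow> g \<in> carrier (poly_alg m) \<Longrightarrow> \<kappa> (f \<otimes>\<^bsub>poly_alg m\<^esub> g) = \<kappa> f \<otimes>\<^bsub>B\<^esub> \<kappa> g"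
  "f \<in> carrier (poly_alg m) \<Longrightarrow> g \<in> carrier (poly_alg m) \<Longrightarrow> \<kappa> (f \<oplus>\<^bsub>poly_alg m\<^esub> g) = \<kappa> f \<oplus>\<^bsub>B\<^esub> \<kappa> g"
  "f \<in> carrier (poly_alg m) \<Longrightarrow> \<kappa> (c \<odot>\<^bsub>poly_alg m\<^esub> f) = c \<odot>\<^bsub>B\<^esub> \<kappa> f"
  by (simp_all add: tens_closed tens_mult tens_add_right tens_smult_right flip: A_eq_DP)

lemma iota_kappa:
  assumes "u \<in> carrier (diff_ops n)" "f \<in> carrier (poly_alg m)"
  shows "\<iota> u \<otimes>\<^bsub>B\<^esub> \<kappa> f = tens (diff_ops n) (poly_alg m) u f" "\<kappa> f \<otimes>\<^bsub>B\<^esub> \<iota> u = tens (diff_ops n) (poly_alg m) u f"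
  using assms by (simp_all add: tens_mult flip: A_eq_DP)

lemma poly_mult_comm:
  assumes "f \<in> carrier (poly_alg m)" "g \<in> carrier (poly_alg m :: ('k, _) module)"
  shows "f \<otimes>\<^bsub>poly_alg m\<^esub> g = g \<otimes>\<^bsub>poly_alg m\<^esub> f"
proof -
  have f: "keys f \<subseteq> mindex m" and g: "keys g \<subseteq> mindex m"
    using assms by (simp_all add: poly_alg_sel)
  from f show ?thesis
    unfolding poly_alg_def
  proof (induction f rule: poly_mapping_span_induct)
    case (single u c)
    from g show ?case
      by (induction g rule: poly_mapping_span_induct)
        (simp_all add: monoid_algebra_mult_single monoid_algebra_mult_add mult.commute add.commute)
  qed (simp_all add: monoid_algebra_mult_add)
qed

lemma kappa_central:
  assumes f: "f \<in> carrier (poly_alg m)" and a: "a \<in> carrier B"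
  shows "\<kappa> f \<otimes>\<^bsub>B\<^esub> a = a \<otimes>\<^bsub>B\<^esub> \<kappa> f"
proof -
  have k: "\<kappa> f \<in> carrier B" by (rule kappa_simps(1)[OF f])
  have "a \<in> carrier A" using a by (simp add: A_eq_DP)
  then show ?thesis
  proof (induction a rule: A_induct)
    case (tens u g)
    have "\<kappa> f \<otimes>\<^bsub>A\<^esub> tens (diff_ops n) (poly_alg m) u g = tens (diff_ops n) (poly_alg m) u (f \<otimes>\<^bsub>poly_alg m\<^esub> g)"
      using tens f by (simp add: tens_mult)
    moreover have "tens (diff_ops n) (poly_alg m) u g \<otimes>\<^bsub>A\<^esub> \<kappa> f = tens (diff_ops n) (poly_alg m) u (g \<otimes>\<^bsub>poly_alg m\<^esub> f)"
      using tens f by (simp add: tens_mult)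
    ultimately show ?case using poly_mult_comm[OF f tens(2)] by (simp add: A_eq_DP)
  next
    case (add u v)
    then show ?case using k by (simp add: A_eq_DP B.l_distr B.r_distr)
  next
    case (smult c u)
    then show ?case using k by (simp add: A_eq_DP B.smult_mult_left B.smult_mult_right)
  qed
qed

abbreviation "x \<equiv> gen_x n m :: nat \<Rightarrow> 'k dpol"
abbreviation "d \<equiv> gen_d n m :: nat \<Rightarrow> nat \<Rightarrow> 'k dpol"
abbreviation "y \<equiv> gen_y n m :: nat \<Rightarrow> 'k dpol"

lemma gen_eq: "x i = \<iota> (X i)" "d i k = \<iota> (\<Delta> i k)" "y j = \<kappa> (bas (single j 1))"
  by (simp_all add: gen_x_def gen_d_def gen_y_def poly_var_def)

lemma y_pow: assumes j: "j < m" shows "y j [^]\<^bsub>B\<^esub> (k::nat) = \<kappa> (bas (single j k))"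
proof (induction k)
  case 0
  then show ?case using iota_simps(5) by (simp add: poly_alg_sel)
next
  case (Suc k)
  have "(bas (single j (Suc k)) :: _ \<Rightarrow>\<^sub>0 'k) = bas (single j k) \<otimes>\<^bsub>poly_alg m\<^esub> bas (single j 1)"
    unfolding poly_alg_sel(6) by (simp flip: single_add)
  then have "\<kappa> (bas (single j (Suc k))) = \<kappa> (bas (single j k)) \<otimes>\<^bsub>B\<^esub> y j"
    using kappa_simps(2)[OF bas_poly bas_poly, OF mindex_single mindex_single, OF j j, of k 1] by (simp only: gen_eq(3))
  then show ?case using Suc by simp
qed

lemma mpow_y: assumes e: "\<epsilon> \<in> mindex m" shows "mpow B m y \<epsilon> = \<kappa> (bas \<epsilon>)"
proof -
  let ?s = "\<lambda>k. \<Sum>j<k. single j (lookup \<epsilon> j)"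
  have s: "?s k \<in> mindex m" if "k \<le> m" for k
    using that by (induction k) (simp_all add: mindex_zero mindex_add mindex_single)
  have "oprod B (\<lambda>j. y j [^]\<^bsub>B\<^esub> lookup \<epsilon> j) k = \<kappa> (bas (?s k))" if "k \<le> m" for k
    using that
  proof (induction k)
    case 0
    then show ?case using iota_simps(5) by (simp add: poly_alg_sel)
  next
    case (Suc k)
    have c: "y j [^]\<^bsub>B\<^esub> lookup \<epsilon> j \<in> carrier B" if "j < Suc k" for j
      using that Suc.prems by (simp add: y_pow kappa_simps(1) bas_poly mindex_single)
    have "oprod B (\<lambda>j. y j [^]\<^bsub>B\<^esub> lookup \<epsilon> j) (Suc k)
        = \<kappa> (bas (?s k)) \<otimes>\<^bsub>B\<^esub> \<kappa> (bas (single k (lookup \<epsilon> k)))"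
      using B.oprod_Suc[of k "\<lambda>j. y j [^]\<^bsub>B\<^esub> lookup \<epsilon> j", OF c] Suc by (simp add: y_pow)
    also have "\<dots> = \<kappa> (bas (?s (Suc k)))"
      using Suc.prems s[of k] by (simp add: kappa_simps(2)[symmetric] bas_poly mindex_single poly_alg_sel(6))
    finally show ?case .
  qed
  moreover have "?s m = \<epsilon>"
    by (rule mindex_eqI[OF s[OF order.refl] e]) (simp add: lookup_sum lookup_single when_def)
  ultimately show ?thesis by (simp add: mpow_def)
qed

section \<open>Generation by \<open>x\<close>, \<open>\<partial>\<close> and \<open>y\<close>\<close>

abbreviation "G \<equiv> x ` {..<n} \<union> case_prod d ` ({..<n} \<times> UNIV) \<union> y ` {..<m}"

lemma zero_gen: "\<zero>\<^bsub>B\<^esub> \<in> B.gen_alg G"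
  using B.gen_alg.smult[OF B.gen_alg.one, of 0 G] by simp

lemma word_gen: "w \<in> lists (gens n) \<Longrightarrow> \<iota> (F.cls (bas w)) \<in> B.gen_alg G"
proof (induction w rule: lists.induct)
  case Nil
  have "\<iota> (F.cls (bas [])) = \<one>\<^bsub>B\<^esub>" using iota_simps(5) by (simp add: diff_ops_sel)
  then show ?case by (simp add: B.gen_alg.one)
next
  case (Cons g w)
  have c: "bas [g] \<in> carrier F" "bas w \<in> carrier F" using Cons by (simp_all add: free_alg_sel bas_def)
  have "bas (g # w) = bas [g] \<otimes>\<^bsub>F\<^esub> bas w" by (simp add: free_alg_def monoid_algebra_mult_bas)
  then have "F.cls (bas (g # w)) = F.cls (bas [g]) \<otimes>\<^bsub>diff_ops n\<^esub> F.cls (bas w)"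
    using c by (simp add: diff_ops_def F.quot_sel(5))
  then have *: "\<iota> (F.cls (bas (g # w))) = \<iota> (F.cls (bas [g])) \<otimes>\<^bsub>B\<^esub> \<iota> (F.cls (bas w))"
    using c by (simp add: iota_simps(2) diff_ops_sel)
  from Cons(1) consider i where "i < n" "g = GX i" | i k where "i < n" "1 \<le> k" "g = GD i k"
    by (auto simp: gens_def)
  then have "\<iota> (F.cls (bas [g])) \<in> G"
  proof cases
    case (1 i)
    then have "\<iota> (F.cls (bas [g])) = x i" by (simp add: gen_eq fX_def)
    then show ?thesis using 1 by auto
  next
    case (2 i k)
    then have "\<iota> (F.cls (bas [g])) = d i k" by (simp add: gen_eq fD_def)
    then show ?thesis using 2 by auto
  qed
  then show ?case unfolding * by (intro B.gen_alg.mult B.gen_alg.base Cons)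
qed

lemma iota_gen:
  assumes "u \<in> carrier (diff_ops n)"
  shows "\<iota> u \<in> B.gen_alg G"
proof -
  obtain f where f: "f \<in> carrier F" "u = F.cls f" using assms by (auto simp: diff_ops_sel)
  have "keys f \<subseteq> lists (gens n)" using f by (simp add: free_alg_sel)
  then have "\<iota> (F.cls f) \<in> B.gen_alg G"
  proof (induction f rule: poly_mapping_span_induct)
    case zero
    have "F.cls 0 = \<zero>\<^bsub>diff_ops n\<^esub>" by (simp only: diff_ops_def F.quot_sel(3) free_alg_sel)
    then show ?case
      using iota_simps(4)[OF D.one_closed, of 0] D.smult_0_left[OF D.one_closed] zero_gen
      by (simp add: iota_simps(5))
  next
    case (single w c)
    have b: "bas w \<in> carrier F" using single by (simp add: free_alg_sel bas_def)
    have "single w c = c \<odot>\<^bsub>F\<^esub> bas w" by (simp add: free_alg_def monoid_algebra_sel bas_def)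
    then have "F.cls (single w c) = c \<odot>\<^bsub>diff_ops n\<^esub> F.cls (bas w)"
      using b by (simp add: diff_ops_def F.quot_smult)
    then show ?case using iota_simps(4)[of "F.cls (bas w)" c] b word_gen[OF single]
      by (simp add: diff_ops_sel B.gen_alg.smult)
  next
    case (add f g)
    then have c: "f \<in> carrier F" "g \<in> carrier F" by (simp_all add: free_alg_sel)
    have "F.cls (f + g) = F.cls f \<oplus>\<^bsub>diff_ops n\<^esub> F.cls g"
      using c by (simp add: diff_ops_def F.quot_sel(4)) (simp add: free_alg_def monoid_algebra_sel)
    then show ?case using iota_simps(3)[of "F.cls f" "F.cls g"] c add B.gen_alg.add
      by (simp add: diff_ops_sel)
  qed
  then show ?thesis using f by simp
qed

lemma gen_alg_pow: "u \<in> B.gen_alg H \<Longrightarrow> u [^]\<^bsub>B\<^esub> (k::nat) \<in> B.gen_alg H"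
  by (induction k) (simp_all add: B.gen_alg.one B.gen_alg.mult)

lemma mpow_y_gen: "mpow B m y \<epsilon> \<in> B.gen_alg G"
proof -
  have "foldr (\<lambda>i u. y i [^]\<^bsub>B\<^esub> lookup \<epsilon> i \<otimes>\<^bsub>B\<^esub> u) L \<one>\<^bsub>B\<^esub> \<in> B.gen_alg G" if "set L \<subseteq> {..<m}" for L
    using that
    by (induction L) (auto intro!: B.gen_alg.one B.gen_alg.mult gen_alg_pow intro: B.gen_alg.base)
  from this[of "[0..<m]"] show ?thesis by (simp add: mpow_def oprod_def atLeast0LessThan)
qed

text \<open>
  The image of the polynomial algebra is spanned by the monomials in \<open>y\<close>.
\<close>

lemma kappa_induct:
  assumes f: "f \<in> carrier (poly_alg m)" and zero: "Q \<zero>\<^bsub>B\<^esub>"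
    and mono: "\<And>\<epsilon>. \<epsilon> \<in> mindex m \<Longrightarrow> Q (mpow B m y \<epsilon>)"
    and add: "\<And>u v. Q u \<Longrightarrow> Q v \<Longrightarrow> Q (u \<oplus>\<^bsub>B\<^esub> v)" and smult: "\<And>c u. Q u \<Longrightarrow> Q (c \<odot>\<^bsub>B\<^esub> u)"
  shows "Q (\<kappa> f)"
proof -
  have "keys f \<subseteq> mindex m" using f by (simp add: poly_alg_sel)
  then show ?thesis
  proof (induction f rule: poly_mapping_span_induct)
    case zero
    have "0 = 0 \<odot>\<^bsub>poly_alg m\<^esub> (bas 0 :: _ \<Rightarrow>\<^sub>0 'k)" by (simp add: poly_alg_sel scal_simps)
    then have "\<kappa> 0 = 0 \<odot>\<^bsub>B\<^esub> \<kappa> (bas 0)" using kappa_simps(4)[OF bas_poly[OF mindex_zero], of 0] by metis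
    then show ?case using assms(2) kappa_simps(1)[OF bas_poly[OF mindex_zero]] by simp
  next
    case (single \<epsilon> c)
    have "single \<epsilon> c = c \<odot>\<^bsub>poly_alg m\<^esub> bas \<epsilon>" by (simp add: poly_alg_sel bas_def scal_simps)
    then show ?case using smult[OF mono[OF single]] single by (simp add: kappa_simps(4) bas_poly mpow_y)
  next
    case (add f g)
    then show ?case using kappa_simps(3)[of f g] assms(4) by (simp add: poly_alg_sel)
  qed
qed

lemma generated: "carrier B \<subseteq> B.gen_alg G"
proof
  fix a assume "a \<in> carrier B"
  then have "a \<in> carrier A" by (simp add: A_eq_DP)
  then show "a \<in> B.gen_alg G"
  proof (induction a rule: A_induct)
    case (tens u f)
    have "\<kappa> f \<in> B.gen_alg G"
      by (rule kappa_induct[OF tens(2)]) (simp_all add: zero_gen mpow_y_gen B.gen_alg.add B.gen_alg.smult)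
    then show ?case unfolding iota_kappa(1)[OF tens, symmetric] by (intro B.gen_alg.mult iota_gen tens)
  qed (simp_all add: A_eq_DP B.gen_alg.add B.gen_alg.smult)
qed

lemma sub_P_eq: "sub_P n m = B.span (mpow B m y ` mindex m)"
proof
  have Y: "mpow B m y ` mindex m \<subseteq> carrier B"
    by (auto simp: mpow_y kappa_simps(1) bas_poly)
  show "sub_P n m \<subseteq> B.span (mpow B m y ` mindex m)"
  proof
    fix u :: "'k dpol" assume "u \<in> sub_P n m"
    then obtain f where f: "f \<in> carrier (poly_alg m)" "u = \<kappa> f" unfolding sub_P_def by blast
    show "u \<in> B.span (mpow B m y ` mindex m)"
      unfolding f(2) by (rule kappa_induct[OF f(1)])
        (simp_all add: B.span.zero B.span.add B.span.smult B.span.base)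
  qed
  have "B.subspace (sub_P n m)"
    unfolding sub_P_def
  proof (rule B.subspaceI)
    show "\<kappa> ` carrier (poly_alg m) \<subseteq> carrier B" by (auto simp: kappa_simps(1))
    have "\<zero>\<^bsub>B\<^esub> = \<kappa> (0 \<odot>\<^bsub>poly_alg m\<^esub> \<one>\<^bsub>poly_alg m\<^esub>)"
      by (simp only: kappa_simps(4)[OF P.one_closed] B.smult_0_left[OF kappa_simps(1)[OF P.one_closed]])
    then show "\<zero>\<^bsub>B\<^esub> \<in> \<kappa> ` carrier (poly_alg m)" by blast
  next
    fix u v assume "u \<in> \<kappa> ` carrier (poly_alg m)" "v \<in> \<kappa> ` carrier (poly_alg m)"
    then show "u \<oplus>\<^bsub>B\<^esub> v \<in> \<kappa> ` carrier (poly_alg m)"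
      by (auto simp: kappa_simps(3)[symmetric])
  next
    fix c u assume "u \<in> \<kappa> ` carrier (poly_alg m)"
    then show "c \<odot>\<^bsub>B\<^esub> u \<in> \<kappa> ` carrier (poly_alg m)"
      by (auto simp: kappa_simps(4)[symmetric])
  qed
  then show "B.span (mpow B m y ` mindex m) \<subseteq> sub_P n m"
    by (rule B.span_subset_subspace[rotated]) (auto simp: sub_P_def mpow_y bas_poly)
qed

section \<open>Higher derivations on \<open>P\<^sub>m\<close>\<close>

definition hasse_poly :: "(nat \<Rightarrow>\<^sub>0 nat) \<Rightarrow> ((nat \<Rightarrow>\<^sub>0 nat) \<Rightarrow>\<^sub>0 'k) \<Rightarrow> (nat \<Rightarrow>\<^sub>0 nat) \<Rightarrow>\<^sub>0 'k" where
  "hasse_poly \<gamma> = lin_ext (\<lambda>\<epsilon>. single (\<epsilon> - \<gamma>)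
     (of_nat (\<Prod>j<m. lookup \<epsilon> j choose lookup \<gamma> j)))"

lemma hasse_poly_props:
  "f \<in> carrier (poly_alg m) \<Longrightarrow> hasse_poly \<gamma> f \<in> carrier (poly_alg m)"
  "hasse_poly \<gamma> (f \<oplus>\<^bsub>poly_alg m\<^esub> f') = hasse_poly \<gamma> f \<oplus>\<^bsub>poly_alg m\<^esub> hasse_poly \<gamma> f'"
  "hasse_poly \<gamma> (c \<odot>\<^bsub>poly_alg m\<^esub> f) = c \<odot>\<^bsub>poly_alg m\<^esub> hasse_poly \<gamma> f"
proof -
  assume "f \<in> carrier (poly_alg m)"
  then have f: "keys f \<subseteq> mindex m" by (simp add: poly_alg_sel)
  have "keys (hasse_poly \<gamma> f) \<subseteq> mindex m"
    unfolding hasse_poly_def by (rule keys_lin_ext) (use f mindex_diff in auto)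
  then show "hasse_poly \<gamma> f \<in> carrier (poly_alg m)" by (simp add: poly_alg_sel)
qed (simp_all add: poly_alg_sel hasse_poly_def lin_ext_add lin_ext_scal)

text \<open>
  A linear map of polynomials preserves equality of the tensors \<open>1 \<otimes> f\<close>, hence descends to the image
  \<open>sub_P n m\<close> of the polynomial algebra.
\<close>

lemma hasse_derivation_exists:
  "\<exists>D. B.linear (sub_P n m) (sub_P n m) D \<and> (\<forall>\<epsilon>\<in>mindex m. D (mpow B m y \<epsilon>) =
        of_nat (\<Prod>j<m. lookup \<epsilon> j choose lookup \<gamma> j) \<odot>\<^bsub>B\<^esub> mpow B m y (\<epsilon> - \<gamma>))"
proof -
  define D where "D u = \<kappa> (hasse_poly \<gamma> (SOME f. f \<in> carrier (poly_alg m) \<and> \<kappa> f = u))" for u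
  have D: "D (\<kappa> f) = \<kappa> (hasse_poly \<gamma> f)" if f: "f \<in> carrier (poly_alg m)" for f
  proof -
    let ?f = "SOME f'. f' \<in> carrier (poly_alg m) \<and> \<kappa> f' = \<kappa> f"
    have sf: "?f \<in> carrier (poly_alg m) \<and> \<kappa> ?f = \<kappa> f" by (rule someI[of _ f]) (simp only: f simp_thms)
    show ?thesis unfolding D_def
      by (rule tens_one_map_well_defined[where g = "hasse_poly \<gamma>"])
        (simp_all only: hasse_poly_props f conjunct1[OF sf] conjunct2[OF sf] D.one_closed)
  qed
  have "B.linear (sub_P n m) (sub_P n m) D"
    unfolding sub_P_def
  proof (rule B.linearI)
    fix u assume "u \<in> \<kappa> ` carrier (poly_alg m)"
    then obtain f where f: "f \<in> carrier (poly_alg m)" "u = \<kappa> f" by blast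
    then show "D u \<in> \<kappa> ` carrier (poly_alg m)" using D hasse_poly_props(1) by simp
    show "D (c \<odot>\<^bsub>B\<^esub> u) = c \<odot>\<^bsub>B\<^esub> D u" for c
      using kappa_simps(4)[OF f(1), of c] D[OF f(1)] D[OF P.smult_closed[OF f(1)], of c]
        kappa_simps(4)[OF hasse_poly_props(1)[OF f(1)], of c \<gamma>]
      by (simp only: f(2) hasse_poly_props(3))
    fix v assume "v \<in> \<kappa> ` carrier (poly_alg m)"
    then obtain g where g: "g \<in> carrier (poly_alg m)" "v = \<kappa> g" by blast
    then show "D (u \<oplus>\<^bsub>B\<^esub> v) = D u \<oplus>\<^bsub>B\<^esub> D v"
      using kappa_simps(3)[OF f(1) g(1)] D[OF f(1)] D[OF g(1)] D[OF P.a_closed[OF f(1) g(1)]]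
        kappa_simps(3)[OF hasse_poly_props(1)[OF f(1)] hasse_poly_props(1)[OF g(1)], of \<gamma> \<gamma>]
      by (simp only: f(2) g(2) hasse_poly_props(2))
  qed
  moreover have "D (mpow B m y \<epsilon>) =
        of_nat (\<Prod>j<m. lookup \<epsilon> j choose lookup \<gamma> j) \<odot>\<^bsub>B\<^esub> mpow B m y (\<epsilon> - \<gamma>)"
    if e: "\<epsilon> \<in> mindex m" for \<epsilon>
  proof -
    let ?c = "of_nat (\<Prod>j<m. lookup \<epsilon> j choose lookup \<gamma> j) :: 'k"
    have "hasse_poly \<gamma> (bas \<epsilon>) = ?c \<odot>\<^bsub>poly_alg m\<^esub> bas (\<epsilon> - \<gamma>)"
      by (simp add: hasse_poly_def lin_ext_single poly_alg_sel bas_def scal_simps)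
    then show ?thesis using e mindex_diff[OF e, of \<gamma>]
      by (simp only: mpow_y D bas_poly kappa_simps(4))
  qed
  ultimately show ?thesis by blast
qed

lemma weyl_DP:
  assumes "CHAR('k) = p" "p > 0"
  shows "weyl B n m p x d y (sub_P n m)"
proof (intro weyl.intro B.kalg_axioms weyl_axioms.intro)
  fix i j k assume i: "i < n" and j: "j < n"
  note cl = XD_closed[OF i] XD_closed[OF j]
  show "x i \<otimes>\<^bsub>B\<^esub> x j = x j \<otimes>\<^bsub>B\<^esub> x i"
    using D_xx[OF i j] cl by (simp add: gen_eq iota_simps(2)[symmetric])
  show "d i k \<otimes>\<^bsub>B\<^esub> d j l = d j l \<otimes>\<^bsub>B\<^esub> d i k" for l
    using D_dd[OF i j, of k l] cl by (simp add: gen_eq iota_simps(2)[symmetric])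
  show "d i k \<otimes>\<^bsub>B\<^esub> x j = x j \<otimes>\<^bsub>B\<^esub> d i k" if "i \<noteq> j"
  proof (cases k)
    case 0
    then show ?thesis using cl by (simp add: gen_eq D_0 iota_simps)
  next
    case (Suc k')
    then show ?thesis using D_dx_general[OF i j, of k'] cl that
      by (simp add: gen_eq iota_simps(2)[symmetric])
  qed
next
  fix i k assume i: "i < n"
  note cl = XD_closed[OF i]
  show "x i \<in> carrier B" "d i k \<in> carrier B" using cl by (simp_all add: gen_eq iota_simps)
  show "d i 0 = \<one>\<^bsub>B\<^esub>" by (simp add: gen_eq D_0 iota_simps)
  show "d i k \<otimes>\<^bsub>B\<^esub> d i l = of_nat ((k + l) choose k) \<odot>\<^bsub>B\<^esub> d i (k + l)" for l
    using D_d_mult[OF i, of k l] cl by (simp add: gen_eq iota_simps(2,4)[symmetric])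
  show "d i (Suc k) \<otimes>\<^bsub>B\<^esub> x i = x i \<otimes>\<^bsub>B\<^esub> d i (Suc k) \<oplus>\<^bsub>B\<^esub> d i k"
    using D_dx_general[OF i i, of k] cl by (simp add: gen_eq iota_simps(2,3)[symmetric])
next
  fix j assume j: "j < m"
  then have "bas (single j 1) \<in> carrier (poly_alg m :: ('k, _) module)"
    by (simp add: bas_poly mindex_single)
  then show "y j \<in> carrier B" "a \<in> carrier B \<Longrightarrow> y j \<otimes>\<^bsub>B\<^esub> a = a \<otimes>\<^bsub>B\<^esub> y j" for a
    by (simp_all only: gen_eq kappa_simps(1) kappa_central)
qed (use assms generated sub_P_eq hasse_derivation_exists in auto)

end

section \<open>Automorphisms\<close>

lemma hom_oprod:
  assumes "monoid R" "monoid R'" "h \<in> hom R R'" "h \<one>\<^bsub>R\<^esub> = \<one>\<^bsub>R'\<^esub>" "\<And>i. i < k \<Longrightarrow> f i \<in> carrier R"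
  shows "h (oprod R f k) = oprod R' (\<lambda>i. h (f i)) k"
proof -
  have "h (foldr (\<lambda>i u. f i \<otimes>\<^bsub>R\<^esub> u) L \<one>\<^bsub>R\<^esub>) = foldr (\<lambda>i u. h (f i) \<otimes>\<^bsub>R'\<^esub> u) L \<one>\<^bsub>R'\<^esub>"
    if "set L \<subseteq> {..<k}" for L
    using that
  proof (induction L)
    case (Cons i L)
    have "foldr (\<lambda>i u. f i \<otimes>\<^bsub>R\<^esub> u) L \<one>\<^bsub>R\<^esub> \<in> carrier R"
      by (rule monoid.foldr_mult_closed[OF assms(1)]) (use Cons.prems assms(5) monoid.one_closed[OF assms(1)] in auto)
    then show ?case using Cons assms(5)[of i] hom_mult[OF assms(3)] by simp
  qed (simp add: assms(4))
  from this[of "[0..<k]"] show ?thesis by (simp add: oprod_def atLeast0LessThan)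
qed

context kalg
begin

lemma alg_Aut_props:
  assumes "\<sigma> \<in> alg_Aut A"
  shows "u \<in> carrier A \<Longrightarrow> \<sigma> u \<in> carrier A"
    "u \<in> carrier A \<Longrightarrow> v \<in> carrier A \<Longrightarrow> \<sigma> (u \<otimes> v) = \<sigma> u \<otimes> \<sigma> v"
    "u \<in> carrier A \<Longrightarrow> v \<in> carrier A \<Longrightarrow> \<sigma> (u \<oplus> v) = \<sigma> u \<oplus> \<sigma> v"
    "\<sigma> \<one> = \<one>" "u \<in> carrier A \<Longrightarrow> \<sigma> (c \<odot> u) = c \<odot> \<sigma> u"
    "bij_betw \<sigma> (carrier A) (carrier A)"
  using assms by (auto simp: alg_Aut_def ring_iso_def ring_hom_def)

lemma alg_Aut_zero: "\<sigma> \<in> alg_Aut A \<Longrightarrow> \<sigma> \<zero> = \<zero>"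
  using alg_Aut_props(5)[of \<sigma> \<one> 0] alg_Aut_props(1)[of \<sigma> \<one>] by simp

lemma inv_alg_Aut:
  assumes s: "\<sigma> \<in> alg_Aut A"
  shows "inv_into (carrier A) \<sigma> \<in> alg_Aut A"
proof -
  let ?t = "inv_into (carrier A) \<sigma>"
  note \<sigma> = alg_Aut_props[OF s]
  have inj: "inj_on \<sigma> (carrier A)" and im: "\<sigma> ` carrier A = carrier A"
    using \<sigma>(6) by (auto simp: bij_betw_def)
  have t: "?t u \<in> carrier A" "\<sigma> (?t u) = u" if "u \<in> carrier A" for u
    using that im inv_into_into[of u \<sigma> "carrier A"] f_inv_into_f[of u \<sigma> "carrier A"] by auto
  have eq: "?t v = u" if "u \<in> carrier A" "\<sigma> u = v" for u v
    using that inj by (auto simp: inv_into_f_f)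
  have "bij_betw ?t (carrier A) (carrier A)" by (rule bij_betw_inv_into[OF \<sigma>(6)])
  then show ?thesis
    unfolding alg_Aut_def ring_iso_def ring_hom_def
    using t \<sigma> by (auto intro!: eq)
qed

lemma alg_Aut_mpow:
  assumes s: "\<sigma> \<in> alg_Aut A" and x: "\<And>i. i < k \<Longrightarrow> x i \<in> carrier A"
  shows "\<sigma> (mpow A k x \<alpha>) = mpow A k (\<lambda>i. \<sigma> (x i)) \<alpha>"
proof -
  note \<sigma> = alg_Aut_props[OF s]
  have h: "\<sigma> \<in> hom A A" using \<sigma> by (auto simp: hom_def)
  have pow: "\<sigma> (u [^] (a::nat)) = \<sigma> u [^] a" if "u \<in> carrier A" for u a
    using that by (induction a) (simp_all add: \<sigma>)
  have "\<sigma> (mpow A k x \<alpha>) = oprod A (\<lambda>i. \<sigma> (x i [^] lookup \<alpha> i)) k"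
    unfolding mpow_def by (rule hom_oprod[OF is_monoid is_monoid h \<sigma>(4)]) (simp add: x)
  also have "\<dots> = mpow A k (\<lambda>i. \<sigma> (x i)) \<alpha>"
    unfolding mpow_def by (rule oprod_cong) (simp add: pow x)
  finally show ?thesis .
qed

lemma alg_Aut_dpow:
  assumes s: "\<sigma> \<in> alg_Aut A" and d: "\<And>i k. i < l \<Longrightarrow> d i k \<in> carrier A"
  shows "\<sigma> (dpow A l d \<alpha>) = dpow A l (\<lambda>i k. \<sigma> (d i k)) \<alpha>"
proof -
  note \<sigma> = alg_Aut_props[OF s]
  have h: "\<sigma> \<in> hom A A" using \<sigma> by (auto simp: hom_def)
  show ?thesis
    unfolding dpow_def by (rule hom_oprod[OF is_monoid is_monoid h \<sigma>(4)]) (simp add: d)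
qed

lemma alg_Aut_span_subset:
  assumes s: "\<sigma> \<in> alg_Aut A" and B: "B \<subseteq> carrier A"
  shows "\<sigma> ` span B \<subseteq> span (\<sigma> ` B)"
proof -
  note \<sigma> = alg_Aut_props[OF s]
  have "\<sigma> u \<in> span (\<sigma> ` B) \<and> u \<in> carrier A" if "u \<in> span B" for u
    using that
  proof induction
    case zero then show ?case by (simp add: alg_Aut_zero[OF s] span.zero)
  next
    case (base b) then show ?case using B by (auto intro: span.base)
  next
    case (add u v) then show ?case by (simp add: \<sigma> span.add)
  next
    case (smult u c) then show ?case by (simp add: \<sigma> span.smult)
  qed
  then show ?thesis by blast
qed

lemma alg_Aut_gen_alg_subset:
  assumes s: "\<sigma> \<in> alg_Aut A" and B: "B \<subseteq> carrier A"
  shows "\<sigma> ` gen_alg B \<subseteq> gen_alg (\<sigma> ` B)"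
proof -
  note \<sigma> = alg_Aut_props[OF s]
  have "\<sigma> u \<in> gen_alg (\<sigma> ` B) \<and> u \<in> carrier A" if "u \<in> gen_alg B" for u
    using that
  proof induction
    case one then show ?case by (simp add: \<sigma> gen_alg.one)
  next
    case (base b) then show ?case using B by (auto intro: gen_alg.base)
  next
    case (add u v) then show ?case by (simp add: \<sigma> gen_alg.add)
  next
    case (mult u v) then show ?case by (simp add: \<sigma> gen_alg.mult)
  next
    case (smult u c) then show ?case by (simp add: \<sigma> gen_alg.smult)
  qed
  then show ?thesis by blast
qed

lemma has_fsum_alg_Aut:
  assumes s: "\<sigma> \<in> alg_Aut A" and f: "has_fsum A f I t" "\<And>i. i \<in> I \<Longrightarrow> f i \<in> carrier A"
  shows "has_fsum A (\<lambda>i. \<sigma> (f i)) I (\<sigma> t)"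
proof -
  note \<sigma> = alg_Aut_props[OF s]
  let ?X = "fsupp A f I"
  have X: "finite ?X" "?X \<subseteq> I" "t = finsum A f ?X" using f by (auto simp: has_fsum_def fsupp_def fsum_def)
  have "finsum A (\<lambda>i. \<sigma> (f i)) X = \<sigma> (finsum A f X)" if "finite X" "X \<subseteq> I" for X
    using that
  proof (induction X rule: finite_induct)
    case empty
    then show ?case by (simp add: alg_Aut_zero[OF s])
  next
    case (insert i X)
    then have c: "f \<in> X \<rightarrow> carrier A" "f i \<in> carrier A" using f(2) by auto
    then have "(\<lambda>i. \<sigma> (f i)) \<in> X \<rightarrow> carrier A" using \<sigma>(1) by auto
    then show ?case using insert c by (simp add: \<sigma>)
  qed
  moreover have "fsupp A (\<lambda>i. \<sigma> (f i)) I \<subseteq> ?X"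
    by (auto simp: fsupp_def alg_Aut_zero[OF s])
  ultimately show ?thesis
    by (subst has_fsum_superset[OF X(1) _ X(2)]) (use f X \<sigma>(1) in auto)
qed

end

context weyl
begin

lemma alg_Aut_centre:
  assumes s: "\<sigma> \<in> alg_Aut A"
  shows "\<sigma> ` centre \<subseteq> centre"
proof
  note \<sigma> = alg_Aut_props[OF s]
  fix u assume "u \<in> \<sigma> ` centre"
  then obtain v where v: "v \<in> centre" "u = \<sigma> v" by blast
  have vc: "v \<in> carrier A" by (rule centreD(1)[OF v(1)])
  show "u \<in> centre"
  proof (rule centreI)
    show "u \<in> carrier A" using vc \<sigma>(1) v by simp
    fix a assume "a \<in> carrier A"
    then obtain b where b: "b \<in> carrier A" "a = \<sigma> b" using \<sigma>(6) by (auto simp: bij_betw_def)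
    have "u \<otimes> a = \<sigma> (v \<otimes> b)" using b v vc by (simp add: \<sigma>)
    also have "v \<otimes> b = b \<otimes> v" by (rule centreD(2)[OF v(1) b(1)])
    also have "\<sigma> (b \<otimes> v) = a \<otimes> u" using b v vc by (simp add: \<sigma>)
    finally show "u \<otimes> a = a \<otimes> u" .
  qed
qed

lemma alg_Aut_P: "\<sigma> \<in> alg_Aut A \<Longrightarrow> u \<in> P \<Longrightarrow> \<sigma> u \<in> P"
  using alg_Aut_centre centre_eq_P by blast

text \<open>
  The relations and generation are preserved because the automorphism is surjective and multiplicative.
  The centre is mapped onto itself and is equal to \<open>P\<close>, which gives the statements on \<open>P\<close>; the higher
  derivations are conjugated by the automorphism.
\<close>

lemma weyl_alg_Aut:
  assumes s: "\<sigma> \<in> alg_Aut A"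
  shows "weyl A n m p (\<lambda>i. \<sigma> (x i)) (\<lambda>i k. \<sigma> (d i k)) (\<lambda>j. \<sigma> (y j)) P"
proof (intro weyl.intro kalg_axioms weyl_axioms.intro char)
  note \<sigma> = alg_Aut_props[OF s]
  let ?t = "inv_into (carrier A) \<sigma>"
  have t: "?t \<in> alg_Aut A" by (rule inv_alg_Aut[OF s])
  have st: "\<sigma> (?t u) = u" if "u \<in> carrier A" for u
    using that \<sigma>(6) by (auto simp: bij_betw_def f_inv_into_f)
  have ts: "?t (\<sigma> u) = u" if "u \<in> carrier A" for u
    using that \<sigma>(6) by (auto simp: bij_betw_def)
  show "\<sigma> (x i) \<in> carrier A" "\<sigma> (d i k) \<in> carrier A" "\<sigma> (d i 0) = \<one>" if "i < n" for i k
    using that by (simp_all add: \<sigma>)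
  show "\<sigma> (y j) \<in> carrier A" if "j < m" for j using that by (simp add: \<sigma>)
  show "\<sigma> (x i) \<otimes> \<sigma> (x j) = \<sigma> (x j) \<otimes> \<sigma> (x i)" if "i < n" "j < n" for i j
    using that xx[OF that] by (simp flip: \<sigma>(2))
  show "\<sigma> (d i k) \<otimes> \<sigma> (d j l) = \<sigma> (d j l) \<otimes> \<sigma> (d i k)" if "i < n" "j < n" for i j k l
    using that dd[OF that, of k l] by (simp flip: \<sigma>(2))
  show "\<sigma> (d i k) \<otimes> \<sigma> (d i l) = of_nat ((k + l) choose k) \<odot> \<sigma> (d i (k + l))" if "i < n" for i k l
    using that d_mult[OF that, of k l] by (simp flip: \<sigma>(2,5))
  show "\<sigma> (d i k) \<otimes> \<sigma> (x j) = \<sigma> (x j) \<otimes> \<sigma> (d i k)" if "i < n" "j < n" "i \<noteq> j" for i j k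
    using that dx_ne[OF that, of k] by (simp flip: \<sigma>(2))
  show "\<sigma> (d i (Suc k)) \<otimes> \<sigma> (x i) = \<sigma> (x i) \<otimes> \<sigma> (d i (Suc k)) \<oplus> \<sigma> (d i k)" if "i < n" for i k
    using that dx[OF that, of k] by (simp flip: \<sigma>(2,3))
  show "\<sigma> (y j) \<otimes> a = a \<otimes> \<sigma> (y j)" if "j < m" "a \<in> carrier A" for j a
  proof -
    have "\<sigma> (y j) \<in> centre" using alg_Aut_centre[OF s] y_centre[OF that(1)] by blast
    then show ?thesis using that(2) by (rule centreD(2))
  qed
  have G: "generators \<subseteq> carrier A" by auto
  have "carrier A = \<sigma> ` carrier A" using \<sigma>(6) by (simp add: bij_betw_def)
  also have "\<dots> \<subseteq> gen_alg (\<sigma> ` generators)"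
    using alg_Aut_gen_alg_subset[OF s G] generated by blast
  also have "\<sigma> ` generators = (\<lambda>i. \<sigma> (x i)) ` {..<n} \<union> (\<lambda>(i, k). \<sigma> (d i k)) ` ({..<n} \<times> UNIV) \<union> (\<lambda>j. \<sigma> (y j)) ` {..<m}"
    by (simp add: image_Un image_image split_def)
  finally show "carrier A \<subseteq> gen_alg ((\<lambda>i. \<sigma> (x i)) ` {..<n} \<union> (\<lambda>(i, k). \<sigma> (d i k)) ` ({..<n} \<times> UNIV) \<union> (\<lambda>j. \<sigma> (y j)) ` {..<m})" .
  have Y': "mpow A m (\<lambda>j. \<sigma> (y j)) \<gamma> = \<sigma> (Y \<gamma>)" for \<gamma>
    by (rule alg_Aut_mpow[OF s, symmetric]) simp
  show "P = span (mpow A m (\<lambda>j. \<sigma> (y j)) ` mindex m)"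
  proof
    have "\<sigma> ` P \<subseteq> span (\<sigma> ` Y ` mindex m)"
      unfolding P by (rule alg_Aut_span_subset[OF s Y_subset])
    moreover have "P \<subseteq> \<sigma> ` P"
      using alg_Aut_P[OF t] st P_closed by (metis image_eqI subsetI)
    ultimately show "P \<subseteq> span (mpow A m (\<lambda>j. \<sigma> (y j)) ` mindex m)"
      by (simp add: Y' image_image)
    show "span (mpow A m (\<lambda>j. \<sigma> (y j)) ` mindex m) \<subseteq> P"
      by (rule span_subset_subspace[OF _ subspace_P]) (auto simp: Y' intro!: alg_Aut_P[OF s] Y_in_P)
  qed
  fix \<gamma> assume g: "\<gamma> \<in> mindex m"
  obtain D where D: "linear P P D" "\<forall>\<epsilon>\<in>mindex m. D (Y \<epsilon>) =
        of_nat (\<Prod>j<m. lookup \<epsilon> j choose lookup \<gamma> j) \<odot> Y (\<epsilon> - \<gamma>)"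
    using hasse_derivation[OF g] by blast
  have lin: "linear P P \<tau>" if \<tau>: "\<tau> \<in> alg_Aut A" for \<tau>
    by (rule linearI)
      (simp_all add: alg_Aut_P[OF \<tau>] alg_Aut_props(3)[OF \<tau>] alg_Aut_props(5)[OF \<tau>] P_closed)
  have "linear P P (\<lambda>u. \<sigma> (D (?t u)))"
    by (rule linear_comp[OF lin[OF s] linear_comp[OF D(1) lin[OF t]]])
  then show "\<exists>D. linear P P D \<and> (\<forall>\<epsilon>\<in>mindex m. D (mpow A m (\<lambda>j. \<sigma> (y j)) \<epsilon>) =
        of_nat (\<Prod>j<m. lookup \<epsilon> j choose lookup \<gamma> j) \<odot> mpow A m (\<lambda>j. \<sigma> (y j)) (\<epsilon> - \<gamma>))"
    using D(2) by (intro exI[of _ "\<lambda>u. \<sigma> (D (?t u))"]) (simp add: Y' ts \<sigma>(5))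
qed

lemma alg_Aut_scalar: "\<sigma> \<in> alg_Aut A \<Longrightarrow> u \<in> scalars \<Longrightarrow> \<sigma> u = u"
  by (auto simp: alg_Aut_props)

end

section \<open>The inversion formula\<close>

theorem theorem8p2:
  fixes p n m :: nat
    and A :: "('k::field, 'k dpol) module"
    and \<sigma> :: "'k dpol \<Rightarrow> 'k dpol"
    and x' y' :: "nat \<Rightarrow> 'k dpol"
    and d' :: "nat \<Rightarrow> nat \<Rightarrow> 'k dpol"
    and a :: "'k dpol"
  assumes char: "CHAR('k) = p" "p > 0"
    and A: "A = DP n m"
    and \<sigma>: "\<sigma> \<in> alg_Aut A"
    and x': "x' = (\<lambda>i. \<sigma> (gen_x n m i))"
    and d': "d' = (\<lambda>i k. \<sigma> (gen_d n m i k))"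
    and y': "y' = (\<lambda>j. \<sigma> (gen_y n m j))"
    and a: "a \<in> carrier A"
  shows
    "has_fsum A
       (\<lambda>(\<alpha>, \<beta>, \<gamma>). (-1) ^ mdeg n \<alpha> \<odot>\<^bsub>A\<^esub>
          (phi_P p A (sub_P n m) m y'
             (hderiv A (sub_P n m) m y' \<gamma>
               (phi_D p A n x' d' (mdelta A n x' \<beta> a \<otimes>\<^bsub>A\<^esub> dpow A n d' \<alpha>)))
           \<otimes>\<^bsub>A\<^esub> dpow A n (gen_d n m) \<beta> \<otimes>\<^bsub>A\<^esub> mpow A n (gen_x n m) \<alpha>
           \<otimes>\<^bsub>A\<^esub> mpow A m (gen_y n m) \<gamma>))
       (mindex n \<times> mindex n \<times> mindex m)
       (inv_into (carrier A) \<sigma> a)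
     \<and> has_fsum A
       (\<lambda>(\<alpha>, \<beta>, \<gamma>).
          phi_P p A (sub_P n m) m y'
             (hderiv A (sub_P n m) m y' \<gamma>
               (psi_D p A n x' d' (dpow A n d' \<alpha> \<otimes>\<^bsub>A\<^esub> mdelta A n x' \<beta> a)))
           \<otimes>\<^bsub>A\<^esub> mpow A n (gen_x n m) \<alpha> \<otimes>\<^bsub>A\<^esub> dpow A n (gen_d n m) \<beta>
           \<otimes>\<^bsub>A\<^esub> mpow A m (gen_y n m) \<gamma>)
       (mindex n \<times> mindex n \<times> mindex m)
       (inv_into (carrier A) \<sigma> a)"
proof -
  interpret W: weyl A n m p "gen_x n m" "gen_d n m" "gen_y n m" "sub_P n m"
    unfolding A by (rule DP_algebra.weyl_DP[OF char])
  \<comment> \<open>The expansions are taken in the primed coordinates and then transported back.\<close>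
  interpret W': weyl A n m p x' d' y' "sub_P n m"
    unfolding x' d' y' by (rule W.weyl_alg_Aut[OF \<sigma>])
  let ?t = "inv_into (carrier A) \<sigma>"
  have t: "?t \<in> alg_Aut A" by (rule W.inv_alg_Aut[OF \<sigma>])
  note tp = W.alg_Aut_props[OF t]
  have ts: "?t (\<sigma> u) = u" if "u \<in> carrier A" for u
    using that W.alg_Aut_props(6)[OF \<sigma>] by (auto simp: bij_betw_def)
  have "mpow A n x' \<alpha> = \<sigma> (mpow A n (gen_x n m) \<alpha>)" "dpow A n d' \<beta> = \<sigma> (dpow A n (gen_d n m) \<beta>)"
    "mpow A m y' \<gamma> = \<sigma> (mpow A m (gen_y n m) \<gamma>)" for \<alpha> \<beta> \<gamma>
    unfolding x' d' y' using W.alg_Aut_mpow[OF \<sigma>] W.alg_Aut_dpow[OF \<sigma>] by simp_all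
  then have mono: "?t (mpow A n x' \<alpha>) = mpow A n (gen_x n m) \<alpha>" "?t (dpow A n d' \<beta>) = dpow A n (gen_d n m) \<beta>"
    "?t (mpow A m y' \<gamma>) = mpow A m (gen_y n m) \<gamma>" for \<alpha> \<beta> \<gamma>
    using ts by simp_all
  \<comment> \<open>The coefficients are multiples of the unit, hence fixed by the inverse automorphism.\<close>
  have phi: "W'.phi_coeff \<alpha> \<beta> \<gamma> a \<in> carrier A" "?t (W'.phi_coeff \<alpha> \<beta> \<gamma> a) = W'.phi_coeff \<alpha> \<beta> \<gamma> a"
    and psi: "W'.psi_coeff \<alpha> \<beta> \<gamma> a \<in> carrier A" "?t (W'.psi_coeff \<alpha> \<beta> \<gamma> a) = W'.psi_coeff \<alpha> \<beta> \<gamma> a"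
    if "(\<alpha>, \<beta>, \<gamma>) \<in> W'.indices" for \<alpha> \<beta> \<gamma>
    using W.linearD(1)[OF W'.linear_phi_coeff[OF that] a] W.linearD(1)[OF W'.linear_psi_coeff[OF that] a]
      W'.scalar_closed W.alg_Aut_scalar[OF t] by blast+
  let ?f = "\<lambda>(\<alpha>, \<beta>, \<gamma>). (-1) ^ mdeg n \<alpha> \<odot>\<^bsub>A\<^esub>
      (W'.phi_coeff \<alpha> \<beta> \<gamma> a \<otimes>\<^bsub>A\<^esub> dpow A n d' \<beta> \<otimes>\<^bsub>A\<^esub> mpow A n x' \<alpha> \<otimes>\<^bsub>A\<^esub> mpow A m y' \<gamma>)"
  let ?g = "\<lambda>(\<alpha>, \<beta>, \<gamma>). W'.psi_coeff \<alpha> \<beta> \<gamma> a \<otimes>\<^bsub>A\<^esub> mpow A n x' \<alpha> \<otimes>\<^bsub>A\<^esub> dpow A n d' \<beta> \<otimes>\<^bsub>A\<^esub> mpow A m y' \<gamma>"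
  have "has_fsum A (\<lambda>\<tau>. ?t (?f \<tau>)) W'.indices (?t a)"
    by (rule W.has_fsum_alg_Aut[OF t W'.phi_expansion[OF a]]) (auto simp: phi)
  moreover have "?t (?f \<tau>) = (case \<tau> of (\<alpha>, \<beta>, \<gamma>) \<Rightarrow> (-1) ^ mdeg n \<alpha> \<odot>\<^bsub>A\<^esub>
      (W'.phi_coeff \<alpha> \<beta> \<gamma> a \<otimes>\<^bsub>A\<^esub> dpow A n (gen_d n m) \<beta> \<otimes>\<^bsub>A\<^esub> mpow A n (gen_x n m) \<alpha> \<otimes>\<^bsub>A\<^esub> mpow A m (gen_y n m) \<gamma>))"
    "?t (?f \<tau>) \<in> carrier A" if "\<tau> \<in> W'.indices" for \<tau>
    using that by (auto simp: tp phi mono)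
  ultimately have 1: "has_fsum A (\<lambda>(\<alpha>, \<beta>, \<gamma>). (-1) ^ mdeg n \<alpha> \<odot>\<^bsub>A\<^esub>
      (W'.phi_coeff \<alpha> \<beta> \<gamma> a \<otimes>\<^bsub>A\<^esub> dpow A n (gen_d n m) \<beta> \<otimes>\<^bsub>A\<^esub> mpow A n (gen_x n m) \<alpha> \<otimes>\<^bsub>A\<^esub> mpow A m (gen_y n m) \<gamma>))
      W'.indices (?t a)"
    by (subst W.has_fsum_cong[symmetric]) auto
  have "has_fsum A (\<lambda>\<tau>. ?t (?g \<tau>)) W'.indices (?t a)"
    by (rule W.has_fsum_alg_Aut[OF t W'.psi_expansion[OF a]]) (auto simp: psi)
  moreover have "?t (?g \<tau>) = (case \<tau> of (\<alpha>, \<beta>, \<gamma>) \<Rightarrow>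
      W'.psi_coeff \<alpha> \<beta> \<gamma> a \<otimes>\<^bsub>A\<^esub> mpow A n (gen_x n m) \<alpha> \<otimes>\<^bsub>A\<^esub> dpow A n (gen_d n m) \<beta> \<otimes>\<^bsub>A\<^esub> mpow A m (gen_y n m) \<gamma>)"
    "?t (?g \<tau>) \<in> carrier A" if "\<tau> \<in> W'.indices" for \<tau>
    using that by (auto simp: tp psi mono)
  ultimately have 2: "has_fsum A (\<lambda>(\<alpha>, \<beta>, \<gamma>).
      W'.psi_coeff \<alpha> \<beta> \<gamma> a \<otimes>\<^bsub>A\<^esub> mpow A n (gen_x n m) \<alpha> \<otimes>\<^bsub>A\<^esub> dpow A n (gen_d n m) \<beta> \<otimes>\<^bsub>A\<^esub> mpow A m (gen_y n m) \<gamma>)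
      W'.indices (?t a)"
    by (subst W.has_fsum_cong[symmetric]) auto
  show ?thesis
    using 1 2 unfolding W'.phi_coeff_def W'.psi_coeff_def ..
qed

end
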